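(* Let $d\ge 4$ be an integer, let $c\in\mathbb{R}$, let $c_*=(d-1)^{d-1}$, and let $$F_{c,d}(x_1,\dots,x_d)=\frac{1}{1-e_1+c\,e_d}=\sum_{\mathbf r\in\mathbb{Z}_{\ge0}^d} a_{\mathbf r}\,\mathbf x^{\mathbf r}$$ be the power series expansion at the origin, with diagonal coefficients $\delta_n=a_{n,\dots,n}$. If $c<c_*$, then $\delta_n>0$ for all but finitely many $n$. If $c>c_*$, then $\delta_n>0$ for infinitely many $n$ and $\delta_n<0$ for infinitely many $n$. Moreover, when $c<c_*$ there is a conical neighborhood $\mathcal N$ of the diagonal such that $a_{\mathbf r}>0$ for all but finitely many $\mathbf r\in\mathcal N$.
   Context: $e_1=x_1+\cdots+x_d$ and $e_d=x_1x_2\cdots x_d$. A conical neighborhood of the diagonal is an open cone in $(0,\infty)^d$ (closed under multiplication by positive scalars) containing $(1,\dots,1)$; "$\mathbf r\in\mathcal N$" refers to integer index vectors $\mathbf r\in\mathbb{Z}_{\ge0}^d\cap\mathcal N$. *)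

theory Defs
  imports "HOL-Analysis.Analysis"
begin

definition e1 :: "real ^ 'd \<Rightarrow> real" where
  "e1 x = (\<Sum>i\<in>UNIV. x $ i)"

definition ed :: "real ^ 'd \<Rightarrow> real" where
  "ed x = (\<Prod>i\<in>UNIV. x $ i)"

definition F :: "real \<Rightarrow> real ^ 'd \<Rightarrow> real" where
  "F c x = 1 / (1 - e1 x + c * ed x)"

definition c_star :: "nat \<Rightarrow> real" where
  "c_star d = (real d - 1) ^ (d - 1)"

definition monom_vec :: "real ^ 'd \<Rightarrow> nat ^ 'd \<Rightarrow> real" where
  "monom_vec x r = (\<Prod>i\<in>UNIV. (x $ i) ^ (r $ i))"

text \<open>
  The coefficient family is indexed by all exponent vectors and the sum is unordered (hence
  absolutely convergent). The condition determines \<open>a\<close> uniquely, since the expansion is required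
  on a full neighbourhood of the origin.
\<close>

definition has_power_series_at_0 :: "(real ^ 'd \<Rightarrow> real) \<Rightarrow> (nat ^ 'd \<Rightarrow> real) \<Rightarrow> bool" where
  "has_power_series_at_0 f a \<longleftrightarrow>
     (\<forall>\<^sub>F x in nhds 0. ((\<lambda>r. a r * monom_vec x r) has_sum f x) UNIV)"

definition diag_coeff :: "(nat ^ 'd \<Rightarrow> real) \<Rightarrow> nat \<Rightarrow> real" where
  "diag_coeff a n = a (\<chi> i. n)"

text \<open>
  The library predicate \<open>cone\<close> also asks for closure under multiplication by 0, which would be
  incompatible with being an open subset of the positive orthant.
\<close>

definition conical_nbhd_of_diagonal :: "(real ^ 'd) set \<Rightarrow> bool" where
  "conical_nbhd_of_diagonal N \<longleftrightarrow>
     open N \<and> N \<subseteq> {x. \<forall>i. x $ i > 0} \<and> (\<forall>x\<in>N. \<forall>t>0. t *\<^sub>R x \<in> N) \<and> (\<chi> i. 1) \<in> N"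

definition real_vec :: "nat ^ 'd \<Rightarrow> real ^ 'd" where
  "real_vec r = (\<chi> i. real (r $ i))"

lemma sum_words:
  fixes g :: "'l::finite \<Rightarrow> real"
  shows "finite {w::'l list. length w = k} \<and> (\<Sum>w | length w = k. prod_list (map g w)) = (sum g UNIV) ^ k"
proof (induction k)
  case 0
  then show ?case by simp
next
  case (Suc k)
  have eq: "{w::'l list. length w = Suc k} = (\<lambda>(l,w). l # w) ` (UNIV \<times> {w. length w = k})"
    by (auto simp: length_Suc_conv image_iff)
  have inj: "inj_on (\<lambda>(l,w). l # w) (UNIV \<times> {w::'l list. length w = k})"
    by (auto simp: inj_on_def)
  have "(\<Sum>w | length w = Suc k. prod_list (map g w))
      = (\<Sum>(l,w)\<in>UNIV \<times> {w. length w = k}. g l * prod_list (map g w))"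
    unfolding eq by (subst sum.reindex[OF inj]) (auto intro!: sum.cong)
  also have "\<dots> = sum g UNIV * (\<Sum>w | length w = k. prod_list (map g w))"
    by (simp add: sum.cartesian_product[symmetric] sum_product)
  finally show ?case using Suc eq by simp
qed

lemma words_has_sum:
  fixes g :: "'l::finite \<Rightarrow> real"
  assumes s: "(\<Sum>l\<in>UNIV. \<bar>g l\<bar>) < 1"
  shows "((\<lambda>w. prod_list (map g w)) has_sum (1 / (1 - sum g UNIV))) UNIV"
proof -
  define s where "s = (\<Sum>l\<in>UNIV. \<bar>g l\<bar>)"
  have s0: "0 \<le> s" "s < 1" using s by (auto simp: s_def sum_nonneg)
  have nrm: "norm (prod_list (map g w)) = prod_list (map (\<lambda>l. \<bar>g l\<bar>) w)" for w
    by (induction w) (auto simp: abs_mult)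
  have bd: "(\<Sum>w\<in>A. norm (prod_list (map g w))) \<le> 1 / (1 - s)" if "finite A" for A
  proof -
    define K where "K = Suc (Max (insert 0 (length ` A)))"
    have sub: "A \<subseteq> (\<Union>k<K. {w. length w = k})"
      using that by (auto simp: K_def less_Suc_eq_le)
    have "(\<Sum>w\<in>A. norm (prod_list (map g w)))
       \<le> (\<Sum>w\<in>(\<Union>k<K. {w. length w = k}). norm (prod_list (map g w)))"
      by (rule sum_mono2[OF _ sub]) (auto simp: sum_words)
    also have "\<dots> = (\<Sum>k<K. \<Sum>w | length w = k. norm (prod_list (map g w)))"
      by (rule sum.UNION_disjoint) (auto simp: sum_words)
    also have "\<dots> = (\<Sum>k<K. s ^ k)"
      unfolding nrm by (simp add: sum_words s_def)
    also have "\<dots> \<le> (\<Sum>k. s ^ k)"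
      using s0 by (intro sum_le_suminf summable_geometric) auto
    also have "\<dots> = 1 / (1 - s)" using s0 by (simp add: suminf_geometric)
    finally show ?thesis .
  qed
  have "(\<lambda>w. norm (prod_list (map g w))) summable_on UNIV"
    by (subst abs_summable_iff_bdd_above) (auto intro!: bdd_aboveI[where M = "1 / (1 - s)"] bd[simplified])
  then have "(\<lambda>w. prod_list (map g w)) summable_on UNIV"
    by (rule abs_summable_summable)
  then obtain S where S: "((\<lambda>w. prod_list (map g w)) has_sum S) UNIV"
    by (auto simp: summable_on_def)
  have "((\<lambda>(k,w). prod_list (map g w)) has_sum S) (Sigma UNIV (\<lambda>k::nat. {w. length w = k}))"
    using S by (subst has_sum_reindex_bij_witness[of _ "\<lambda>w. (length w, w)" snd]) auto
  then have "((\<lambda>k. (sum g UNIV) ^ k) has_sum S) UNIV"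
    by (rule has_sum_SigmaD) (auto intro!: has_sum_finiteI simp: sum_words)
  then have "(\<lambda>k. (sum g UNIV) ^ k) sums S" by (rule has_sum_imp_sums)
  moreover have "\<bar>sum g UNIV\<bar> < 1" using s by (rule le_less_trans[OF sum_abs])
  then have "(\<lambda>k. (sum g UNIV) ^ k) sums (1 / (1 - sum g UNIV))" by (intro geometric_sums) auto
  ultimately have "S = 1 / (1 - sum g UNIV)" by (rule sums_unique2)
  with S show ?thesis by simp
qed

text \<open>Existence of the expansion: the geometric series in \<open>e1 x - c * ed x\<close>, expanded into words over
  the alphabet of its summands and regrouped by monomials.\<close>

lemma F_has_power_series_at_0_exists: "\<exists>a. has_power_series_at_0 (F c :: real ^ 'd::finite \<Rightarrow> real) a"
proof -
  define ex :: "'d option list \<Rightarrow> nat ^ 'd" where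
    "ex w = (\<chi> i. count_list w (Some i) + count_list w None)" for w
  define co :: "'d option list \<Rightarrow> real" where "co w = (-c) ^ count_list w None" for w
  define g :: "real ^ 'd \<Rightarrow> 'd option \<Rightarrow> real" where
    "g x l = (case l of Some i \<Rightarrow> x $ i | None \<Rightarrow> - c * ed x)" for x l
  have U: "(UNIV :: 'd option set) = insert None (Some ` UNIV)" by (rule UNIV_option_conv)
  have w: "prod_list (map (g x) w) = co w * monom_vec x (ex w)" for x w
  proof (induction w)
    case Nil
    then show ?case by (simp add: co_def ex_def monom_vec_def)
  next
    case (Cons l w)
    show ?case
    proof (cases l)
      case None
      have "monom_vec x (ex (l # w)) = ed x * monom_vec x (ex w)"
        by (simp add: monom_vec_def ex_def ed_def None prod.distrib)
      then show ?thesis using Cons None by (simp add: g_def co_def)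
    next
      case (Some j)
      have "monom_vec x (ex (l # w)) = (\<Prod>i\<in>UNIV. (if i = j then x $ i else 1) * (x $ i) ^ (ex w $ i))"
        unfolding monom_vec_def by (intro prod.cong) (auto simp: ex_def Some)
      also have "\<dots> = x $ j * monom_vec x (ex w)"
        by (simp add: prod.distrib monom_vec_def)
      finally show ?thesis using Cons Some by (simp add: g_def co_def)
    qed
  qed
  have len: "length w \<le> (\<Sum>i\<in>UNIV. ex w $ i)" for w
  proof (induction w)
    case Nil
    then show ?case by simp
  next
    case (Cons l w)
    have "(\<Sum>i\<in>UNIV. ex w $ i) < (\<Sum>i\<in>UNIV. ex (l # w) $ i)"
      by (rule sum_strict_mono_ex1) (cases l; auto simp: ex_def)+
    with Cons show ?case by simp
  qed
  have fin: "finite {w. ex w = r}" for r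
  proof (rule finite_subset)
    show "{w. ex w = r} \<subseteq> (\<Union>k\<le>(\<Sum>i\<in>UNIV. r $ i). {w. length w = k})" using len by auto
  qed (auto simp: sum_words)
  define a where "a r = (\<Sum>w | ex w = r. co w)" for r
  have conv: "((\<lambda>r. a r * monom_vec x r) has_sum F c x) UNIV"
    if "(\<Sum>l\<in>UNIV. \<bar>g x l\<bar>) < 1" for x
  proof -
    have sg: "1 - sum (g x) UNIV = 1 - e1 x + c * ed x"
      unfolding U by (subst sum.insert) (auto simp: sum.reindex g_def e1_def)
    have "((\<lambda>w. co w * monom_vec x (ex w)) has_sum F c x) UNIV"
      using words_has_sum[OF that] by (simp add: w sg F_def)
    then have "((\<lambda>(r,w). co w * monom_vec x r) has_sum F c x) (Sigma UNIV (\<lambda>r. {w. ex w = r}))"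
      by (subst has_sum_reindex_bij_witness[of _ "\<lambda>w. (ex w, w)" snd]) auto
    then show ?thesis
      by (rule has_sum_SigmaD)
        (auto intro!: has_sum_finiteI simp: fin a_def sum_distrib_right)
  qed
  have "((\<lambda>x. \<Sum>l\<in>UNIV. \<bar>g x l\<bar>) \<longlongrightarrow> (\<Sum>l\<in>UNIV. \<bar>g 0 l\<bar>)) (nhds 0)"
  proof (intro tendsto_sum tendsto_rabs)
    fix l :: "'d option"
    have "continuous_on UNIV (\<lambda>x. g x l)"
      unfolding g_def ed_def by (cases l) (auto intro!: continuous_intros)
    then have "isCont (\<lambda>x. g x l) 0" by (simp add: continuous_on_eq_continuous_at)
    then show "((\<lambda>x. g x l) \<longlongrightarrow> g 0 l) (nhds 0)"
      by (simp add: tendsto_nhds_iff isCont_def)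
  qed
  moreover have "g 0 l = 0" for l by (cases l) (auto simp: g_def ed_def)
  ultimately have "\<forall>\<^sub>F x in nhds 0. (\<Sum>l\<in>UNIV. \<bar>g x l\<bar>) < 1"
    by (intro order_tendstoD(2)[where y = "0::real"]) auto
  then have "has_power_series_at_0 (F c) a"
    unfolding has_power_series_at_0_def by (rule eventually_mono) (rule conv)
  then show ?thesis by blast
qed

end

theory Submission
  imports Defs "HOL-Probability.Probability" "HOL-Complex_Analysis.Complex_Analysis"
    "HOL-Real_Asymp.Real_Asymp"
begin

text \<open>
  For \<open>c > c_star d\<close> the diagonal series is \<open>G (z / (1 + c z)^d) / (1 + c z)\<close>, where \<open>G\<close> is the
  diagonal series for \<open>c = 0\<close> and converges for \<open>|w| < d^(-d)\<close>. Since \<open>d^d z < (1 + c z)^d\<close> for all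
  \<open>z \<ge> 0\<close> exactly when \<open>c > c_star d\<close>, the series continues analytically along the whole positive
  axis and tends to 0 there. By Pringsheim's theorem this is impossible for a series whose
  coefficients eventually have a constant sign.

  For \<open>0 < c < c_star d\<close> single out one coordinate \<open>j0\<close>; the coefficient of \<open>x_j0^n\<close> in \<open>F\<close> is
  \<open>(1 - c p)^n / (1 - s)^(n+1)\<close> with \<open>s\<close> and \<open>p\<close> the sum and the product of the other variables.
  Integrating over the torus through the positive critical point for the direction \<open>r\<close> gives a
  Fourier integral. Its integrand is largest in modulus at the centre only: on the diagonal this is
  the inequality \<open>|1 - z_1 ... z_k| \<le> |(1 - z_1) + ... + (1 - z_k)|\<close> for complex numbers of modulus 1,
  and the resulting Gaussian bound is stable under small changes of the direction. On the scale
  \<open>1 / sqrt n\<close> the phase is negligible, so the real part of the integral is positive.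
\<close>

text \<open>Coefficients are identified only through the recurrence coming from
  \<open>F c x * (1 - e1 x + c * ed x) = 1\<close>: a family on integer vectors that satisfies it
  and vanishes off the nonnegative ones is the coefficient family. This takes the place of Cauchy's
  formula in several variables; the point to prove about a candidate such as the Fourier integral is
  its vanishing at negative indices. With n = r_j0 and \<alpha>_i = r_i / n, stationarity of (1 - c
  p)^n / (1 - s)^(n+1) / prod y_i^r_i in the radii y_i reads \<beta>_i = \<alpha>_i + \<tau>. One
  unknown \<tau> remains, subject to \<tau> V^(d-1) = c prod (\<alpha>_i + \<tau>), the product over
  all i, with V = sum \<alpha>_i + (d-1) \<tau>. Both sides have degree d in \<tau>, with leading
  coefficients (d-1)^(d-1) and c. For c below \<open>c_star\<close> a root therefore exists and
  stays bounded over all directions near the diagonal; this makes the threshold on n uniform, as a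
  cone of directions demands. For c <= 0 every term of the recurrence is nonnegative and positivity
  is immediate.\<close>

subsection \<open>Uniqueness of coefficients and the recurrence\<close>

lemma has_sum_minus:
  fixes f g :: "'a \<Rightarrow> real"
  assumes "(f has_sum s) A" "(g has_sum t) A"
  shows "((\<lambda>x. f x - g x) has_sum (s - t)) A"
  using has_sum_add[OF assms(1), of "\<lambda>x. - g x" "- t"] assms(2) by (simp add: has_sum_uminus)

lemma has_sum_finite_sum:
  fixes f :: "'i \<Rightarrow> 'a \<Rightarrow> real"
  assumes "finite I" "\<And>i. i \<in> I \<Longrightarrow> (f i has_sum s i) A"
  shows "((\<lambda>x. \<Sum>i\<in>I. f i x) has_sum (\<Sum>i\<in>I. s i)) A"
  using assms by (induction I) (auto intro: has_sum_add)

lemma has_sum_real_bound: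
  fixes f g :: "'a \<Rightarrow> real"
  assumes "(f has_sum s) A" "(g has_sum t) A" "\<And>x. x \<in> A \<Longrightarrow> \<bar>f x\<bar> \<le> g x"
  shows "\<bar>s\<bar> \<le> t"
proof -
  have "s \<le> t" using assms(1,2) by (rule has_sum_mono) (use assms(3) abs_le_D1 in blast)
  moreover have "((\<lambda>x. - f x) has_sum - s) A" using assms(1) by (simp add: has_sum_uminus)
  then have "- s \<le> t" using assms(2) by (rule has_sum_mono) (use assms(3) abs_le_D2 in blast)
  ultimately show ?thesis by simp
qed

lemma finite_bounded_nat_vec: "finite {r :: nat ^ 'd::finite. \<forall>i. r $ i \<le> m}"
proof -
  have "finite (PiE (UNIV :: 'd set) (\<lambda>_. {..m}))" by (intro finite_PiE) auto
  then have "finite (vec_lambda ` (PiE (UNIV :: 'd set) (\<lambda>_. {..m})))" by simp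
  moreover have "{r :: nat ^ 'd. \<forall>i. r $ i \<le> m} \<subseteq> vec_lambda ` (PiE UNIV (\<lambda>_. {..m}))"
  proof
    fix r :: "nat ^ 'd" assume "r \<in> {r. \<forall>i. r $ i \<le> m}"
    then have "(\<lambda>i. r $ i) \<in> PiE UNIV (\<lambda>_. {..m})" by auto
    moreover have "r = vec_lambda (\<lambda>i. r $ i)" by simp
    ultimately show "r \<in> vec_lambda ` (PiE UNIV (\<lambda>_. {..m}))" by blast
  qed
  ultimately show ?thesis by (rule rev_finite_subset)
qed

text \<open>Among the coefficient vectors of least total degree pick one, \<open>r0\<close>, of largest Euclidean
  norm. With \<open>L\<close> large, the weights \<open>L - r0 $ i\<close> make \<open>r0\<close> the unique vector of least weighted
  degree, so along the curve \<open>x $ i = t ^ (L - r0 $ i)\<close> its monomial dominates as \<open>t\<close> tends to 0.\<close>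

lemma power_series_unique:
  fixes b :: "nat ^ 'd::finite \<Rightarrow> real"
  assumes ev: "\<forall>\<^sub>F x in nhds 0. ((\<lambda>r. b r * monom_vec x r) has_sum 0) UNIV"
  shows "b r = 0"
proof (rule ccontr)
  assume "b r \<noteq> 0"
  define size where "size r = (\<Sum>i\<in>UNIV. r $ i)" for r :: "nat ^ 'd"
  define m where "m = (LEAST m. \<exists>r. b r \<noteq> 0 \<and> size r = m)"
  have exm: "\<exists>r. b r \<noteq> 0 \<and> size r = m"
    unfolding m_def by (rule LeastI_ex) (use \<open>b r \<noteq> 0\<close> in blast)
  have m_min: "m \<le> size r" if "b r \<noteq> 0" for r
    unfolding m_def by (rule Least_le) (use that in blast)
  have le_size: "r $ i \<le> size r" for r i
    unfolding size_def by (rule member_le_sum) auto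
  define R where "R = {r. b r \<noteq> 0 \<and> size r = m}"
  have "R \<subseteq> {r. \<forall>i. r $ i \<le> m}" using le_size by (force simp: R_def)
  then have "finite R" by (rule finite_subset) (rule finite_bounded_nat_vec)
  moreover have "R \<noteq> {}" using exm by (auto simp: R_def)
  define q where "q r = (\<Sum>i\<in>UNIV. (r $ i)\<^sup>2)" for r :: "nat ^ 'd"
  obtain r0 where r0: "r0 \<in> R" "\<And>r. r \<in> R \<Longrightarrow> q r \<le> q r0"
  proof -
    have "Max (q ` R) \<in> q ` R" using \<open>finite R\<close> \<open>R \<noteq> {}\<close> by (intro Max_in) auto
    then obtain r0 where "r0 \<in> R" "q r0 = Max (q ` R)" by auto
    then show ?thesis using that \<open>finite R\<close> by (metis Max_ge finite_imageI imageI)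
  qed
  \<comment> \<open>This value gives L m < (m^2 + 1) (m + 1), so every vector of total degree above
    m has larger weighted degree than \<open>r0\<close>.\<close>
  define L where "L = m\<^sup>2 + m + 1"
  define w where "w i = L - r0 $ i" for i
  define e where "e r = (\<Sum>i\<in>UNIV. w i * r $ i)" for r :: "nat ^ 'd"
  have r0m: "r0 $ i \<le> m" for i using le_size[of r0 i] r0(1) by (simp add: R_def)
  have wm: "w i \<ge> m\<^sup>2 + 1" for i using r0m[of i] by (simp add: w_def L_def)
  have int_e: "int (e r) = int L * int (size r) - (\<Sum>i\<in>UNIV. int (r0 $ i) * int (r $ i))" for r
  proof -
    have "int (w i * r $ i) = int L * int (r $ i) - int (r0 $ i) * int (r $ i)" for i
    proof -
      have "int (w i) = int L - int (r0 $ i)"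
        unfolding w_def by (rule of_nat_diff) (use r0m[of i] in \<open>simp add: L_def\<close>)
      then show ?thesis by (simp only: of_nat_mult left_diff_distrib)
    qed
    then show ?thesis
      by (simp only: e_def size_def of_nat_sum sum_subtractf sum_distrib_left)
  qed
  have gap: "e r0 + 1 \<le> e r" if br: "b r \<noteq> 0" and ne: "r \<noteq> r0" for r
  proof (cases "size r = m")
    case True
    then have "q r \<le> q r0" using br r0 by (simp add: R_def)
    \<comment> \<open>Since r differs from r0 and is no longer than it, expanding the squared
      distance shows that the inner product of r with r0 is less than that of r0 with
      itself.\<close>
    have "0 < (\<Sum>i\<in>UNIV. (int (r $ i) - int (r0 $ i))\<^sup>2)"
    proof -
      obtain i where "r $ i \<noteq> r0 $ i" using ne by (auto simp: vec_eq_iff)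
      then show ?thesis by (intro sum_pos2[of _ i]) auto
    qed
    also have "\<dots> = int (q r) + int (q r0) - 2 * (\<Sum>i\<in>UNIV. int (r0 $ i) * int (r $ i))"
      by (simp add: q_def power2_diff sum.distrib sum_subtractf sum_distrib_left mult_ac)
    finally have "(\<Sum>i\<in>UNIV. int (r0 $ i) * int (r $ i)) < int (q r0)" using \<open>q r \<le> q r0\<close> by linarith
    moreover have "int (q r0) = (\<Sum>i\<in>UNIV. int (r0 $ i) * int (r0 $ i))"
      by (simp add: q_def power2_eq_square)
    ultimately have "int (e r0) < int (e r)"
      using int_e[of r] int_e[of r0] True r0(1) by (simp add: R_def)
    then show ?thesis by linarith
  next
    case False
    then have "m + 1 \<le> size r" using m_min[OF br] by simp
    have "e r0 \<le> L * size r0"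
      unfolding e_def size_def sum_distrib_left by (intro sum_mono) (simp add: w_def)
    also have "\<dots> < (m\<^sup>2 + 1) * (m + 1)"
      using r0(1) by (simp add: R_def L_def power2_eq_square algebra_simps)
    also have "\<dots> \<le> (m\<^sup>2 + 1) * size r" using \<open>m + 1 \<le> size r\<close> by (rule mult_left_mono) simp
    also have "\<dots> \<le> e r"
      unfolding e_def size_def sum_distrib_left by (intro sum_mono mult_right_mono wm) simp
    finally show ?thesis by simp
  qed
  define x where "x t = (\<chi> i. t ^ w i)" for t :: real
  have mono_x: "monom_vec (x t) r = t ^ e r" for t r
    by (simp add: monom_vec_def x_def e_def power_sum power_mult)
  have "((\<lambda>t. x t) \<longlongrightarrow> x 0) (at_right 0)"
    unfolding x_def by (intro tendsto_intros)
  moreover have "w i > 0" for i using wm[of i] by simp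
  then have "x 0 = 0" by (auto simp: x_def vec_eq_iff)
  ultimately have "(x \<longlongrightarrow> 0) (at_right 0)" by simp
  then have "\<forall>\<^sub>F t in at_right 0. ((\<lambda>r. b r * monom_vec (x t) r) has_sum 0) UNIV"
    by (rule eventually_compose_filterlim[OF ev])
  then obtain t0 where t0: "t0 > 0" "\<And>t. 0 < t \<Longrightarrow> t < t0 \<Longrightarrow> ((\<lambda>r. b r * t ^ e r) has_sum 0) UNIV"
    unfolding mono_x by (auto simp: eventually_at_right_field)
  define t1 where "t1 = t0 / 2"
  have t1: "0 < t1" "t1 < t0" using t0(1) by (auto simp: t1_def)
  have "(\<lambda>r. \<bar>b r * t1 ^ e r\<bar>) summable_on UNIV"
    using t0(2)[OF t1] has_sum_imp_summable summable_on_iff_abs_summable_on_real by fastforce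
  then obtain S where S: "((\<lambda>r. \<bar>b r * t1 ^ e r\<bar>) has_sum S) UNIV"
    by (auto simp: summable_on_def)
  \<comment> \<open>Relative to its value at \<open>t1\<close>, every term other than the one at
    \<open>r0\<close> gains at least \<open>Suc (e r0)\<close> factors \<open>t / t1\<close>, one
    more than the term at \<open>r0\<close>.\<close>
  have bound: "\<bar>b r0\<bar> * t1 ^ Suc (e r0) \<le> t * S" if t: "0 < t" "t < t1" for t
  proof -
    have "((\<lambda>r. if r = r0 then b r0 * t ^ e r0 else 0) has_sum (b r0 * t ^ e r0)) UNIV"
      by (rule has_sum_finite_neutralI[of "{r0}"]) auto
    from has_sum_minus[OF t0(2)[of t] this]
    have "((\<lambda>r. if r = r0 then 0 else b r * t ^ e r) has_sum (0 - b r0 * t ^ e r0)) UNIV"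
      using t t1 by (simp add: if_distrib if_distribR cong: if_cong)
    moreover have "((\<lambda>r. (t / t1) ^ Suc (e r0) * \<bar>b r * t1 ^ e r\<bar>) has_sum ((t / t1) ^ Suc (e r0) * S)) UNIV"
      using S by (rule has_sum_cmult_right)
    moreover have "\<bar>if r = r0 then 0 else b r * t ^ e r\<bar> \<le> (t / t1) ^ Suc (e r0) * \<bar>b r * t1 ^ e r\<bar>" for r
    proof (cases "r = r0 \<or> b r = 0")
      case True
      then show ?thesis using t t1 by auto
    next
      case False
      then have "(t / t1) ^ e r \<le> (t / t1) ^ Suc (e r0)"
        using gap[of r] t t1 by (intro power_decreasing) auto
      then have "(t / t1) ^ e r * \<bar>b r * t1 ^ e r\<bar> \<le> (t / t1) ^ Suc (e r0) * \<bar>b r * t1 ^ e r\<bar>"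
        by (rule mult_right_mono) simp
      moreover have "(t / t1) ^ e r * \<bar>b r * t1 ^ e r\<bar> = \<bar>b r * t ^ e r\<bar>"
        using t t1 by (simp add: abs_mult power_divide)
      ultimately show ?thesis using False by simp
    qed
    ultimately have "\<bar>0 - b r0 * t ^ e r0\<bar> \<le> (t / t1) ^ Suc (e r0) * S"
      by (rule has_sum_real_bound)
    then have "\<bar>b r0\<bar> * t ^ e r0 * t1 ^ Suc (e r0) \<le> t ^ Suc (e r0) * S"
      using t t1 by (simp add: abs_mult power_divide field_simps del: power_Suc)
    then have "t ^ e r0 * (\<bar>b r0\<bar> * t1 ^ Suc (e r0)) \<le> t ^ e r0 * (t * S)"
      by (simp add: mult_ac)
    then show ?thesis using t by (simp del: power_Suc)
  qed
  have "((\<lambda>t. t * S) \<longlongrightarrow> 0 * S) (at_right 0)" by (intro tendsto_intros)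
  moreover have "\<forall>\<^sub>F t in at_right 0. \<bar>b r0\<bar> * t1 ^ Suc (e r0) \<le> t * S"
    using eventually_at_right_less[of "0::real"] bound t1(1)
    by (auto simp: eventually_at_right_field intro!: exI[of _ t1])
  ultimately have "\<bar>b r0\<bar> * t1 ^ Suc (e r0) \<le> 0 * S"
    by (intro tendsto_lowerbound[where F = "at_right 0"]) auto
  then have "\<bar>b r0\<bar> * t1 ^ Suc (e r0) \<le> 0 * t1 ^ Suc (e r0)" by simp
  then have "\<bar>b r0\<bar> \<le> 0" by (rule mult_right_le_imp_le) (use t1 in simp)
  then show False using r0(1) by (simp add: R_def)
qed

text \<open>Extension by zero to integer vectors, so that the recurrence has the same form at the
  boundary of the orthant as inside it.\<close>

definition coeff_ext :: "(nat ^ 'd \<Rightarrow> real) \<Rightarrow> ('d \<Rightarrow> int) \<Rightarrow> real" where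
  "coeff_ext a q = (if \<forall>i. 0 \<le> q i then a (\<chi> i. nat (q i)) else 0)"

lemma coeff_ext_neg: "q i < 0 \<Longrightarrow> coeff_ext a q = 0"
proof -
  assume "q i < 0"
  then have "\<not> (\<forall>i. 0 \<le> q i)" by (auto simp: not_le)
  then show ?thesis unfolding coeff_ext_def by (rule if_not_P)
qed

lemma monom_vec_shift_has_sum:
  fixes a :: "nat ^ 'd::finite \<Rightarrow> real" and v :: "nat ^ 'd"
  assumes "((\<lambda>r. a r * monom_vec x r) has_sum S) UNIV"
  shows "((\<lambda>r. coeff_ext a (\<lambda>i. int (r $ i) - int (v $ i)) * monom_vec x r) has_sum (monom_vec x v * S)) UNIV"
proof -
  have inj: "inj (\<lambda>r. r + v)" by (auto simp: inj_on_def)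
  have "((\<lambda>r. monom_vec x v * (a r * monom_vec x r)) has_sum (monom_vec x v * S)) UNIV"
    using assms by (rule has_sum_cmult_right)
  also have "(\<lambda>r. monom_vec x v * (a r * monom_vec x r))
      = (\<lambda>r. coeff_ext a (\<lambda>i. int (r $ i) - int (v $ i)) * monom_vec x r) \<circ> (\<lambda>r. r + v)"
    by (auto simp: coeff_ext_def monom_vec_def fun_eq_iff power_add prod.distrib)
  finally have "((\<lambda>r. coeff_ext a (\<lambda>i. int (r $ i) - int (v $ i)) * monom_vec x r) has_sum (monom_vec x v * S))
      (range (\<lambda>r. r + v))"
    unfolding has_sum_reindex[OF inj] .
  then show ?thesis
  proof (rule has_sum_cong_neutral[THEN iffD1, rotated -1])
    fix r assume "r \<in> UNIV - range (\<lambda>r. r + v)"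
    then have "r \<noteq> (r - v) + v" by blast
    then obtain i where "r $ i \<noteq> r $ i - v $ i + v $ i" by (auto simp: vec_eq_iff)
    then have "r $ i < v $ i" by simp
    then have "int (r $ i) - int (v $ i) < 0" by simp
    then show "coeff_ext a (\<lambda>i. int (r $ i) - int (v $ i)) * monom_vec x r = 0"
      by (simp add: coeff_ext_neg[of "\<lambda>i. int (r $ i) - int (v $ i)" i])
  qed auto
qed

text \<open>Comparison of coefficients in \<open>F c x * (1 - e1 x + c * ed x) = 1\<close>, valid
  near 0 where the denominator does not vanish. A vector with a negative entry makes every term
  0.\<close>

lemma coeff_recurrence:
  fixes a :: "nat ^ 'd::finite \<Rightarrow> real"
  assumes ps: "has_power_series_at_0 (F c) a"
  shows "coeff_ext a q = of_bool (q = (\<lambda>_. 0)) + (\<Sum>i\<in>UNIV. coeff_ext a (q(i := q i - 1)))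
            - c * coeff_ext a (\<lambda>i. q i - 1)"
proof (cases "\<forall>i. 0 \<le> q i")
  case False
  then obtain j where j: "q j < 0" by (auto simp: not_le)
  have "coeff_ext a (q(i := q i - 1)) = 0" for i
    using j by (intro coeff_ext_neg[of _ j]) auto
  moreover have "coeff_ext a (\<lambda>i. q i - 1) = 0" "coeff_ext a q = 0"
    using j by (auto intro!: coeff_ext_neg[of _ j])
  ultimately show ?thesis using j by auto
next
  case True
  define E where "E v r = coeff_ext a (\<lambda>i. int (r $ i) - int (v $ i))" for v r :: "nat ^ 'd"
  define b where "b r = E 0 r - of_bool (r = 0) - (\<Sum>i\<in>UNIV. E (axis i 1) r) + c * E 1 r" for r
  have "((\<lambda>x::real^'d. 1 - e1 x + c * ed x) \<longlongrightarrow> 1 - e1 (0::real^'d) + c * ed (0::real^'d)) (nhds 0)"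
  proof -
    have "continuous_on UNIV (\<lambda>x::real^'d. 1 - e1 x + c * ed x)"
      unfolding e1_def ed_def by (intro continuous_intros)
    then have "isCont (\<lambda>x::real^'d. 1 - e1 x + c * ed x) 0"
      by (simp add: continuous_on_eq_continuous_at)
    then show ?thesis by (simp add: tendsto_nhds_iff isCont_def)
  qed
  then have "\<forall>\<^sub>F x::real^'d in nhds 0. 1 - e1 x + c * ed x \<noteq> 0"
    by (rule tendsto_imp_eventually_ne) (simp add: e1_def ed_def zero_power)
  moreover have "\<forall>\<^sub>F x in nhds 0. ((\<lambda>r. a r * monom_vec x r) has_sum F c x) UNIV"
    using ps by (simp add: has_power_series_at_0_def)
  ultimately have "\<forall>\<^sub>F x in nhds 0. ((\<lambda>r. b r * monom_vec x r) has_sum 0) UNIV"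
  proof eventually_elim
    case (elim x)
    have sh: "((\<lambda>r. E v r * monom_vec x r) has_sum (monom_vec x v * F c x)) UNIV" for v
      unfolding E_def by (rule monom_vec_shift_has_sum) (use elim in simp)
    have m0: "monom_vec x 0 = 1" by (simp add: monom_vec_def)
    have m1: "monom_vec x 1 = ed x" by (simp add: monom_vec_def ed_def)
    have max: "monom_vec x (axis i 1) = x $ i" for i
    proof -
      have "monom_vec x (axis i 1) = (\<Prod>j\<in>UNIV. if j = i then x $ j else 1)"
        unfolding monom_vec_def axis_def by (intro prod.cong) auto
      then show ?thesis by simp
    qed
    have one: "((\<lambda>r. of_bool (r = 0) * monom_vec x r) has_sum 1) UNIV"
      by (rule has_sum_finite_neutralI[of "{0}"]) (auto simp: m0)
    have "((\<lambda>r. E 0 r * monom_vec x r - of_bool (r = 0) * monom_vec x r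
          - (\<Sum>i\<in>UNIV. E (axis i 1) r * monom_vec x r) + c * (E 1 r * monom_vec x r))
        has_sum (1 * F c x - 1 - (\<Sum>i\<in>UNIV. x $ i * F c x) + c * (ed x * F c x))) UNIV"
    proof (intro has_sum_add has_sum_minus has_sum_finite_sum has_sum_cmult_right one)
      show "((\<lambda>r. E 0 r * monom_vec x r) has_sum 1 * F c x) UNIV" using sh[of 0] unfolding m0 .
      show "((\<lambda>r. E 1 r * monom_vec x r) has_sum ed x * F c x) UNIV" using sh[of 1] unfolding m1 .
      show "((\<lambda>r. E (axis i 1) r * monom_vec x r) has_sum x $ i * F c x) UNIV" for i
        using sh[of "axis i 1"] unfolding max .
    qed simp
    moreover have "1 * F c x - 1 - (\<Sum>i\<in>UNIV. x $ i * F c x) + c * (ed x * F c x)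
        = F c x * (1 - e1 x + c * ed x) - 1"
      unfolding e1_def sum_distrib_right[symmetric] by (simp add: algebra_simps)
    moreover have "\<dots> = 0" using elim by (simp add: F_def)
    moreover have "b r * monom_vec x r = E 0 r * monom_vec x r - of_bool (r = 0) * monom_vec x r
          - (\<Sum>i\<in>UNIV. E (axis i 1) r * monom_vec x r) + c * (E 1 r * monom_vec x r)" for r
      unfolding b_def by (simp only: left_diff_distrib distrib_right sum_distrib_right mult.assoc)
    ultimately show ?case by (simp only:)
  qed
  then have "b (\<chi> i. nat (q i)) = 0" by (rule power_series_unique)
  moreover have "E 0 (\<chi> i. nat (q i)) = coeff_ext a q" "E 1 (\<chi> i. nat (q i)) = coeff_ext a (\<lambda>i. q i - 1)"
    using True by (simp_all add: E_def)
  moreover have "E (axis i 1) (\<chi> i. nat (q i)) = coeff_ext a (q(i := q i - 1))" for i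
  proof -
    have "(\<lambda>j. int ((\<chi> i. nat (q i)) $ j) - int (axis i 1 $ j)) = q(i := q i - 1)"
      using True by (auto simp: axis_def)
    then show ?thesis by (simp add: E_def)
  qed
  moreover have "((\<chi> i. nat (q i)) = 0) = (q = (\<lambda>_. 0))"
  proof -
    have "(q i \<le> 0) = (q i = 0)" for i using True[rule_format, of i] by linarith
    then show ?thesis by (simp add: vec_eq_iff fun_eq_iff)
  qed
  ultimately show ?thesis by (simp add: b_def)
qed

text \<open>Induction on the total degree: a neighbour either has smaller degree or acquires a
  negative entry, where both families vanish. The ring is left open because both a real and a
  complex candidate are compared in this way.\<close>

lemma recurrence_unique:
  fixes A B :: "('d::finite \<Rightarrow> int) \<Rightarrow> 'a::comm_ring_1"
  assumes A: "\<And>q. A q = of_bool (q = (\<lambda>_. 0)) + (\<Sum>i\<in>UNIV. A (q(i := q i - 1))) - c * A (\<lambda>i. q i - 1)"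
    and B: "\<And>q. \<forall>i. 0 \<le> q i \<Longrightarrow>
          B q = of_bool (q = (\<lambda>_. 0)) + (\<Sum>i\<in>UNIV. B (q(i := q i - 1))) - c * B (\<lambda>i. q i - 1)"
    and A0: "\<And>q i. q i < 0 \<Longrightarrow> A q = 0" and B0: "\<And>q i. q i < 0 \<Longrightarrow> B q = 0"
  shows "A q = B q"
proof (induction "nat (\<Sum>i\<in>UNIV. q i)" arbitrary: q rule: less_induct)
  case less
  show ?case
  proof (cases "\<forall>i. 0 \<le> q i")
    case False
    then obtain i where "q i < 0" by (auto simp: not_le)
    then show ?thesis using A0[of q i] B0[of q i] by simp
  next
    case True
    have 1: "A (q(i := q i - 1)) = B (q(i := q i - 1))" for i
    proof (cases "q i = 0")
      case True
      then show ?thesis using A0[of "q(i := q i - 1)" i] B0[of "q(i := q i - 1)" i] by simp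
    next
      case False
      then have "q i > 0" using \<open>\<forall>i. 0 \<le> q i\<close> by (simp add: order_less_le)
      have "(\<Sum>j\<in>UNIV. (q(i := q i - 1)) j) < (\<Sum>j\<in>UNIV. q j)"
        by (rule sum_strict_mono_ex1) auto
      moreover have "0 < (\<Sum>j\<in>UNIV. q j)"
        using True \<open>q i > 0\<close> by (intro sum_pos2[of _ i]) auto
      ultimately show ?thesis by (intro less) simp
    qed
    have 2: "A (\<lambda>i. q i - 1) = B (\<lambda>i. q i - 1)"
    proof (cases "\<exists>i. q i = 0")
      case True
      then obtain i where "q i = 0" ..
      then show ?thesis using A0[of "\<lambda>i. q i - 1" i] B0[of "\<lambda>i. q i - 1" i] by simp
    next
      case False
      then have pos: "q i > 0" for i using \<open>\<forall>i. 0 \<le> q i\<close> by (metis order_less_le)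
      have "(\<Sum>j\<in>UNIV. q j - 1) < (\<Sum>j\<in>UNIV. q j)"
        by (rule sum_strict_mono) auto
      moreover have "0 < (\<Sum>j\<in>UNIV. q j)"
        using pos by (intro sum_pos) auto
      ultimately show ?thesis by (intro less) simp
    qed
    show ?thesis by (subst A, subst B[OF True]) (simp only: 1 2)
  qed
qed

subsection \<open>Diagonal coefficients as alternating sums\<close>

text \<open>Expanding \<open>F c\<close> in powers of \<open>c ed\<close>, where \<open>M\<close> collects the multinomial coefficients
  of \<open>F 0\<close>.\<close>

lemma coeff_explicit:
  fixes a M :: "nat ^ 'd::finite \<Rightarrow> real"
  assumes a: "has_power_series_at_0 (F c) a" and M: "has_power_series_at_0 (F 0) M"
  shows "diag_coeff a n = (\<Sum>k\<le>n. (- c) ^ k * of_nat ((CARD('d) * (n - k) + k) choose k) * diag_coeff M (n - k))"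
proof -
  define S where "S q = (\<Sum>i\<in>UNIV. q i)" for q :: "'d \<Rightarrow> int"
  \<comment> \<open>\<open>T k q\<close> is the coefficient of x^q in (-c ed)^k / (1 - e1)^(k+1).
    With s = q - (k,...,k), the power of 1 - e1 contributes the multinomial coefficient of s times
    (|s| + k choose k), and |s| + k = |q| - (d - 1) k.\<close>
  define T where "T k q = (- c) ^ k * of_nat (nat (S q - (int CARD('d) - 1) * int k) choose k)
      * coeff_ext M (\<lambda>i. q i - int k)" for k and q :: "'d \<Rightarrow> int"
  have T0: "T k q = 0" if "q i < int k" for k q i
    using that coeff_ext_neg[of "\<lambda>i. q i - int k" i M] by (simp add: T_def)
  have S1: "S (q(i := q i - 1)) = S q - 1" for q i
  proof -
    have "q(i := q i - 1) = (\<lambda>j. q j - (if j = i then 1 else 0))" by auto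
    then show ?thesis by (simp add: S_def sum_subtractf)
  qed
  have Sd: "S (\<lambda>i. q i - int k) = S q - int CARD('d) * int k" for q k
    by (simp add: S_def sum_subtractf)
  \<comment> \<open>Coefficient form of (1 - e1) T_k = -c ed T_(k-1), with right-hand side 1 when k
    = 0.\<close>
  have Trec: "T k q = of_bool (k = 0 \<and> q = (\<lambda>_. 0)) + (\<Sum>i\<in>UNIV. T k (q(i := q i - 1)))
      - c * (if k = 0 then 0 else T (k - 1) (\<lambda>i. q i - 1))" for k q
  proof (cases "\<exists>i. q i < int k")
    case True
    then obtain i where i: "q i < int k" ..
    have "T k (q(j := q j - 1)) = 0" for j
      using i by (intro T0[of _ i]) auto
    moreover have "T (k - 1) (\<lambda>i. q i - 1) = 0" if "k \<noteq> 0"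
      using i that by (intro T0[of _ i]) auto
    moreover have "\<not> (k = 0 \<and> q = (\<lambda>_. 0))" using i by auto
    ultimately show ?thesis using T0[of q i k, OF i] by auto
  next
    case False
    define s where "s = (\<lambda>i. q i - int k)"
    have s0: "0 \<le> s i" for i using False by (auto simp: s_def not_less)
    define N where "N = nat (S q - (int CARD('d) - 1) * int k)"
    have Ss0: "S s \<ge> 0" using s0 by (simp add: S_def sum_nonneg)
    have SN: "S q - (int CARD('d) - 1) * int k = S s + int k"
      unfolding s_def Sd by (simp add: algebra_simps)
    have N: "N = nat (S s) + k" unfolding N_def SN using Ss0 by simp
    have 1: "T k q = (- c) ^ k * of_nat (N choose k) * coeff_ext M s"
      by (simp add: T_def N_def s_def)
    have "T k (q(i := q i - 1)) = (- c) ^ k * of_nat ((N - 1) choose k) * coeff_ext M (s(i := s i - 1))" for i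
    proof -
      have "nat (S q - 1 - (int CARD('d) - 1) * int k) = N - 1"
        unfolding N_def by (simp add: nat_diff_distrib' algebra_simps) 
      moreover have "(\<lambda>j. (q(i := q i - 1)) j - int k) = s(i := s i - 1)" by (auto simp: s_def)
      ultimately show ?thesis by (simp add: T_def S1)
    qed
    then have 2: "(\<Sum>i\<in>UNIV. T k (q(i := q i - 1)))
        = (- c) ^ k * of_nat ((N - 1) choose k) * (\<Sum>i\<in>UNIV. coeff_ext M (s(i := s i - 1)))"
      by (simp add: sum_distrib_left)
    have 3: "T (k - 1) (\<lambda>i. q i - 1) = (- c) ^ (k - 1) * of_nat ((N - 1) choose (k - 1)) * coeff_ext M s" if "k \<noteq> 0"
    proof -
      have "S (\<lambda>i. q i - 1) - (int CARD('d) - 1) * int (k - 1) = S q - (int CARD('d) - 1) * int k - 1"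
        using that Sd[of q 1] by (simp add: of_nat_diff algebra_simps)
      then have "nat (S (\<lambda>i. q i - 1) - (int CARD('d) - 1) * int (k - 1)) = N - 1"
        unfolding N_def by (simp add: nat_diff_distrib')
      moreover have "(\<lambda>j. q j - 1 - int (k - 1)) = s" using that by (auto simp: s_def of_nat_diff)
      ultimately show ?thesis by (simp add: T_def)
    qed
    have Ms: "(\<Sum>i\<in>UNIV. coeff_ext M (s(i := s i - 1))) = coeff_ext M s - of_bool (s = (\<lambda>_. 0))"
      using coeff_recurrence[OF M, of s] by simp
    show ?thesis
    proof (cases k)
      case 0
      then have "s = q" by (simp add: s_def)
      then show ?thesis unfolding 1 2 Ms using 0 by simp
    next
      case (Suc j)
      \<comment> \<open>Pascal's rule separates the part matched by the single shifts from the part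
        matched by the diagonal shift. If s = 0 then N = k, so the Kronecker term in the recurrence
        of \<open>M\<close> is multiplied by (k - 1 choose k) = 0.\<close>
      have "N choose k = ((N - 1) choose k) + ((N - 1) choose (k - 1))"
        using N Suc by simp
      moreover have "of_nat ((N - 1) choose k) * of_bool (s = (\<lambda>_. 0)) = (0::real)"
        using N Suc by (auto simp: S_def)
      ultimately show ?thesis unfolding 1 2 Ms using Suc 3
        by (simp add: algebra_simps)
    qed
  qed
  fix j0 :: 'd
  \<comment> \<open>\<open>T k q\<close> is 0 once k exceeds some entry of q, so the sum over all k
    may be cut off at an arbitrary coordinate \<open>j0\<close>.\<close>
  define B where "B q = (\<Sum>k\<le>nat (q j0). T k q)" for q
  have B_upto: "B q = (\<Sum>k\<le>n. T k q)" if "nat (q j0) \<le> n" for q n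
    unfolding B_def using that by (intro sum.mono_neutral_left) (auto intro!: T0[of _ j0])
  have "coeff_ext a q = B q" for q
  proof (rule recurrence_unique[OF coeff_recurrence[OF a]])
    fix q :: "'d \<Rightarrow> int" and i assume "q i < 0"
    then show "coeff_ext a q = 0" "B q = 0"
      unfolding B_def by (auto intro!: coeff_ext_neg[of _ i] sum.neutral T0[of _ i])
  next
    fix q :: "'d \<Rightarrow> int" assume q: "\<forall>i. 0 \<le> q i"
    define n where "n = nat (q j0)"
    have "B q = (\<Sum>k\<le>n. of_bool (k = 0 \<and> q = (\<lambda>_. 0)) + (\<Sum>i\<in>UNIV. T k (q(i := q i - 1)))
        - c * (if k = 0 then 0 else T (k - 1) (\<lambda>i. q i - 1)))"
      unfolding B_def n_def by (intro sum.cong Trec) simp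
    also have "\<dots> = (\<Sum>k\<le>n. of_bool (k = 0 \<and> q = (\<lambda>_. 0))) + (\<Sum>i\<in>UNIV. \<Sum>k\<le>n. T k (q(i := q i - 1)))
        - c * (\<Sum>k\<le>n. if k = 0 then 0 else T (k - 1) (\<lambda>i. q i - 1))"
      by (subst sum.swap) (simp add: sum.distrib sum_subtractf sum_distrib_left)
    also have "(\<Sum>k\<le>n. of_bool (k = 0 \<and> q = (\<lambda>_. 0))) = (of_bool (q = (\<lambda>_. 0)) :: real)"
      by (simp add: of_bool_conj sum_distrib_right[symmetric])
    also have "(\<Sum>i\<in>UNIV. \<Sum>k\<le>n. T k (q(i := q i - 1))) = (\<Sum>i\<in>UNIV. B (q(i := q i - 1)))"
      by (intro sum.cong B_upto[symmetric]) (auto simp: n_def)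
    also have "(\<Sum>k\<le>n. if k = 0 then 0 else T (k - 1) (\<lambda>i. q i - 1)) = B (\<lambda>i. q i - 1)"
    proof (cases n)
      case 0
      then have "q j0 = 0" using q by (simp add: n_def order_antisym)
      then show ?thesis using 0 T0[of "\<lambda>i. q i - 1" j0 0] by (simp add: B_def)
    next
      case (Suc m)
      have "(\<Sum>k\<le>Suc m. if k = 0 then 0 else T (k - 1) (\<lambda>i. q i - 1)) = (\<Sum>k\<le>m. T k (\<lambda>i. q i - 1))"
        by (subst sum.atMost_Suc_shift) simp
      also have "\<dots> = B (\<lambda>i. q i - 1)" using Suc by (intro B_upto[symmetric]) (auto simp: n_def)
      finally show ?thesis using Suc by simp
    qed
    finally show "B q = of_bool (q = (\<lambda>_. 0)) + (\<Sum>i\<in>UNIV. B (q(i := q i - 1))) - c * B (\<lambda>i. q i - 1)" .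
  qed
  from this[of "\<lambda>_. int n"] have "diag_coeff a n = B (\<lambda>_. int n)"
    by (simp add: diag_coeff_def coeff_ext_def)
  also have "\<dots> = (\<Sum>k\<le>n. (- c) ^ k * of_nat ((CARD('d) * (n - k) + k) choose k) * diag_coeff M (n - k))"
  proof -
    have "T k (\<lambda>_. int n) = (- c) ^ k * of_nat ((CARD('d) * (n - k) + k) choose k) * diag_coeff M (n - k)"
      if kn: "k \<le> n" for k
    proof -
      have "S (\<lambda>_. int n) - (int CARD('d) - 1) * int k = int (CARD('d) * (n - k) + k)"
      proof -
        obtain m where "n = k + m" using le_Suc_ex[OF kn] by blast
        then show ?thesis by (simp add: S_def algebra_simps)
      qed
      then have "nat (S (\<lambda>_. int n) - (int CARD('d) - 1) * int k) = CARD('d) * (n - k) + k"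
        by (simp only: nat_int)
      moreover have "coeff_ext M (\<lambda>_. int n - int k) = diag_coeff M (n - k)"
        using that by (simp add: coeff_ext_def diag_coeff_def nat_diff_distrib')
      ultimately show ?thesis by (simp add: T_def)
    qed
    then show ?thesis unfolding B_def by (intro sum.cong) auto
  qed
  finally show ?thesis .
qed

text \<open>The value at \<open>q\<close> is a multinomial coefficient: it counts certain words of
  length |q| over \<open>CARD('d)\<close> letters. On the diagonal this yields a radius of
  convergence of at least d^(-d).\<close>

lemma coeff_geometric_bounds:
  fixes M :: "nat ^ 'd::finite \<Rightarrow> real"
  assumes M: "has_power_series_at_0 (F 0) M"
  shows "0 \<le> coeff_ext M q \<and> coeff_ext M q \<le> real CARD('d) ^ nat (\<Sum>i\<in>UNIV. q i)"
proof (induction "nat (\<Sum>i\<in>UNIV. q i)" arbitrary: q rule: less_induct)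
  case less
  show ?case
  proof (cases "(\<forall>i. 0 \<le> q i) \<and> q \<noteq> (\<lambda>_. 0)")
    case False
    have "coeff_ext M (\<lambda>_. 0) = 1"
      using coeff_recurrence[OF M, of "\<lambda>_. 0"] coeff_ext_neg[of "(\<lambda>_. 0)(_ := - 1)" _ M] by simp
    moreover have "coeff_ext M q = 0" if q0: "q \<noteq> (\<lambda>_. 0)"
    proof -
      obtain i where "q i < 0" using False q0 by (auto simp: not_le)
      then show ?thesis by (rule coeff_ext_neg)
    qed
    ultimately show ?thesis by (cases "q = (\<lambda>_. 0)") auto
  next
    case True
    then obtain i where "q i \<noteq> 0" by auto
    then have pos: "0 < (\<Sum>j\<in>UNIV. q j)"
      using True by (intro sum_pos2[of _ i]) (auto simp: order_less_le)
    define m where "m = nat (\<Sum>j\<in>UNIV. q j) - 1"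
    have m: "nat (\<Sum>j\<in>UNIV. q j) = Suc m" using pos by (simp add: m_def)
    have s: "(\<Sum>j\<in>UNIV. (q(i := q i - 1)) j) = (\<Sum>j\<in>UNIV. q j) - 1" for i
    proof -
      have "q(i := q i - 1) = (\<lambda>j. q j - (if j = i then 1 else 0))" by auto
      then show ?thesis by (simp add: sum_subtractf)
    qed
    have b: "0 \<le> coeff_ext M (q(i := q i - 1)) \<and> coeff_ext M (q(i := q i - 1)) \<le> real CARD('d) ^ m" for i
      using less[of "q(i := q i - 1)"] pos unfolding s by (simp add: m_def nat_diff_distrib')
    have "coeff_ext M q = (\<Sum>i\<in>UNIV. coeff_ext M (q(i := q i - 1)))"
      using coeff_recurrence[OF M, of q] True by simp
    moreover have "\<dots> \<le> (\<Sum>i\<in>(UNIV::'d set). real CARD('d) ^ m)" by (intro sum_mono) (use b in blast)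
    moreover have "0 \<le> (\<Sum>i\<in>UNIV. coeff_ext M (q(i := q i - 1)))" by (intro sum_nonneg) (use b in blast)
    ultimately show ?thesis unfolding m by simp
  qed
qed

corollary diag_coeff_geometric_bounds:
  fixes M :: "nat ^ 'd::finite \<Rightarrow> real"
  assumes M: "has_power_series_at_0 (F 0) M"
  shows "0 \<le> diag_coeff M n" "diag_coeff M n \<le> (real CARD('d) ^ CARD('d)) ^ n"
  using coeff_geometric_bounds[OF M, of "\<lambda>_. int n"]
  by (simp_all add: coeff_ext_def diag_coeff_def nat_mult_distrib power_mult)

subsection \<open>Pringsheim's theorem\<close>

lemma sums_nonneg:
  fixes f :: "nat \<Rightarrow> real"
  shows "f sums s \<Longrightarrow> (\<And>n. 0 \<le> f n) \<Longrightarrow> 0 \<le> s"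
  by (rule sums_le[of "\<lambda>_. 0"]) auto

text \<open>Termwise differentiation keeps the coefficients nonnegative, so the induction on
  \<open>k\<close> runs over all such series at once.\<close>

lemma higher_deriv_eval_fps_nonneg:
  fixes G :: "complex fps"
  assumes "\<And>n. fps_nth G n \<in> \<real> \<and> 0 \<le> Re (fps_nth G n)"
    and "0 \<le> x" "ereal x < fps_conv_radius G"
  shows "0 \<le> Re ((deriv ^^ k) (eval_fps G) (of_real x))"
  using assms
proof (induction k arbitrary: G)
  case 0
  have "(\<lambda>n. fps_nth G n * of_real x ^ n) sums eval_fps G (of_real x)"
    using 0 by (intro sums_eval_fps) simp
  then have "(\<lambda>n. Re (fps_nth G n * of_real x ^ n)) sums Re (eval_fps G (of_real x))"
    by (rule sums_Re)
  moreover have "0 \<le> Re (fps_nth G n * of_real x ^ n)" for n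
  proof -
    have "Re (fps_nth G n * of_real x ^ n) = Re (fps_nth G n) * x ^ n"
      by (simp flip: of_real_power)
    then show ?thesis using 0 by simp
  qed
  ultimately have "0 \<le> Re (eval_fps G (of_real x))" by (rule sums_nonneg)
  then show ?case by simp
next
  case (Suc k)
  have "eval_fps (fps_deriv G) z = deriv (eval_fps G) z" if "ereal (norm z) < fps_conv_radius G" for z
    using has_field_derivative_eval_fps[OF that, of UNIV] by (simp add: DERIV_imp_deriv)
  then have "\<forall>\<^sub>F z in nhds (of_real x). deriv (eval_fps G) z = eval_fps (fps_deriv G) z"
    using Suc.prems by (intro eventually_nhds_in_open[of "eball 0 (fps_conv_radius G)", THEN eventually_mono])
      (auto simp: in_eball_iff)
  then have "(deriv ^^ k) (deriv (eval_fps G)) (of_real x) = (deriv ^^ k) (eval_fps (fps_deriv G)) (of_real x)"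
    by (intro higher_deriv_cong_ev refl)
  moreover have "0 \<le> Re ((deriv ^^ k) (eval_fps (fps_deriv G)) (of_real x))"
  proof (rule Suc.IH)
    fix n show "fps_nth (fps_deriv G) n \<in> \<real> \<and> 0 \<le> Re (fps_nth (fps_deriv G) n)"
    proof -
      obtain r where "fps_nth G (Suc n) = of_real r" "0 \<le> r"
        using Suc.prems(1)[of "Suc n"] by (auto elim: Reals_cases)
      then have "fps_nth (fps_deriv G) n = of_real (real (Suc n) * r)" by simp
      then show ?thesis using \<open>0 \<le> r\<close> by (simp only: Reals_of_real Re_complex_of_real) simp
    qed
  qed (use Suc.prems fps_conv_radius_deriv[of G] in auto)
  ultimately show ?case by (simp only: funpow_Suc_right comp_apply)
qed

text \<open>Compactness gives a rectangle inside \<open>W\<close> around the segment. Its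
  intersection with the disc of radius \<open>\<rho>\<close> is convex, so the identity theorem
  carries the agreement near 0 to all of it, whereas \<open>W\<close> cut with the disc might be
  disconnected.\<close>

lemma power_series_agree_near_segment:
  fixes \<delta> :: "nat \<Rightarrow> complex"
  assumes hol: "f holomorphic_on W" and W: "open W" "of_real ` {0..\<rho>} \<subseteq> W"
    and small: "0 < r0" "\<And>z. norm z < r0 \<Longrightarrow> (\<lambda>n. \<delta> n * z ^ n) sums f z"
    and \<rho>: "0 < \<rho>" "ereal \<rho> \<le> conv_radius \<delta>"
  obtains e where "0 < e" "box (Complex (-e) (-e)) (Complex (\<rho> + e) e) \<subseteq> W"
    "\<And>z. z \<in> box (Complex (-e) (-e)) (Complex (\<rho> + e) e) \<Longrightarrow> norm z < \<rho> \<Longrightarrow> (\<lambda>n. \<delta> n * z ^ n) sums f z"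
proof -
  have "compact (complex_of_real ` {0..\<rho>})"
    by (intro compact_continuous_image continuous_intros) simp
  then obtain \<epsilon> where \<epsilon>: "\<epsilon> > 0" "(\<Union>x\<in>complex_of_real ` {0..\<rho>}. ball x \<epsilon>) \<subseteq> W"
    using W by (metis compact_subset_open_imp_ball_epsilon_subset)
  define e where "e = \<epsilon> / 2"
  define B where "B = box (Complex (-e) (-e)) (Complex (\<rho> + e) e)"
  have e: "0 < e" using \<epsilon> by (simp add: e_def)
  have B: "z \<in> B \<longleftrightarrow> -e < Re z \<and> Re z < \<rho> + e \<and> -e < Im z \<and> Im z < e" for z
    by (auto simp: B_def in_box_complex_iff)
  have BW: "B \<subseteq> W"
  proof
    fix z assume z: "z \<in> B"
    define x where "x = max 0 (min \<rho> (Re z))"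
    have x: "x \<in> {0..\<rho>}" using \<rho> by (auto simp: x_def)
    have "norm (complex_of_real x - z) \<le> \<bar>Re (complex_of_real x - z)\<bar> + \<bar>Im (complex_of_real x - z)\<bar>"
      by (rule cmod_le)
    also have "\<dots> < e + e" using z e by (intro add_strict_mono) (auto simp: B x_def)
    finally have "z \<in> ball (complex_of_real x) \<epsilon>" by (simp add: dist_norm e_def)
    then show "z \<in> W" using \<epsilon>(2) x by blast
  qed
  define P where "P z = (\<Sum>n. \<delta> n * z ^ n)" for z
  have P_sums: "(\<lambda>n. \<delta> n * z ^ n) sums P z" if "ereal (norm z) < conv_radius \<delta>" for z
    unfolding P_def by (intro summable_sums summable_in_conv_radius that)
  have P_eq: "P = eval_fps (Abs_fps \<delta>)" by (auto simp: P_def eval_fps_def)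
  have P_hol: "P holomorphic_on ball 0 \<rho>"
    unfolding P_eq
  proof (rule holomorphic_on_eval_fps, rule subsetI)
    fix z :: complex assume "z \<in> ball 0 \<rho>"
    then have "ereal (norm z) < conv_radius \<delta>" by (intro less_le_trans[OF _ \<rho>(2)]) simp
    then show "z \<in> eball 0 (fps_conv_radius (Abs_fps \<delta>))"
      by (simp add: fps_conv_radius_def Abs_fps_inverse in_eball_iff fps_nth_Abs_fps[abs_def])
  qed
  define r where "r = min (min r0 \<rho>) e"
  have r: "0 < r" "r \<le> r0" "r \<le> \<rho>" "r \<le> e" using small(1) \<rho>(1) e by (auto simp: r_def)
  have agree: "P z = f z" if "z \<in> B \<inter> ball 0 \<rho>" for z
  proof (rule analytic_continuation_open[of "ball 0 r" "B \<inter> ball 0 \<rho>" P f])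
    show "ball 0 r \<subseteq> B \<inter> ball 0 \<rho>"
    proof
      fix z :: complex assume "z \<in> ball 0 r"
      then have "norm z < r" by simp
      then have "\<bar>Re z\<bar> < r" "\<bar>Im z\<bar> < r" using abs_Re_le_cmod[of z] abs_Im_le_cmod[of z] by linarith+
      then show "z \<in> B \<inter> ball 0 \<rho>" using r \<rho>(1) \<open>norm z < r\<close> by (auto simp: B)
    qed
    show "open (B \<inter> ball 0 \<rho>)" unfolding B_def by (intro open_Int open_box open_ball)
    show "connected (B \<inter> ball 0 \<rho>)"
      unfolding B_def by (intro convex_connected convex_Int convex_box convex_ball)
    show "P holomorphic_on B \<inter> ball 0 \<rho>" using P_hol by (rule holomorphic_on_subset) auto
    show "f holomorphic_on B \<inter> ball 0 \<rho>" using hol by (rule holomorphic_on_subset) (use BW in auto)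
    show "P z = f z" if "z \<in> ball 0 r" for z
      using small(2)[of z] that r unfolding P_def by (simp add: sums_iff)
  qed (use r that in auto)
  show ?thesis
  proof (rule that[of e])
    fix z assume z: "z \<in> box (Complex (-e) (-e)) (Complex (\<rho> + e) e)" "norm z < \<rho>"
    have "ereal (norm z) < conv_radius \<delta>" by (rule less_le_trans[OF _ \<rho>(2)]) (use z(2) in simp)
    then show "(\<lambda>n. \<delta> n * z ^ n) sums f z"
      using P_sums[of z] agree[of z] z by (simp add: B_def)
  qed (use e BW in \<open>auto simp: B_def\<close>)
qed

text \<open>If the radius \<open>\<rho>\<close> were finite, \<open>f\<close> could be expanded at a
  point below \<open>\<rho>\<close> in a disc reaching beyond \<open>\<rho>\<close>. Nonnegative
  derivatives there bound the partial sums of the original series at a point beyond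
  \<open>\<rho>\<close>, which forces convergence at that point. As the whole positive axis lies in
  \<open>W\<close>, no finite radius is possible.\<close>

lemma pringsheim:
  fixes \<delta> :: "nat \<Rightarrow> real"
  assumes nonneg: "\<And>n. 0 \<le> \<delta> n"
    and hol: "f holomorphic_on W" and W: "open W" "\<And>x. 0 \<le> x \<Longrightarrow> complex_of_real x \<in> W"
    and small: "0 < r0" "\<And>z. norm z < r0 \<Longrightarrow> (\<lambda>n. of_real (\<delta> n) * z ^ n) sums f z"
    and x: "0 \<le> x"
  shows "(\<lambda>n. of_real (\<delta> n) * of_real x ^ n) sums f (of_real x)"
proof -
  define D where "D n = complex_of_real (\<delta> n)" for n
  have smallD: "norm z < r0 \<Longrightarrow> (\<lambda>n. D n * z ^ n) sums f z" for z using small(2) by (simp add: D_def)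
  have seg: "of_real ` {0..\<rho>} \<subseteq> W" for \<rho> using W(2) by auto
  have "summable (\<lambda>n. D n * of_real (r0 / 2) ^ n)"
    using smallD[of "of_real (r0 / 2)"] small(1) by (simp add: sums_iff)
  from conv_radius_geI[OF this] have Rpos: "0 < conv_radius D"
    using small(1) by (auto intro: order.strict_trans2[rotated])
  have "conv_radius D = \<infinity>"
  proof (rule ccontr)
    assume "conv_radius D \<noteq> \<infinity>"
    then obtain \<rho> where \<rho>: "conv_radius D = ereal \<rho>" "0 < \<rho>"
      using Rpos by (cases "conv_radius D") auto
    obtain e where e: "0 < e" "box (Complex (-e) (-e)) (Complex (\<rho> + e) e) \<subseteq> W"
      "\<And>z. z \<in> box (Complex (-e) (-e)) (Complex (\<rho> + e) e) \<Longrightarrow> norm z < \<rho> \<Longrightarrow> (\<lambda>n. D n * z ^ n) sums f z"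
      by (rule power_series_agree_near_segment[OF hol W(1) seg small(1) smallD \<rho>(2)]) (use \<rho> in auto)
    \<comment> \<open>The disc of radius \<open>2 * \<nu>\<close> around
      \<open>\<rho> - \<nu>\<close> reaches \<open>\<rho> + \<nu>\<close> and still fits into the
      rectangle; the point \<open>x0 + h\<close> chosen below is
      \<open>\<rho> + \<nu> / 2\<close>.\<close>
    define \<nu> where "\<nu> = min (e / 3) (\<rho> / 2)"
    have \<nu>: "0 < \<nu>" "3 * \<nu> \<le> e" "2 * \<nu> \<le> \<rho>" using e \<rho> by (auto simp: \<nu>_def)
    define x0 where "x0 = \<rho> - \<nu>"
    have x0: "0 < x0" "x0 < \<rho>" using \<nu> \<rho>(2) by (auto simp: x0_def)
    have ballB: "ball (of_real x0) (2 * \<nu>) \<subseteq> box (Complex (-e) (-e)) (Complex (\<rho> + e) e)"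
    proof
      fix z assume "z \<in> ball (complex_of_real x0) (2 * \<nu>)"
      then have n: "norm (z - of_real x0) < 2 * \<nu>" by (simp add: dist_norm norm_minus_commute)
      have "\<bar>Re z - x0\<bar> < 2 * \<nu>" "\<bar>Im z\<bar> < 2 * \<nu>"
        using n abs_Re_le_cmod[of "z - of_real x0"] abs_Im_le_cmod[of "z - of_real x0"] by auto
      then show "z \<in> box (Complex (-e) (-e)) (Complex (\<rho> + e) e)"
        using \<nu> x0 by (auto simp: in_box_complex_iff x0_def)
    qed
    define h where "h = 3 / 2 * \<nu>"
    have h: "0 < h" "h < 2 * \<nu>" "x0 + h > \<rho>" using \<nu> by (auto simp: h_def x0_def)
    \<comment> \<open>The tail \<open>g\<close> after N terms again has nonnegative coefficients, so
      its derivatives at \<open>x0\<close>, and with them its value at \<open>x0 + h\<close>, are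
      nonnegative. Treating one tail at a time avoids rearranging a double series.\<close>
    have bound: "(\<Sum>n<N. \<delta> n * (x0 + h) ^ n) \<le> Re (f (of_real (x0 + h)))" for N
    proof -
      define G where "G = Abs_fps (\<lambda>n. if n < N then 0 else D n)"
      define p where "p z = (\<Sum>n<N. D n * z ^ n)" for z :: complex
      define g where "g z = f z - p z" for z
      have G_sums: "(\<lambda>n. fps_nth G n * z ^ n) sums g z"
        if "(\<lambda>n. D n * z ^ n) sums f z" for z
      proof -
        have "(\<lambda>n. if n \<in> {..<N} then D n * z ^ n else 0) sums p z"
          unfolding p_def by (rule sums_If_finite_set) simp
        from sums_diff[OF that this] show ?thesis
          unfolding g_def G_def by (rule sums_cong[THEN iffD1, rotated]) simp
      qed
      have g_eval: "g z = eval_fps G z" if "z \<in> box (Complex (-e) (-e)) (Complex (\<rho> + e) e)" "norm z < \<rho>" for z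
        using G_sums[OF e(3)[OF that]] by (simp add: eval_fps_def sums_iff)
      have conv: "ereal \<rho> \<le> fps_conv_radius G"
        unfolding fps_conv_radius_def
      proof (rule conv_radius_geI_ex')
        fix r assume r: "0 < r" "ereal r < ereal \<rho>"
        have "summable (\<lambda>n. D n * of_real r ^ n)"
          using r \<rho> by (intro summable_in_conv_radius) auto
        then have "summable (\<lambda>n. D n * of_real r ^ n - (if n \<in> {..<N} then D n * of_real r ^ n else 0))"
          by (intro summable_diff summable_If_finite_set) auto
        then show "summable (\<lambda>n. fps_nth G n * of_real r ^ n)"
          by (rule summable_cong[THEN iffD1, rotated]) (auto simp: G_def)
      qed
      have "g holomorphic_on ball (of_real x0) (2 * \<nu>)"
        unfolding g_def p_def
        by (intro holomorphic_intros holomorphic_on_subset[OF hol]) (use ballB e(2) in auto)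
      moreover have "complex_of_real (x0 + h) \<in> ball (of_real x0) (2 * \<nu>)"
        using h by (simp add: dist_norm)
      ultimately have "(\<lambda>k. (deriv ^^ k) g (of_real x0) / fact k * (of_real (x0 + h) - of_real x0) ^ k)
          sums g (of_real (x0 + h))"
        by (rule holomorphic_power_series)
      then have "(\<lambda>k. Re ((deriv ^^ k) g (of_real x0) / fact k * (of_real (x0 + h) - of_real x0) ^ k))
          sums Re (g (of_real (x0 + h)))"
        by (rule sums_Re)
      moreover have "0 \<le> Re ((deriv ^^ k) g (of_real x0) / fact k * (of_real (x0 + h) - of_real x0) ^ k)" for k
      proof -
        have "\<forall>\<^sub>F z in nhds (complex_of_real x0). z \<in> ball (of_real x0) (2 * \<nu>) \<inter> ball 0 \<rho>"
          using \<nu>(1) x0 by (intro eventually_nhds_in_open) (auto simp: dist_norm)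
        then have "\<forall>\<^sub>F z in nhds (of_real x0). g z = eval_fps G z"
          by (rule eventually_mono) (use g_eval ballB in auto)
        then have "(deriv ^^ k) g (of_real x0) = (deriv ^^ k) (eval_fps G) (of_real x0)"
          by (intro higher_deriv_cong_ev refl)
        moreover have "0 \<le> Re ((deriv ^^ k) (eval_fps G) (of_real x0))"
        proof (rule higher_deriv_eval_fps_nonneg)
          show "ereal x0 < fps_conv_radius G"
            by (rule less_le_trans[OF _ conv]) (use x0 in simp)
        qed (use x0 nonneg in \<open>auto simp: G_def D_def\<close>)
        moreover have "Re ((deriv ^^ k) g (of_real x0) / fact k * (of_real (x0 + h) - of_real x0) ^ k)
            = Re ((deriv ^^ k) g (of_real x0)) * (h ^ k / fact k)"
        proof -
          have "(deriv ^^ k) g (of_real x0) / fact k * (of_real (x0 + h) - of_real x0) ^ k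
              = (deriv ^^ k) g (of_real x0) * of_real (h ^ k / fact k)" by simp
          then show ?thesis
            by (simp only: times_complex.sel Re_complex_of_real Im_complex_of_real mult_zero_right diff_zero)
        qed
        ultimately show ?thesis using h by simp
      qed
      ultimately have "0 \<le> Re (g (of_real (x0 + h)))" by (rule sums_nonneg)
      moreover have "p (of_real (x0 + h)) = of_real (\<Sum>n<N. \<delta> n * (x0 + h) ^ n)"
        by (simp add: p_def D_def)
      ultimately show ?thesis unfolding g_def by (simp only: minus_complex.sel Re_complex_of_real)
    qed
    have "summable (\<lambda>n. \<delta> n * (x0 + h) ^ n)"
      using bound nonneg h x0 by (intro summableI_nonneg_bounded) auto
    then have "summable (\<lambda>n. complex_of_real (\<delta> n * (x0 + h) ^ n))"
      by (simp only: summable_of_real_iff)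
    then have "summable (\<lambda>n. D n * of_real (x0 + h) ^ n)" by (simp add: D_def)
    from conv_radius_geI[OF this] have "ereal \<bar>x0 + h\<bar> \<le> ereal \<rho>" by (simp only: norm_of_real \<rho>(1))
    then show False using h x0 by simp
  qed
  obtain e where e: "0 < e" 
      "\<And>z. z \<in> box (Complex (-e) (-e)) (Complex (x + 1 + e) e) \<Longrightarrow> norm z < x + 1 \<Longrightarrow> (\<lambda>n. D n * z ^ n) sums f z"
    by (rule power_series_agree_near_segment[OF hol W(1) seg small(1) smallD, of "x + 1"])
       (use x \<open>conv_radius D = \<infinity>\<close> in auto)
  then show ?thesis using e(2)[of "of_real x"] x by (simp add: D_def in_box_complex_iff)
qed

subsection \<open>Sign changes above the critical value\<close>

lemma negative_binomial_sums:
  fixes w :: complex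
  assumes "norm w < 1"
  shows "(\<lambda>k. of_nat ((N + k) choose k) * w ^ k) sums (1 / (1 - w) ^ Suc N)"
proof -
  have "w \<noteq> 1" using assms by auto
  have "(\<lambda>k. ((- of_nat (Suc N)) gchoose k) * (- w) ^ k) sums (1 + (- w)) powr (- of_nat (Suc N))"
    using assms by (intro gen_binomial_complex) simp
  moreover have "(1 + (- w)) powr (- of_nat (Suc N)) = 1 / (1 - w) ^ Suc N"
    using \<open>w \<noteq> 1\<close> by (simp add: powr_minus powr_nat' field_simps del: of_nat_Suc power_Suc)
  moreover have "((- of_nat (Suc N)) gchoose k) * (- w) ^ k = of_nat ((N + k) choose k) * w ^ k" for k
  proof -
    have "(- of_nat (Suc N) :: complex) gchoose k = (-1) ^ k * (of_nat (N + k) gchoose k)"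
      by (subst gbinomial_minus) simp
    then have "((- of_nat (Suc N)) gchoose k) * (- w) ^ k = ((-1) ^ k * (- w) ^ k) * (of_nat (N + k) gchoose k)"
      by simp
    also have "(-1) ^ k * (- w) ^ k = w ^ k" by (simp flip: power_mult_distrib)
    also have "of_nat (N + k) gchoose k = (of_nat ((N + k) choose k) :: complex)"
      by (rule binomial_gbinomial[symmetric])
    finally show ?thesis by (simp add: mult.commute)
  qed
  ultimately show ?thesis by simp
qed

text \<open>Both sides are sums of one double series over (m, k), taken along n = m + k on the left
  and along rows on the right. Row m has absolute sum at most a constant times the m-th power of K
  |z| / (1 - |c z|)^d, so the second condition on \<open>z\<close> gives absolute
  convergence.\<close>

lemma substituted_series_sums:
  fixes \<delta> g :: "nat \<Rightarrow> real" and c :: real and z :: complex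
  assumes \<delta>: "\<And>n. \<delta> n = (\<Sum>k\<le>n. (- c) ^ k * of_nat ((d * (n - k) + k) choose k) * g (n - k))"
    and g: "\<And>m. \<bar>g m\<bar> \<le> K ^ m"
    and z: "\<bar>c\<bar> * norm z < 1" "K * norm z < (1 - \<bar>c\<bar> * norm z) ^ d"
  shows "(\<lambda>n. of_real (\<delta> n) * z ^ n) sums (\<Sum>m. of_real (g m) * z ^ m / (1 + of_real c * z) ^ Suc (d * m))"
proof -
  define w where "w = - of_real c * z"
  have nw: "norm w = \<bar>c\<bar> * norm z" by (simp add: w_def norm_mult)
  define h where "h = (\<lambda>(m, k). of_real (g m) * z ^ m * (of_nat ((d * m + k) choose k) * w ^ k))"
  have K0: "0 \<le> K" using g[of 1] by simp
  define \<theta> where "\<theta> = K * norm z / (1 - norm w) ^ d"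
  have nw1: "norm w < 1" using z by (simp add: nw)
  have \<theta>: "0 \<le> \<theta>" "\<theta> < 1"
    using z nw1 K0 by (auto simp: \<theta>_def nw)
  have inner_norm: "((\<lambda>k. norm (h (m, k))) has_sum (norm (of_real (g m) * z ^ m) * (1 / (1 - norm w) ^ Suc (d * m)))) UNIV" for m
  proof -
    have "(\<lambda>k. of_nat ((d * m + k) choose k) * of_real (norm w) ^ k) sums (1 / (1 - complex_of_real (norm w)) ^ Suc (d * m))"
      using nw1 by (intro negative_binomial_sums) simp
    then have "(\<lambda>k. complex_of_real (of_nat ((d * m + k) choose k) * norm w ^ k)) sums complex_of_real (1 / (1 - norm w) ^ Suc (d * m))"
      by simp
    then have "(\<lambda>k. of_nat ((d * m + k) choose k) * norm w ^ k) sums (1 / (1 - norm w) ^ Suc (d * m))"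
      by (simp only: sums_of_real_iff)
    then have "((\<lambda>k. of_nat ((d * m + k) choose k) * norm w ^ k) has_sum (1 / (1 - norm w) ^ Suc (d * m))) UNIV"
      by (rule sums_nonneg_imp_has_sum) auto
    then have "((\<lambda>k. norm (of_real (g m) * z ^ m) * (of_nat ((d * m + k) choose k) * norm w ^ k))
        has_sum (norm (of_real (g m) * z ^ m) * (1 / (1 - norm w) ^ Suc (d * m)))) UNIV"
      by (rule has_sum_cmult_right)
    then show ?thesis by (simp add: h_def norm_mult norm_power)
  qed
  have "(\<lambda>x. norm (h x)) summable_on UNIV \<times> UNIV"
    unfolding Infinite_Sum.abs_summable_on_Sigma_iff
  proof (intro conjI ballI)
    fix m show "(\<lambda>k. norm (h (m, k))) summable_on UNIV"
      using inner_norm[of m] by (rule has_sum_imp_summable)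
  next
    have eq: "infsum (\<lambda>k. norm (h (m, k))) UNIV = norm (of_real (g m) * z ^ m) * (1 / (1 - norm w) ^ Suc (d * m))" for m
      by (rule infsumI[OF inner_norm])
    have bd: "norm (norm (of_real (g m) * z ^ m) * (1 / (1 - norm w) ^ Suc (d * m))) \<le> 1 / (1 - norm w) * \<theta> ^ m" for m
    proof -
      have "norm (of_real (g m) * z ^ m) \<le> (K * norm z) ^ m"
        using g[of m] by (simp add: norm_mult norm_power power_mult_distrib mult_right_mono)
      then have "norm (of_real (g m) * z ^ m) * (1 / (1 - norm w) ^ Suc (d * m)) \<le> (K * norm z) ^ m * (1 / (1 - norm w) ^ Suc (d * m))"
        using nw1 by (intro mult_right_mono) auto
      also have "\<dots> = 1 / (1 - norm w) * \<theta> ^ m"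
        by (simp add: \<theta>_def power_divide power_mult)
      finally show ?thesis using nw1 by simp
    qed
    have "summable (\<lambda>m. 1 / (1 - norm w) * \<theta> ^ m)"
      using \<theta> by (intro summable_mult summable_geometric) simp
    then have "(\<lambda>m. 1 / (1 - norm w) * \<theta> ^ m) summable_on UNIV"
      using \<theta> nw1 by (intro summable_nonneg_imp_summable_on) auto
    then show "(\<lambda>m. norm (infsum (\<lambda>k. norm (h (m, k))) UNIV)) summable_on UNIV"
      unfolding eq by (rule Infinite_Sum.abs_summable_on_comparison_test') (rule bd)
  qed
  then have "h summable_on UNIV \<times> UNIV" by (rule Infinite_Sum.abs_summable_summable)
  then obtain S where S: "(h has_sum S) (UNIV \<times> UNIV)" by (auto simp: summable_on_def)
  have "((\<lambda>m. of_real (g m) * z ^ m * (1 / (1 - w) ^ Suc (d * m))) has_sum S) UNIV"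
  proof (rule has_sum_SigmaD[OF S])
    fix m :: nat
    have "((\<lambda>k. of_nat ((d * m + k) choose k) * w ^ k) has_sum (1 / (1 - w) ^ Suc (d * m))) UNIV"
    proof (rule norm_summable_imp_has_sum)
      show "(\<lambda>k. of_nat ((d * m + k) choose k) * w ^ k) sums (1 / (1 - w) ^ Suc (d * m))"
        by (rule negative_binomial_sums[OF nw1])
      have "(\<lambda>k. of_nat ((d * m + k) choose k) * complex_of_real (norm w) ^ k) sums (1 / (1 - of_real (norm w)) ^ Suc (d * m))"
        using nw1 by (intro negative_binomial_sums) simp
      then have "summable (\<lambda>k. complex_of_real (of_nat ((d * m + k) choose k) * norm w ^ k))"
        by (simp add: sums_iff)
      then show "summable (\<lambda>k. norm (of_nat ((d * m + k) choose k) * w ^ k))"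
        by (simp only: summable_of_real_iff norm_mult norm_power norm_of_nat)
    qed
    then show "((\<lambda>k. h (m, k)) has_sum (of_real (g m) * z ^ m * (1 / (1 - w) ^ Suc (d * m)))) UNIV"
      unfolding h_def prod.case by (rule has_sum_cmult_right)
  qed
  then have "(\<lambda>m. of_real (g m) * z ^ m * (1 / (1 - w) ^ Suc (d * m))) sums S"
    by (rule has_sum_imp_sums)
  moreover have "1 - w = 1 + of_real c * z" by (simp add: w_def)
  ultimately have S_eq: "S = (\<Sum>m. of_real (g m) * z ^ m / (1 + of_real c * z) ^ Suc (d * m))"
    by (simp add: sums_iff del: power_Suc)
  have "((\<lambda>(n, k). h (n - k, k)) has_sum S) (Sigma UNIV (\<lambda>n. {..n}))"
    using S by (subst has_sum_reindex_bij_witness[of _ "\<lambda>(m, k). (m + k, k)" "\<lambda>(n, k). (n - k, k)"]) auto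
  then have "((\<lambda>n. of_real (\<delta> n) * z ^ n) has_sum S) UNIV"
  proof (rule has_sum_SigmaD)
    fix n :: nat
    have "of_real (\<delta> n) * z ^ n = (\<Sum>k\<le>n. h (n - k, k))"
      unfolding \<delta> h_def of_real_sum sum_distrib_right
    proof (intro sum.cong refl)
      fix k assume "k \<in> {..n}"
      then have "z ^ n = z ^ (n - k) * z ^ k" by (simp flip: power_add)
      then show "of_real ((- c) ^ k * of_nat ((d * (n - k) + k) choose k) * g (n - k)) * z ^ n =
          (case (n - k, k) of (m, k) \<Rightarrow> of_real (g m) * z ^ m * (of_nat ((d * m + k) choose k) * w ^ k))"
        using power_mult_distrib[of "- complex_of_real c" z k] by (simp add: w_def)
    qed
    then show "((\<lambda>k. case (n, k) of (n, k) \<Rightarrow> h (n - k, k)) has_sum (of_real (\<delta> n) * z ^ n)) {..n}"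
      by (auto intro!: has_sum_finiteI)
  qed
  then show ?thesis unfolding S_eq by (rule has_sum_imp_sums)
qed

text \<open>Bernoulli's inequality in the form t <= ((d - 1 + t) / d)^d with t = (d - 1) v. Equality
  at v = 1 / (d - 1) shows that \<open>c_star d\<close> is the best constant.\<close>

lemma c_star_bernoulli:
  assumes "2 \<le> d" "0 \<le> v"
  shows "real d ^ d * v \<le> c_star d * (1 + v) ^ d"
proof -
  define t where "t = (real d - 1) * v"
  have d: "real d - 1 > 0" using assms by simp
  have t: "0 \<le> t" using d assms by (simp add: t_def)
  have "1 + real d * ((t - 1) / real d) \<le> (1 + (t - 1) / real d) ^ d"
    using t assms by (intro Bernoulli_inequality) (simp add: field_simps)
  then have "t \<le> ((real d - 1 + t) / real d) ^ d"
    using assms by (simp add: field_simps)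
  then have "t * real d ^ d \<le> (real d - 1 + t) ^ d"
    using assms by (simp add: power_divide field_simps)
  also have "real d - 1 + t = (real d - 1) * (1 + v)" by (simp add: t_def algebra_simps)
  also have "((real d - 1) * (1 + v)) ^ d = (real d - 1) * (c_star d * (1 + v) ^ d)"
    using assms by (cases d) (simp_all add: c_star_def power_mult_distrib)
  finally have "(real d - 1) * (real d ^ d * v) \<le> (real d - 1) * (c_star d * (1 + v) ^ d)"
    by (simp add: t_def algebra_simps)
  then show ?thesis using d by simp
qed

text \<open>With finitely many negative terms, some tail has nonnegative coefficients, and
  Pringsheim's theorem makes it converge on the whole positive axis to \<open>f\<close> minus a
  polynomial. As \<open>f\<close> tends to 0, only finitely many coefficients are nonzero, so
  \<open>f\<close> is on the axis a polynomial with limit 0, hence 0, against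
  \<open>g 0 \<noteq> 0\<close>. The sequences are abstract so that the result also applies to their
  negatives.\<close>

lemma substituted_series_no_eventual_sign:
  fixes \<delta> g :: "nat \<Rightarrow> real" and c :: real
  assumes d: "2 \<le> d" and c: "c_star d < c" and g0: "g 0 \<noteq> 0"
    and \<delta>: "\<And>n. \<delta> n = (\<Sum>k\<le>n. (- c) ^ k * of_nat ((d * (n - k) + k) choose k) * g (n - k))"
    and g: "\<And>m. \<bar>g m\<bar> \<le> (real d ^ d) ^ m"
  shows "infinite {n. \<delta> n < 0}"
proof
  assume fin: "finite {n. \<delta> n < 0}"
  have cs: "c_star d > 0" using d by (simp add: c_star_def)
  then have c0: "c > 0" using c by simp
  obtain n0 where "\<forall>n\<in>{n. \<delta> n < 0}. n < n0"
    using fin unfolding finite_nat_set_iff_bounded by blast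
  then have n0: "0 \<le> \<delta> n" if "n \<ge> n0" for n
    using that by (metis linorder_not_le mem_Collect_eq)
  define K where "K = real d ^ d"
  have K: "K > 0" using d by (simp add: K_def)
  have \<delta>0: "\<delta> 0 = g 0" using \<delta>[of 0] by simp
  define G where "G w = (\<Sum>m. of_real (g m) * w ^ m)" for w :: complex
  have g_norm: "norm (of_real (g m) * w ^ m) \<le> (K * norm w) ^ m" for m and w :: complex
    using mult_right_mono[OF g[of m], of "norm w ^ m"]
    by (simp add: norm_mult norm_power power_mult_distrib K_def)
  have G_summable: "summable (\<lambda>m. norm (of_real (g m) * w ^ m))" if "K * norm w < 1" for w :: complex
  proof (rule summable_comparison_test)
    show "summable (\<lambda>m. (K * norm w) ^ m)" using that K by (intro summable_geometric) simp
    show "\<exists>N. \<forall>n\<ge>N. norm (norm (of_real (g n) * w ^ n)) \<le> (K * norm w) ^ n"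
      using g_norm by (simp only: real_norm_def abs_norm_cancel) blast
  qed
  have G_sums: "(\<lambda>m. of_real (g m) * w ^ m) sums G w" if "K * norm w < 1" for w :: complex
    unfolding G_def by (rule summable_sums[OF summable_norm_cancel[OF G_summable[OF that]]])
  have G_hol: "G holomorphic_on ball 0 (1 / K)"
  proof (rule power_series_holomorphic)
    fix w :: complex assume "w \<in> ball 0 (1 / K)"
    then have "K * norm w < 1" using K by (simp add: field_simps)
    then show "(\<lambda>n. of_real (g n) * (w - 0) ^ n) sums G w" using G_sums by simp
  qed
  define s where "s z = 1 + of_real c * z" for z :: complex
  define f where "f z = G (z / s z ^ d) / s z" for z
  \<comment> \<open>The condition that z / s(z)^d lies in the disc of convergence of
    \<open>G\<close>, multiplied out: in this form it also excludes the zeros of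
    \<open>s\<close>.\<close>
  define W where "W = {z. K * norm z < norm (s z) ^ d}"
  have s_ne: "s z \<noteq> 0" if "z \<in> W" for z
    using that d K by (auto simp: W_def power_0_left mult_less_0_iff split: if_splits)
  have W_ball: "z / s z ^ d \<in> ball 0 (1 / K)" if "z \<in> W" for z
  proof -
    have "K * norm z < norm (s z) ^ d" "0 < norm (s z) ^ d" using that s_ne[OF that] by (auto simp: W_def)
    then show ?thesis using K by (simp add: norm_divide norm_power field_simps)
  qed
  have "open W"
    unfolding W_def s_def by (intro open_Collect_less continuous_intros)
  have f_hol: "f holomorphic_on W"
  proof -
    have "(\<lambda>z. z / s z ^ d) holomorphic_on W"
      unfolding s_def by (intro holomorphic_intros) (use s_ne in \<open>auto simp: s_def\<close>)
    then have "(G \<circ> (\<lambda>z. z / s z ^ d)) holomorphic_on W"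
      by (rule holomorphic_on_compose_gen[OF _ G_hol]) (use W_ball in auto)
    moreover have "s holomorphic_on W" unfolding s_def by (intro holomorphic_intros)
    ultimately show ?thesis unfolding f_def comp_def by (intro holomorphic_intros) (use s_ne in auto)
  qed
  have bern: "K * x \<le> (c_star d / c) * (1 + c * x) ^ d" if "0 \<le> x" for x
  proof -
    have "K * (c * x) \<le> c_star d * (1 + c * x) ^ d"
      unfolding K_def using d c0 that by (intro c_star_bernoulli) auto
    then show ?thesis using c0 by (simp add: field_simps)
  qed
  have s_real: "s (of_real x) = of_real (1 + c * x)" for x by (simp add: s_def)
  have W_pos: "of_real x \<in> W" if "0 \<le> x" for x
  proof -
    have p: "1 + c * x > 0" using that c0 by (simp add: add_pos_nonneg)
    have "c_star d / c < 1" using c c0 by simp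
    then have "(c_star d / c) * (1 + c * x) ^ d < 1 * (1 + c * x) ^ d"
      using p by (intro mult_strict_right_mono) simp_all
    with bern[OF that] p that show ?thesis
      unfolding W_def mem_Collect_eq s_real norm_of_real by simp
  qed
  have f_small: "\<exists>r0>0. \<forall>z. norm z < r0 \<longrightarrow> (\<lambda>n. of_real (\<delta> n) * z ^ n) sums f z"
  proof -
    have "((\<lambda>r. (1 - c * r) ^ d - K * r) \<longlongrightarrow> (1 - c * 0) ^ d - K * 0) (at_right 0)"
      by (intro tendsto_intros)
    then have "\<forall>\<^sub>F r in at_right 0. 0 < (1 - c * r) ^ d - K * r" by (rule order_tendstoD) simp
    moreover have "\<forall>\<^sub>F r in at_right 0. c * r < 1"
    proof (rule order_tendstoD)
      show "((\<lambda>r. c * r) \<longlongrightarrow> c * 0) (at_right 0)" by (intro tendsto_intros)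
    qed simp
    ultimately have "\<forall>\<^sub>F r in at_right 0. 0 < (1 - c * r) ^ d - K * r \<and> c * r < 1"
      by (rule eventually_conj)
    then obtain b where b: "b > 0" "\<And>r. 0 < r \<Longrightarrow> r < b \<Longrightarrow> 0 < (1 - c * r) ^ d - K * r \<and> c * r < 1"
      by (auto simp: eventually_at_right_field)
    have "(\<lambda>n. of_real (\<delta> n) * z ^ n) sums f z" if z: "norm z < b" for z
    proof -
      have 1: "K * norm z < (1 - \<bar>c\<bar> * norm z) ^ d" "\<bar>c\<bar> * norm z < 1"
        using b(2)[of "norm z"] z c0 by (cases "z = 0"; auto)+
      have "(\<lambda>n. of_real (\<delta> n) * z ^ n) sums (\<Sum>m. of_real (g m) * z ^ m / (1 + of_real c * z) ^ Suc (d * m))"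
        using \<delta> g 1 by (intro substituted_series_sums[where K = K]) (auto simp: K_def)
      also have "(\<Sum>m. of_real (g m) * z ^ m / (1 + of_real c * z) ^ Suc (d * m)) = f z"
      proof -
        have "norm (1 :: complex) - norm (of_real c * z) \<le> norm (1 + of_real c * z)"
          by (rule norm_diff_ineq)
        then have "1 - \<bar>c\<bar> * norm z \<le> norm (s z)" by (simp add: s_def norm_mult)
        then have "(1 - \<bar>c\<bar> * norm z) ^ d \<le> norm (s z) ^ d" using 1 by (intro power_mono) auto
        then have "z \<in> W" using 1 by (simp add: W_def)
        then have "K * norm (z / s z ^ d) < 1" using W_ball[of z] K by (simp add: field_simps)
        then have "(\<lambda>m. of_real (g m) * (z / s z ^ d) ^ m / s z) sums f z"
          unfolding f_def by (intro sums_divide G_sums)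
        moreover have "of_real (g m) * (z / s z ^ d) ^ m / s z = of_real (g m) * z ^ m / (1 + of_real c * z) ^ Suc (d * m)" for m
          by (simp add: s_def power_divide power_mult mult.commute)
        ultimately show ?thesis by (simp add: sums_iff del: power_Suc)
      qed
      finally show ?thesis .
    qed
    then show ?thesis using b(1) by blast
  qed
  then obtain r0 where r0: "r0 > 0" "\<And>z. norm z < r0 \<Longrightarrow> (\<lambda>n. of_real (\<delta> n) * z ^ n) sums f z" by blast
  define \<delta>' where "\<delta>' n = (if n < n0 then 0 else \<delta> n)" for n
  define p where "p z = (\<Sum>n<n0. of_real (\<delta> n) * z ^ n)" for z :: complex
  have tail: "(\<lambda>n. of_real (\<delta>' n) * z ^ n) sums (f z - p z)" if "(\<lambda>n. of_real (\<delta> n) * z ^ n) sums f z" for z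
  proof -
    have "(\<lambda>n. if n \<in> {..<n0} then of_real (\<delta> n) * z ^ n else 0) sums p z"
      unfolding p_def by (rule sums_If_finite_set) simp
    from sums_diff[OF that this] show ?thesis
      by (rule sums_cong[THEN iffD1, rotated]) (simp add: \<delta>'_def)
  qed
  have all_sums: "(\<lambda>n. of_real (\<delta>' n) * of_real x ^ n) sums (f (of_real x) - p (of_real x))" if "0 \<le> x" for x
  proof (rule pringsheim[where f = "\<lambda>z. f z - p z"])
    show "(\<lambda>z. f z - p z) holomorphic_on W"
      unfolding p_def by (intro holomorphic_intros f_hol)
  qed (use \<open>open W\<close> W_pos r0 tail that n0 in \<open>auto simp: \<delta>'_def\<close>)
  define q where "q x = (\<Sum>n<n0. \<delta> n * x ^ n)" for x
  have sums_real: "(\<lambda>n. \<delta>' n * x ^ n) sums (Re (f (of_real x)) - q x)" if "0 \<le> x" for x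
  proof -
    have "p (of_real x) = of_real (q x)" by (simp add: p_def q_def)
    moreover have "(\<lambda>n. Re (of_real (\<delta>' n) * of_real x ^ n)) sums Re (f (of_real x) - p (of_real x))"
      by (rule sums_Re[OF all_sums[OF that]])
    moreover have "Re (of_real (\<delta>' n) * of_real x ^ n) = \<delta>' n * x ^ n" for n
      by (simp flip: of_real_power of_real_mult)
    ultimately show ?thesis by simp
  qed
  \<comment> \<open>Along the axis the argument of \<open>G\<close> stays in a fixed smaller disc,
    with ratio at most \<open>\<theta>\<close>. So \<open>G\<close> is bounded there, and the decay
    of \<open>f\<close> comes from its denominator \<open>1 + c * x\<close>.\<close>
  define \<theta> where "\<theta> = c_star d / c"
  have \<theta>: "0 < \<theta>" "\<theta> < 1" using c c0 cs by (auto simp: \<theta>_def)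
  have f_bound: "\<bar>Re (f (of_real x))\<bar> \<le> 1 / (1 - \<theta>) / (1 + c * x)" if "0 \<le> x" for x
  proof -
    have p: "1 + c * x > 0" using that c0 by (simp add: add_pos_nonneg)
    define w where "w = of_real x / s (of_real x) ^ d"
    have "norm w = x / (1 + c * x) ^ d"
      using that p unfolding w_def s_real by (simp add: norm_divide norm_power del: of_real_add of_real_mult)
    then have "K * norm w = (K * x) / (1 + c * x) ^ d" by simp
    also have "\<dots> \<le> \<theta>"
      using bern[OF that] zero_less_power[OF p, of d] by (simp only: pos_divide_le_eq \<theta>_def)
    finally have Kw: "K * norm w \<le> \<theta>" .
    have "norm (G w) \<le> (\<Sum>m. norm (of_real (g m) * w ^ m))"
      unfolding G_def using Kw \<theta> by (intro summable_norm G_summable) simp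
    also have "\<dots> \<le> (\<Sum>m. \<theta> ^ m)"
    proof (rule suminf_le)
      fix m
      have "norm (of_real (g m) * w ^ m) \<le> (K * norm w) ^ m"
        by (rule g_norm)
      also have "\<dots> \<le> \<theta> ^ m" using Kw K by (intro power_mono) auto
      finally show "norm (of_real (g m) * w ^ m) \<le> \<theta> ^ m" .
    qed (use G_summable[of w] Kw \<theta> in \<open>auto intro: summable_geometric\<close>)
    also have "\<dots> = 1 / (1 - \<theta>)" using \<theta> by (simp add: suminf_geometric)
    finally have "norm (G w) \<le> 1 / (1 - \<theta>)" .
    then have "norm (G w) / (1 + c * x) \<le> 1 / (1 - \<theta>) / (1 + c * x)"
      by (rule divide_right_mono) (use p in simp)
    moreover have "norm (f (of_real x)) = norm (G w) / (1 + c * x)"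
      using p unfolding f_def w_def[symmetric] unfolding s_real
      by (simp add: norm_divide del: of_real_add of_real_mult)
    ultimately have "norm (f (of_real x)) \<le> 1 / (1 - \<theta>) / (1 + c * x)" by simp
    then show ?thesis using abs_Re_le_cmod order_trans by blast
  qed
  have lim0: "((\<lambda>x. Re (f (of_real x))) \<longlongrightarrow> 0) at_top"
  proof (rule Lim_null_comparison)
    show "\<forall>\<^sub>F x in at_top. norm (Re (f (of_real x))) \<le> 1 / (1 - \<theta>) / (1 + c * x)"
      using eventually_ge_at_top[of "0::real"] by eventually_elim (unfold real_norm_def, rule f_bound)
    show "((\<lambda>x. 1 / (1 - \<theta>) / (1 + c * x)) \<longlongrightarrow> 0) at_top"
      using c0 by real_asymp
  qed
  have poly_bound: "\<delta>' N * x ^ N + q x \<le> Re (f (of_real x))" if "0 \<le> x" for x N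
  proof -
    have "(\<Sum>n\<in>{N}. \<delta>' n * x ^ n) \<le> (\<Sum>n. \<delta>' n * x ^ n)"
      using sums_real[OF that] that n0
      by (intro sum_le_suminf) (auto simp: sums_iff \<delta>'_def)
    also have "\<dots> = Re (f (of_real x)) - q x" using sums_real[OF that] by (simp add: sums_iff)
    finally show ?thesis by simp
  qed
  \<comment> \<open>Strictly above \<open>n0\<close>, so that N is positive and x^N tends to
    infinity even if \<open>n0\<close> is 0; the coefficient at \<open>n0\<close> itself goes into
    the polynomial \<open>P\<close> below.\<close>
  have \<delta>'0: "\<delta>' N = 0" if "n0 < N" for N
  proof (rule ccontr)
    assume "\<delta>' N \<noteq> 0"
    then have pos: "\<delta>' N > 0" using n0[of N] that by (auto simp: \<delta>'_def)
    have "((\<lambda>x. q x / x ^ N) \<longlongrightarrow> (\<Sum>n<n0. 0)) at_top"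
      unfolding q_def sum_divide_distrib
    proof (intro tendsto_sum)
      fix n assume "n \<in> {..<n0}"
      then have nN: "n < N" using that by simp
      have "((\<lambda>x. \<delta> n * inverse (x ^ (N - n))) \<longlongrightarrow> \<delta> n * 0) at_top"
        using nN by (intro tendsto_intros tendsto_inverse_0_at_top filterlim_pow_at_top filterlim_ident) simp
      moreover have "\<forall>\<^sub>F x in at_top. \<delta> n * inverse (x ^ (N - n)) = \<delta> n * x ^ n / x ^ N"
        using eventually_gt_at_top[of "0::real"]
      proof eventually_elim
        case (elim x)
        have "x ^ N = x ^ n * x ^ (N - n)" using nN by (simp flip: power_add)
        then show ?case using elim by (simp add: field_simps)
      qed
      ultimately show "((\<lambda>x. \<delta> n * x ^ n / x ^ N) \<longlongrightarrow> 0) at_top"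
        by (simp add: filterlim_cong[OF refl refl])
    qed
    moreover have "((\<lambda>x. Re (f (of_real x)) / x ^ N) \<longlongrightarrow> 0) at_top"
      using that by (intro tendsto_divide_0[OF lim0] filterlim_at_top_imp_at_infinity filterlim_pow_at_top filterlim_ident) simp
    ultimately have "((\<lambda>x. Re (f (of_real x)) / x ^ N - q x / x ^ N) \<longlongrightarrow> 0 - 0) at_top"
      by (intro tendsto_diff) simp_all
    moreover have "\<forall>\<^sub>F x in at_top. \<delta>' N \<le> Re (f (of_real x)) / x ^ N - q x / x ^ N"
      using eventually_gt_at_top[of "0::real"]
    proof eventually_elim
      case (elim x)
      then have "\<delta>' N * x ^ N \<le> Re (f (of_real x)) - q x" using poly_bound[of x N] by simp
      then show ?case using elim by (simp add: field_simps)
    qed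
    ultimately have "\<delta>' N \<le> 0 - 0" by (intro tendsto_lowerbound) auto
    then show False using pos by simp
  qed
  define P where "P = (\<Sum>n\<le>n0. monom (\<delta> n) n)"
  have P_eq: "poly P x = Re (f (of_real x))" if "0 \<le> x" for x
  proof -
    have "\<delta>' n = 0" if "n \<notin> {n0}" for n
      using that \<delta>'0[of n] by (cases "n < n0") (auto simp: \<delta>'_def)
    then have "(\<lambda>n. \<delta>' n * x ^ n) sums (\<Sum>n\<in>{n0}. \<delta>' n * x ^ n)"
      by (intro sums_finite) auto
    then have "\<delta> n0 * x ^ n0 = Re (f (of_real x)) - q x"
      using sums_unique2[OF sums_real[OF that]] by (simp add: \<delta>'_def)
    moreover have "poly P x = q x + \<delta> n0 * x ^ n0"
      by (simp add: P_def q_def poly_sum poly_monom lessThan_Suc_atMost[symmetric])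
    ultimately show ?thesis by simp
  qed
  have "\<forall>\<^sub>F x in at_top. poly P x = Re (f (of_real x))"
    using eventually_ge_at_top[of "0::real"] by eventually_elim (rule P_eq)
  then have "((\<lambda>x. poly P x) \<longlongrightarrow> 0) at_top"
    using lim0 by (simp add: filterlim_cong[OF refl refl])
  moreover have "poly P 0 \<noteq> 0" using g0 \<delta>0
    by (simp add: P_def poly_sum poly_monom power_0_left if_distrib cong: if_cong)
  ultimately show False
  proof (cases "degree P = 0")
    case True
    then obtain b where "P = [:b:]" by (rule degree_eq_zeroE)
    then show False using \<open>((\<lambda>x. poly P x) \<longlongrightarrow> 0) at_top\<close> \<open>poly P 0 \<noteq> 0\<close>
      by (simp add: tendsto_const_iff)
  next
    case False
    then have "filterlim (poly P) at_infinity at_infinity"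
      by (intro filterlim_poly_at_infinity) simp
    then have "filterlim (poly P) at_infinity at_top"
      using at_top_le_at_infinity by (rule filterlim_mono[OF _ order_refl])
    then show False
      using \<open>((\<lambda>x. poly P x) \<longlongrightarrow> 0) at_top\<close> not_tendsto_and_filterlim_at_infinity
      by (metis trivial_limit_at_top_linorder)
  qed
qed

subsection \<open>An inequality on the torus\<close>

text \<open>\<open>m\<close> has the mean of the two angles and \<open>t\<close> is the cosine of
  half their difference. With \<open>m\<close> fixed, varying \<open>t\<close> keeps the product and
  moves the sum along a segment.\<close>

lemma unit_pair_midpoint:
  fixes z w :: complex
  assumes "norm z = 1" "norm w = 1"
  obtains m t where "norm m = 1" "t \<in> {-1..1}" "z * w = m\<^sup>2" "z + w = of_real (2 * t) * m"
    "t\<^sup>2 = 1 \<Longrightarrow> z = w"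
proof -
  have "z = cis (Arg z)" "w = cis (Arg w)"
    using assms by (metis mult_1 of_real_1 rcis_cmod_Arg rcis_def)+
  then obtain x y where xy: "z = cis x" "w = cis y" by blast
  define m where "m = cis ((x + y) / 2)"
  define t where "t = cos ((x - y) / 2)"
  have z: "z = m * cis ((x - y) / 2)" and w: "w = m * cis (- ((x - y) / 2))"
    by (simp_all add: xy m_def cis_mult field_simps)
  have "z * w = m\<^sup>2"
    by (simp add: xy m_def cis_mult power2_eq_square)
  moreover have "z + w = of_real (2 * t) * m"
    by (simp add: z w t_def complex_eq_iff algebra_simps)
  moreover have "z = w" if "t\<^sup>2 = 1"
  proof -
    have "sin ((x - y) / 2) = 0" using that sin_cos_squared_add[of "(x - y) / 2"] by (simp add: t_def)
    then show ?thesis by (simp add: z w complex_eq_iff)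
  qed
  moreover have "norm m = 1" "t \<in> {-1..1}" by (simp_all add: m_def t_def)
  ultimately show ?thesis using that by blast
qed

text \<open>If \<open>u\<close> occurs k times, the claim is |1 - u^k| <= k |1 - u|.\<close>

lemma norm_one_minus_prod_le_two_values:
  fixes z :: "'i \<Rightarrow> complex"
  assumes "finite K" "norm u = 1" "\<And>i. i \<in> K \<Longrightarrow> z i \<in> {1, u}"
  shows "norm (1 - prod z K) \<le> norm (\<Sum>i\<in>K. 1 - z i)"
proof -
  define A where "A = {i \<in> K. z i \<noteq> 1}"
  have A: "finite A" "A \<subseteq> K" "\<And>i. i \<in> A \<Longrightarrow> z i = u"
    using assms(1) assms(3) by (auto simp: A_def)
  have "prod z K = prod z A"
    by (rule prod.mono_neutral_right[OF assms(1)]) (auto simp: A_def)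
  also have "\<dots> = (\<Prod>i\<in>A. u)" by (intro prod.cong A(3)) auto
  also have "\<dots> = u ^ card A" by simp
  finally have 1: "prod z K = u ^ card A" .
  have "(\<Sum>i\<in>K. 1 - z i) = (\<Sum>i\<in>A. 1 - z i)"
    by (rule sum.mono_neutral_right[OF assms(1)]) (auto simp: A_def)
  also have "\<dots> = (\<Sum>i\<in>A. 1 - u)" by (intro sum.cong) (auto simp: A(3))
  also have "\<dots> = of_nat (card A) * (1 - u)" by simp
  finally have 2: "norm (\<Sum>i\<in>K. 1 - z i) = card A * norm (1 - u)" by (simp add: norm_mult)
  have "norm (1 ^ card A - u ^ card A) \<le> card A * norm (1 - u)"
    using assms(2) by (intro norm_power_diff) auto
  then show ?thesis unfolding 1 2 by simp
qed

text \<open>At a minimum of the difference of the two sides over the torus, replacing two coordinates by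
  another pair with the same product moves the sum along a segment, so either the two coordinates
  agree or the sum is orthogonal to the direction of that segment. Hence at most two values occur,
  and one of them is 1.\<close>

lemma norm_one_minus_prod_le_vec:
  fixes z :: "complex ^ 'd::finite"
  assumes "\<And>i. norm (z $ i) = 1"
  shows "norm (1 - (\<Prod>i\<in>UNIV. z $ i)) \<le> norm (\<Sum>i\<in>UNIV. 1 - z $ i)"
proof -
  define T where "T = {z :: complex ^ 'd. \<forall>i. norm (z $ i) = 1}"
  define G where "G z = (norm (\<Sum>i\<in>UNIV. 1 - z $ i))\<^sup>2 - (norm (1 - (\<Prod>i\<in>UNIV. z $ i)))\<^sup>2"
    for z :: "complex ^ 'd"
  have "closed T"
    unfolding T_def by (intro closed_Collect_all closed_Collect_eq continuous_intros)
  moreover have "bounded T"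
    unfolding bounded_iff
  proof (intro exI ballI)
    fix z assume "z \<in> T"
    then have "(\<Sum>i\<in>UNIV. norm (z $ i)) = CARD('d)" by (simp add: T_def)
    then show "norm z \<le> CARD('d)"
      unfolding norm_vec_def using L2_set_le_sum[of UNIV "\<lambda>i. norm (z $ i)"] by simp
  qed
  ultimately have "compact T" by (simp add: compact_eq_bounded_closed)
  moreover have "T \<noteq> {}" using assms by (auto simp: T_def)
  moreover have "continuous_on T G"
    unfolding G_def by (intro continuous_intros)
  ultimately obtain z0 where z0: "z0 \<in> T" "\<And>z. z \<in> T \<Longrightarrow> G z0 \<le> G z"
    using continuous_attains_inf[of T G] by blast
  define D where "D = (\<Sum>i\<in>UNIV. 1 - z0 $ i)"
  have n1: "norm (z0 $ i) = 1" for i using z0(1) by (simp add: T_def)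
  \<comment> \<open>Orthogonality of \<open>D\<close> to m, where m^2 is the product of the two
    coordinates: 2 Re (D * cnj m) = 0, multiplied by m so that only m^2 remains.\<close>
  have pair: "D + cnj D * (z0 $ i * z0 $ j) = 0" if "z0 $ i \<noteq> z0 $ j" for i j
  proof -
    have ij: "i \<noteq> j" using that by auto
    obtain m t where mt: "norm m = 1" "t \<in> {-1..1}" "z0 $ i * z0 $ j = m\<^sup>2"
      "z0 $ i + z0 $ j = of_real (2 * t) * m" "t\<^sup>2 = 1 \<Longrightarrow> z0 $ i = z0 $ j"
      by (rule unit_pair_midpoint[OF n1[of i] n1[of j]]) blast
    define R where "R = UNIV - {i, j}"
    have U: "UNIV = insert i (insert j R)" "finite R" "i \<notin> R" "j \<notin> R" by (auto simp: R_def)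
    have sum_split: "sum f UNIV = f i + f j + sum f R" for f :: "'d \<Rightarrow> complex"
      using ij U(2-) by (subst U(1)) (simp add: add.assoc)
    have prod_split: "prod f UNIV = f i * f j * prod f R" for f :: "'d \<Rightarrow> complex"
      using ij U(2-) by (subst U(1)) (simp add: mult.assoc)
    define e where "e = D + of_real (2 * t) * m"
    \<comment> \<open>Each s in [-1, 1] is realised by the pair of points m * cis (arccos s) and m *
      cis (- arccos s), with product m^2 and sum 2 s m. The full product is unchanged, so minimality
      of \<open>G\<close> compares the sums alone.\<close>
    have key: "norm (e - of_real (2 * t) * m) \<le> norm (e - of_real (2 * s) * m)" if s: "s \<in> {-1..1}" for s
    proof -
      define z where "z = (\<chi> k. if k = i then m * cis (arccos s)
          else if k = j then m * cis (- arccos s) else z0 $ k)"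
      have zi: "z $ i = m * cis (arccos s)" "z $ j = m * cis (- arccos s)"
        using ij by (auto simp: z_def)
      have zR: "z $ k = z0 $ k" if "k \<in> R" for k using that by (auto simp: z_def R_def)
      have "z \<in> T" using mt(1) n1 by (auto simp: T_def z_def norm_mult)
      then have "G z0 \<le> G z" by (rule z0(2))
      moreover have "prod (($) z) UNIV = prod (($) z0) UNIV"
      proof -
        have "z $ i * z $ j = z0 $ i * z0 $ j"
          unfolding zi mt(3) by (simp add: cis_mult power2_eq_square)
        then show ?thesis unfolding prod_split using zR by simp
      qed
      moreover have "(\<Sum>i\<in>UNIV. 1 - z $ i) = e - of_real (2 * s) * m"
      proof -
        have "z $ i + z $ j = m * (cis (arccos s) + cis (- arccos s))" by (simp add: zi algebra_simps)
        also have "cis (arccos s) + cis (- arccos s) = of_real (2 * s)"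
          using s by (simp add: complex_eq_iff)
        finally have "z $ i + z $ j = of_real (2 * s) * m" by (simp add: mult.commute)
        moreover have "(\<Sum>i\<in>UNIV. 1 - z $ i) = D + (z0 $ i + z0 $ j) - (z $ i + z $ j)"
          unfolding D_def sum_split using zR by simp
        ultimately show ?thesis by (simp add: e_def mt(4))
      qed
      ultimately have "(norm D)\<^sup>2 \<le> (norm (e - of_real (2 * s) * m))\<^sup>2"
        by (simp add: G_def D_def)
      then show ?thesis by (simp add: e_def)
    qed
    define p where "p = Re (e * cnj m)"
    have sq: "(norm (e - of_real (2 * s) * m))\<^sup>2 = (norm e)\<^sup>2 - 4 * s * p + 4 * s\<^sup>2" for s
    proof -
      have "(norm m)\<^sup>2 = 1" using mt(1) by simp
      then have m2: "(Re m)\<^sup>2 + (Im m)\<^sup>2 = 1" by (simp add: cmod_power2)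
      have "(norm (e - of_real (2 * s) * m))\<^sup>2 = (norm e)\<^sup>2 - 4 * s * p + 4 * s\<^sup>2 * ((Re m)\<^sup>2 + (Im m)\<^sup>2)"
        unfolding cmod_power2 p_def by (simp add: power2_eq_square algebra_simps)
      then show ?thesis by (simp add: m2)
    qed
    have min_q: "4 * t\<^sup>2 - 4 * t * p \<le> 4 * s\<^sup>2 - 4 * s * p" if "s \<in> {-1..1}" for s
    proof -
      have "(norm (e - of_real (2 * t) * m))\<^sup>2 \<le> (norm (e - of_real (2 * s) * m))\<^sup>2"
        using key[OF that] by (rule power_mono) simp
      then show ?thesis unfolding sq by simp
    qed
    have "t\<^sup>2 \<noteq> 1" using mt(5) that by blast
    then have "\<bar>t\<bar> < 1" using mt(2) by (smt (verit) atLeastAtMost_iff power2_eq_1_iff)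
    \<comment> \<open>The derivative of the quadratic vanishes at its interior minimum
      \<open>t\<close>. The trial step \<open>h\<close> stays inside [-1, 1] and is at most half as
      long as \<open>p - 2 * t\<close>.\<close>
    have "p = 2 * t"
    proof (rule ccontr)
      assume ne: "p \<noteq> 2 * t"
      define h where "h = min ((1 - \<bar>t\<bar>) / 2) (\<bar>p - 2 * t\<bar> / 2) * sgn (p - 2 * t)"
      have h: "\<bar>h\<bar> \<le> (1 - \<bar>t\<bar>) / 2" "\<bar>h\<bar> \<le> \<bar>p - 2 * t\<bar> / 2" "h * (p - 2 * t) = \<bar>h\<bar> * \<bar>p - 2 * t\<bar>" "\<bar>h\<bar> > 0"
        using ne \<open>\<bar>t\<bar> < 1\<close> by (auto simp: h_def abs_mult sgn_real_def min_def)
      have "t + h \<in> {-1..1}" using h(1) \<open>\<bar>t\<bar> < 1\<close> by auto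
      from min_q[OF this] have "h * (p - 2 * t) \<le> h\<^sup>2"
        by (simp add: power2_eq_square algebra_simps)
      then have "\<bar>h\<bar> * \<bar>p - 2 * t\<bar> \<le> \<bar>h\<bar> * \<bar>h\<bar>" using h(3) by (simp add: power2_eq_square)
      then have "\<bar>p - 2 * t\<bar> \<le> \<bar>h\<bar>" by (rule mult_left_le_imp_le) (rule h(4))
      from order_trans[OF this h(2)] have "\<bar>p - 2 * t\<bar> \<le> 0" by simp
      then show False using ne by simp
    qed
    have mm: "m * cnj m = 1" using mt(1) by (simp add: complex_norm_square[symmetric])
    have "Re (D * cnj m) = 0"
    proof -
      have "D * cnj m = e * cnj m - of_real (2 * t) * (m * cnj m)" by (simp add: e_def algebra_simps)
      then show ?thesis using \<open>p = 2 * t\<close> by (simp add: mm p_def)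
    qed
    then have "D * cnj m + cnj (D * cnj m) = 0" by (simp add: complex_eq_iff)
    then have "(D * cnj m + cnj D * m) * m = 0" by simp
    then have "D * (m * cnj m) + cnj D * m\<^sup>2 = 0" by (simp add: algebra_simps power2_eq_square)
    then show ?thesis by (simp add: mm mt(3))
  qed
  have "\<exists>u. norm u = 1 \<and> (\<forall>i. z0 $ i \<in> {1, u})"
  proof (cases "\<forall>i j. z0 $ i = z0 $ j")
    case True
    then show ?thesis using n1 by blast
  next
    case False
    then obtain i j where ij: "z0 $ i \<noteq> z0 $ j" by blast
    show ?thesis
    proof (cases "D = 0")
      case True
      have nn: "0 \<le> Re (1 - z0 $ k)" for k using n1[of k] complex_Re_le_cmod[of "z0 $ k"] by simp
      have "(\<Sum>k\<in>UNIV. Re (1 - z0 $ k)) = 0" using True unfolding D_def by (metis Re_sum zero_complex.sel(1))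
      then have "\<forall>k\<in>UNIV. Re (1 - z0 $ k) = 0"
        using nn by (subst sum_nonneg_eq_0_iff[symmetric]) auto
      then have Re1: "Re (z0 $ k) = 1" for k by simp
      have "z0 $ k = 1" for k
      proof -
        have "(Re (z0 $ k))\<^sup>2 + (Im (z0 $ k))\<^sup>2 = 1"
          using n1[of k] by (simp add: cmod_power2[symmetric])
        then show ?thesis using Re1[of k] by (simp add: complex_eq_iff)
      qed
      then show ?thesis by (metis insertI1 norm_one)
    next
      case False
      have vals: "z0 $ k \<in> {z0 $ i, z0 $ j}" for k
      proof (rule ccontr)
        assume k: "z0 $ k \<notin> {z0 $ i, z0 $ j}"
        have "D + cnj D * (z0 $ i * z0 $ j) = D + cnj D * (z0 $ i * z0 $ k)"
          using pair[OF ij] pair[of i k] k by auto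
        moreover have "z0 $ i \<noteq> 0" using n1[of i] by auto
        ultimately have "z0 $ j = z0 $ k" using False by simp
        then show False using k by simp
      qed
      define u v where "u = z0 $ i" and "v = z0 $ j"
      have uv: "u * cnj u = 1" "v * cnj v = 1"
        unfolding u_def v_def using n1 by (simp_all add: complex_norm_square[symmetric])
      \<comment> \<open>Both possible values contribute the same amount to
        \<open>D + cnj D * (u * v)\<close>, which turns the relation for the pair into d (1 - u) (1
        - v) = 0.\<close>
      have term_eq: "(1 - w) + cnj (1 - w) * (u * v) = (1 - u) * (1 - v)" if "w = u \<or> w = v" for w
      proof -
        have "(1 - u) + cnj (1 - u) * (u * v) = 1 - u + u * v - (u * cnj u) * v"
          "(1 - v) + cnj (1 - v) * (u * v) = 1 - v + u * v - (v * cnj v) * u"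
          by (simp_all add: algebra_simps)
        then show ?thesis using that uv by (auto simp: algebra_simps)
      qed
      have "D + cnj D * (u * v) = (\<Sum>k\<in>UNIV. (1 - z0 $ k) + cnj (1 - z0 $ k) * (u * v))"
        by (simp add: D_def sum.distrib sum_distrib_right)
      also have "\<dots> = (\<Sum>k\<in>(UNIV :: 'd set). (1 - u) * (1 - v))"
        using vals by (intro sum.cong term_eq) (auto simp: u_def v_def)
      finally have "of_nat CARD('d) * ((1 - u) * (1 - v)) = 0"
        using pair[OF ij] by (simp add: u_def v_def)
      then have "u = 1 \<or> v = 1" by simp
      then show ?thesis
      proof
        assume "u = 1"
        then have "z0 $ k \<in> {1, v}" for k using vals[of k] by (simp add: u_def v_def)
        then show ?thesis using n1[of j] unfolding v_def by blast
      next
        assume "v = 1"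
        then have "z0 $ k \<in> {1, u}" for k using vals[of k] by (auto simp: u_def v_def)
        then show ?thesis using n1[of i] unfolding u_def by blast
      qed
    qed
  qed
  then obtain u where "norm u = 1" "\<And>i. z0 $ i \<in> {1, u}" by blast
  then have "norm (1 - (\<Prod>i\<in>UNIV. z0 $ i)) \<le> norm (\<Sum>i\<in>UNIV. 1 - z0 $ i)"
    by (intro norm_one_minus_prod_le_two_values) auto
  then have "0 \<le> G z0" by (simp add: G_def power_mono)
  also have "\<dots> \<le> G z" using assms by (intro z0(2)) (simp add: T_def)
  finally show ?thesis by (simp add: G_def abs_le_square_iff[symmetric])
qed

lemma norm_one_minus_prod_le:
  fixes z :: "'d::finite \<Rightarrow> complex"
  assumes "\<And>i. i \<in> K \<Longrightarrow> norm (z i) = 1"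
  shows "norm (1 - prod z K) \<le> norm (\<Sum>i\<in>K. 1 - z i)"
proof -
  define y where "y = (\<chi> i. if i \<in> K then z i else 1)"
  have "(\<Prod>i\<in>UNIV. y $ i) = prod z K"
    by (rule prod.mono_neutral_cong_right) (auto simp: y_def)
  moreover have "(\<Sum>i\<in>UNIV. 1 - y $ i) = (\<Sum>i\<in>K. 1 - z i)"
    by (rule sum.mono_neutral_cong_right) (auto simp: y_def)
  moreover have "norm (y $ i) = 1" for i using assms by (simp add: y_def)
  ultimately show ?thesis using norm_one_minus_prod_le_vec[of y] by simp
qed

subsection \<open>Coefficients as Fourier integrals\<close>

abbreviation arc :: "real measure" where "arc \<equiv> uniform_measure lborel {-pi..pi}"

lemma prob_space_arc: "prob_space arc"
  by (rule prob_space_uniform_measure) simp_all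

lemma arc_eq_density: "arc = density lborel (\<lambda>x. ennreal (indicator {-pi..pi} x / (2 * pi)))"
  unfolding uniform_measure_def
proof (rule density_cong)
  have "indicator {-pi..pi} x / ennreal (2 * pi) = ennreal (indicator {-pi..pi} x / (2 * pi))" for x :: real
    using divide_ennreal[of "indicator {-pi..pi} x" "2 * pi"] by (simp add: ennreal_indicator)
  then show "AE x in lborel. indicator {-pi..pi} x / emeasure lborel {-pi..pi}
      = ennreal (indicator {-pi..pi} x / (2 * pi))" by simp
qed simp_all

lemma integral_arc:
  fixes f :: "real \<Rightarrow> 'a::{banach, second_countable_topology}"
  assumes "f \<in> borel_measurable borel"
  shows "integral\<^sup>L arc f = (\<integral>x. (indicator {-pi..pi} x / (2 * pi)) *\<^sub>R f x \<partial>lborel)"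
  unfolding arc_eq_density using assms by (intro integral_density) auto

lemma integral_arc_cis: "(\<integral>x. cis (of_int m * x) \<partial>arc) = of_bool (m = 0)"
proof (cases "m = 0")
  case True
  interpret prob_space arc by (rule prob_space_arc)
  show ?thesis using True prob_space by simp
next
  case False
  define F where "F x = cis (of_int m * x) / (\<i> * of_int m)" for x
  have "(F has_vector_derivative cis (of_int m * x)) (at x within {-pi..pi})" for x
  proof -
    have "((\<lambda>z. exp (\<i> * of_int m * z) / (\<i> * of_int m)) has_field_derivative exp (\<i> * of_int m * of_real x)) (at (of_real x))"
      using False by (auto intro!: derivative_eq_intros)
    from has_vector_derivative_real_field[OF this, of "{-pi..pi}"] show ?thesis
      by (simp add: F_def[abs_def] cis_conv_exp mult_ac)
  qed
  moreover have "continuous_on {-pi..pi} (\<lambda>x. cis (of_int m * x))"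
    by (intro continuous_intros)
  ultimately have "(\<integral>x. indicator {-pi..pi} x *\<^sub>R cis (of_int m * x) \<partial>lborel) = F pi - F (- pi)"
    by (intro integral_FTC_Icc) auto
  also have "F pi - F (- pi) = 0"
  proof -
    have "sin (of_int m * pi) = 0" by (auto simp: sin_zero_iff_int2)
    then have "cis (of_int m * pi) = cis (of_int m * - pi)" by (simp add: complex_eq_iff)
    then show ?thesis by (simp add: F_def)
  qed
  finally have "(\<integral>x. (1 / (2 * pi)) *\<^sub>R (indicator {-pi..pi} x *\<^sub>R cis (of_int m * x)) \<partial>lborel) = 0"
    by (simp only: integral_scaleR_right) simp
  moreover have "(\<lambda>x. cis (of_int m * x)) \<in> borel_measurable borel"
    by (intro borel_measurable_continuous_onI continuous_intros)
  ultimately show ?thesis using False by (simp add: integral_arc)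
qed

definition torus :: "'i set \<Rightarrow> ('i \<Rightarrow> real) measure" where
  "torus K = PiM K (\<lambda>_. arc)"

lemma product_sigma_finite_arc: "product_sigma_finite (\<lambda>_. arc)"
  unfolding product_sigma_finite_def
  using prob_space_arc prob_space_imp_sigma_finite by blast

lemma prob_space_torus: "prob_space (torus K)"
  unfolding torus_def by (intro prob_space_PiM prob_space_arc)

lemma measurable_torus_component: "i \<in> K \<Longrightarrow> (\<lambda>\<theta>. \<theta> i) \<in> borel_measurable (torus K)"
  unfolding torus_def using measurable_component_singleton[of i K "\<lambda>_. arc"]
  by (simp add: measurable_def)

lemma measurable_torus_cis: "i \<in> K \<Longrightarrow> (\<lambda>\<theta>. cis (r * \<theta> i)) \<in> borel_measurable (torus K)"
  by (rule measurable_compose[OF measurable_torus_component])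
    (auto intro!: borel_measurable_continuous_onI continuous_intros)

lemma measurable_torus_cis1: "i \<in> K \<Longrightarrow> (\<lambda>\<theta>. cis (\<theta> i)) \<in> borel_measurable (torus K)"
  using measurable_torus_cis[of i K 1] by simp

text \<open>At the critical point with radii \<open>y_i\<close> put \<open>1 / (1 - s) = V\<close>, \<open>y_i / (1 - s) = \<beta>_i\<close> and
  \<open>c p / (1 - c p) = \<tau>\<close>. Then \<open>kernel_den\<close> and \<open>kernel_num\<close> are \<open>1 - s\<close> and \<open>1 - c p\<close> on the torus,
  normalised to 1 at the centre.\<close>

definition char_torus :: "'i set \<Rightarrow> ('i \<Rightarrow> int) \<Rightarrow> ('i \<Rightarrow> real) \<Rightarrow> complex" where
  "char_torus K q \<theta> = (\<Prod>i\<in>K. cis (- of_int (q i) * \<theta> i))"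

definition kernel_den :: "'i set \<Rightarrow> ('i \<Rightarrow> real) \<Rightarrow> ('i \<Rightarrow> real) \<Rightarrow> complex" where
  "kernel_den K \<beta> \<theta> = 1 + (\<Sum>i\<in>K. of_real (\<beta> i) * (1 - cis (\<theta> i)))"

definition kernel_num :: "'i set \<Rightarrow> real \<Rightarrow> ('i \<Rightarrow> real) \<Rightarrow> complex" where
  "kernel_num K \<tau> \<theta> = 1 + of_real \<tau> * (1 - (\<Prod>i\<in>K. cis (\<theta> i)))"

text \<open>Cauchy's integrand for a coefficient of (1 - c p)^n / (1 - s)^(n+1) in the variables
  indexed by \<open>K\<close>, up to the constant factors restored in
  \<open>coeff_eq_fourier_coeff\<close>. The index \<open>q\<close> is integral so that it can be
  shifted freely.\<close>

definition fourier_integrand ::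
    "'i set \<Rightarrow> ('i \<Rightarrow> real) \<Rightarrow> real \<Rightarrow> nat \<Rightarrow> ('i \<Rightarrow> int) \<Rightarrow> ('i \<Rightarrow> real) \<Rightarrow> complex" where
  "fourier_integrand K \<beta> \<tau> n q \<theta> = kernel_num K \<tau> \<theta> ^ n / kernel_den K \<beta> \<theta> ^ Suc n * char_torus K q \<theta>"

definition fourier_coeff :: "'i set \<Rightarrow> ('i \<Rightarrow> real) \<Rightarrow> real \<Rightarrow> nat \<Rightarrow> ('i \<Rightarrow> int) \<Rightarrow> complex" where
  "fourier_coeff K \<beta> \<tau> n q = integral\<^sup>L (torus K) (fourier_integrand K \<beta> \<tau> n q)"

lemma norm_char_torus [simp]: "norm (char_torus K q \<theta>) = 1"
  by (simp add: char_torus_def flip: prod_norm)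

lemma Re_kernel_den_ge_1:
  assumes "\<forall>i\<in>K. 0 \<le> \<beta> i"
  shows "1 \<le> Re (kernel_den K \<beta> \<theta>)"
proof -
  have "0 \<le> (\<Sum>i\<in>K. \<beta> i * (1 - cos (\<theta> i)))" using assms by (intro sum_nonneg mult_nonneg_nonneg) auto
  then show ?thesis by (simp add: kernel_den_def)
qed

lemma norm_kernel_den_ge_1:
  assumes "\<forall>i\<in>K. 0 \<le> \<beta> i"
  shows "1 \<le> norm (kernel_den K \<beta> \<theta>)"
  using Re_kernel_den_ge_1[OF assms, of \<theta>] complex_Re_le_cmod[of "kernel_den K \<beta> \<theta>"] by linarith

lemma norm_kernel_num_le:
  assumes "0 \<le> \<tau>"
  shows "norm (kernel_num K \<tau> \<theta>) \<le> 1 + 2 * \<tau>"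
proof -
  have "norm (1 - (\<Prod>i\<in>K. cis (\<theta> i))) \<le> 1 + norm (\<Prod>i\<in>K. cis (\<theta> i))"
    using norm_triangle_ineq4[of 1 "\<Prod>i\<in>K. cis (\<theta> i)"] by simp
  then have "norm (1 - (\<Prod>i\<in>K. cis (\<theta> i))) \<le> 2" by (simp flip: prod_norm)
  then have "\<tau> * norm (1 - (\<Prod>i\<in>K. cis (\<theta> i))) \<le> \<tau> * 2" using assms by (rule mult_left_mono)
  moreover have "norm (kernel_num K \<tau> \<theta>) \<le> 1 + \<tau> * norm (1 - (\<Prod>i\<in>K. cis (\<theta> i)))"
    unfolding kernel_num_def using assms
    by (intro order_trans[OF norm_triangle_ineq]) (simp add: norm_mult)
  ultimately show ?thesis by simp
qed

lemma measurable_fourier_integrand: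
  "fourier_integrand K \<beta> \<tau> n q \<in> borel_measurable (torus K)"
  unfolding fourier_integrand_def kernel_num_def kernel_den_def char_torus_def
  by (intro borel_measurable_times borel_measurable_divide borel_measurable_power borel_measurable_add
      borel_measurable_sum borel_measurable_prod borel_measurable_diff borel_measurable_const
      measurable_torus_cis measurable_torus_cis1)

lemma norm_fourier_integrand_le:
  assumes "\<forall>i\<in>K. 0 \<le> \<beta> i" "0 \<le> \<tau>"
  shows "norm (fourier_integrand K \<beta> \<tau> n q \<theta>) \<le> (1 + 2 * \<tau>) ^ n"
proof -
  have "norm (kernel_num K \<tau> \<theta>) ^ n / norm (kernel_den K \<beta> \<theta>) ^ Suc n \<le> (1 + 2 * \<tau>) ^ n / 1"
    using norm_kernel_num_le[OF assms(2), of K \<theta>] norm_kernel_den_ge_1[OF assms(1), of \<theta>] assms(2)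
    by (intro frac_le power_mono one_le_power) auto
  then show ?thesis by (simp add: fourier_integrand_def norm_mult norm_divide norm_power)
qed

lemma integrable_fourier_integrand:
  assumes "\<forall>i\<in>K. 0 \<le> \<beta> i" "0 \<le> \<tau>"
  shows "integrable (torus K) (fourier_integrand K \<beta> \<tau> n q)"
proof -
  interpret prob_space "torus K" by (rule prob_space_torus)
  show ?thesis
    using norm_fourier_integrand_le[OF assms] measurable_fourier_integrand
    by (intro integrable_const_bound[where B = "(1 + 2 * \<tau>) ^ n"]) auto
qed

lemma norm_fourier_coeff_le:
  assumes "\<forall>i\<in>K. 0 \<le> \<beta> i" "0 \<le> \<tau>"
  shows "norm (fourier_coeff K \<beta> \<tau> n q) \<le> (1 + 2 * \<tau>) ^ n"
proof -
  interpret prob_space "torus K" by (rule prob_space_torus)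
  have "norm (fourier_coeff K \<beta> \<tau> n q) \<le> (\<integral>\<theta>. norm (fourier_integrand K \<beta> \<tau> n q \<theta>) \<partial>torus K)"
    unfolding fourier_coeff_def by simp
  also have "\<dots> \<le> (\<integral>\<theta>. (1 + 2 * \<tau>) ^ n \<partial>torus K)"
    using integrable_fourier_integrand[OF assms] norm_fourier_integrand_le[OF assms]
    by (intro integral_mono) auto
  also have "\<dots> = (1 + 2 * \<tau>) ^ n" using prob_space by simp
  finally show ?thesis .
qed

section \<open>Recurrences for the Fourier coefficients\<close>

lemma char_torus_shift:
  assumes "finite K" "i \<in> K"
  shows "cis (\<theta> i) * char_torus K q \<theta> = char_torus K (q(i := q i - 1)) \<theta>"
proof -
  have "char_torus K (q(i := q i - 1)) \<theta> = (\<Prod>j\<in>K. (if j = i then cis (\<theta> j) else 1) * cis (- of_int (q j) * \<theta> j))"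
    unfolding char_torus_def by (intro prod.cong) (auto simp: cis_mult algebra_simps)
  also have "\<dots> = cis (\<theta> i) * char_torus K q \<theta>"
    using assms by (simp add: prod.distrib char_torus_def)
  finally show ?thesis by simp
qed

lemma char_torus_shift_all:
  "(\<Prod>i\<in>K. cis (\<theta> i)) * char_torus K q \<theta> = char_torus K (\<lambda>i. q i - 1) \<theta>"
  unfolding char_torus_def prod.distrib[symmetric] by (intro prod.cong) (auto simp: cis_mult algebra_simps)

lemma integral_char_torus:
  assumes "finite K"
  shows "integral\<^sup>L (torus K) (char_torus K q) = of_bool (\<forall>i\<in>K. q i = 0)"
proof -
  interpret product_sigma_finite "\<lambda>_. arc" by (rule product_sigma_finite_arc)
  have int: "integrable arc (\<lambda>x. cis (- of_int m * x))" for m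
  proof -
    interpret A: prob_space arc by (rule prob_space_arc)
    have "(\<lambda>x. cis (- of_int m * x)) \<in> borel_measurable borel"
      by (intro borel_measurable_continuous_onI continuous_intros)
    then show ?thesis by (intro A.integrable_const_bound[where B = 1]) auto
  qed
  have "integral\<^sup>L (torus K) (char_torus K q) = (\<Prod>i\<in>K. \<integral>x. cis (- of_int (q i) * x) \<partial>arc)"
    unfolding torus_def char_torus_def
    by (rule product_integral_prod[OF assms, of "\<lambda>i x. cis (- of_int (q i) * x)"]) (rule int)
  also have "\<dots> = (\<Prod>i\<in>K. of_bool (q i = 0))"
    using integral_arc_cis[of "- q _"] by simp
  also have "\<dots> = of_bool (\<forall>i\<in>K. q i = 0)"
    using assms by (induction K) auto
  finally show ?thesis .
qed

text \<open>A factor cis (\<theta> i) lowers \<open>q i\<close> by one, so multiplication by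
  \<open>kernel_den\<close> becomes a difference operator on the index. At exponent 0 it leaves the
  bare character; at \<open>Suc n\<close> it trades one denominator for a factor
  \<open>kernel_num\<close>, which involves the shift of all indices at once.\<close>

lemma fourier_coeff_recurrence_aux:
  assumes K: "finite K" and \<beta>: "\<forall>i\<in>K. 0 \<le> \<beta> i" and \<tau>: "0 \<le> \<tau>"
  shows "of_real (1 + sum \<beta> K) * fourier_coeff K \<beta> \<tau> n q
      - (\<Sum>i\<in>K. of_real (\<beta> i) * fourier_coeff K \<beta> \<tau> n (q(i := q i - 1)))
      = (\<integral>\<theta>. kernel_den K \<beta> \<theta> * fourier_integrand K \<beta> \<tau> n q \<theta> \<partial>torus K)"
proof -
  note int = integrable_fourier_integrand[OF \<beta> \<tau>]
  have "kernel_den K \<beta> \<theta> * fourier_integrand K \<beta> \<tau> n q \<theta>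
      = of_real (1 + sum \<beta> K) * fourier_integrand K \<beta> \<tau> n q \<theta>
        - (\<Sum>i\<in>K. of_real (\<beta> i) * fourier_integrand K \<beta> \<tau> n (q(i := q i - 1)) \<theta>)" for \<theta>
  proof -
    have sh: "fourier_integrand K \<beta> \<tau> n (q(i := q i - 1)) \<theta> = cis (\<theta> i) * fourier_integrand K \<beta> \<tau> n q \<theta>"
      if "i \<in> K" for i
      unfolding fourier_integrand_def char_torus_shift[OF K that, symmetric] by (simp add: mult_ac)
    have "(\<Sum>i\<in>K. of_real (\<beta> i) * fourier_integrand K \<beta> \<tau> n (q(i := q i - 1)) \<theta>)
        = (\<Sum>i\<in>K. of_real (\<beta> i) * cis (\<theta> i)) * fourier_integrand K \<beta> \<tau> n q \<theta>"
      unfolding sum_distrib_right by (intro sum.cong) (simp_all add: sh mult_ac)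
    moreover have "kernel_den K \<beta> \<theta> = of_real (1 + sum \<beta> K) - (\<Sum>i\<in>K. of_real (\<beta> i) * cis (\<theta> i))"
      by (simp add: kernel_den_def sum_subtractf right_diff_distrib)
    ultimately show ?thesis by (simp add: left_diff_distrib)
  qed
  then have "(\<integral>\<theta>. kernel_den K \<beta> \<theta> * fourier_integrand K \<beta> \<tau> n q \<theta> \<partial>torus K)
      = (\<integral>\<theta>. of_real (1 + sum \<beta> K) * fourier_integrand K \<beta> \<tau> n q \<theta>
        - (\<Sum>i\<in>K. of_real (\<beta> i) * fourier_integrand K \<beta> \<tau> n (q(i := q i - 1)) \<theta>) \<partial>torus K)"
    by simp
  also have "\<dots> = of_real (1 + sum \<beta> K) * fourier_coeff K \<beta> \<tau> n q
      - (\<Sum>i\<in>K. of_real (\<beta> i) * fourier_coeff K \<beta> \<tau> n (q(i := q i - 1)))"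
    unfolding fourier_coeff_def using int
    by (subst Bochner_Integration.integral_diff) (auto simp: Bochner_Integration.integral_sum)
  finally show ?thesis by simp
qed

lemma fourier_coeff_recurrence_0:
  assumes K: "finite K" and \<beta>: "\<forall>i\<in>K. 0 \<le> \<beta> i" and \<tau>: "0 \<le> \<tau>"
  shows "of_real (1 + sum \<beta> K) * fourier_coeff K \<beta> \<tau> 0 q
      = (\<Sum>i\<in>K. of_real (\<beta> i) * fourier_coeff K \<beta> \<tau> 0 (q(i := q i - 1))) + of_bool (\<forall>i\<in>K. q i = 0)"
proof -
  have "kernel_den K \<beta> \<theta> * fourier_integrand K \<beta> \<tau> 0 q \<theta> = char_torus K q \<theta>" for \<theta>
    using norm_kernel_den_ge_1[OF \<beta>, of \<theta>] by (auto simp: fourier_integrand_def)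
  then have "(\<integral>\<theta>. kernel_den K \<beta> \<theta> * fourier_integrand K \<beta> \<tau> 0 q \<theta> \<partial>torus K) = of_bool (\<forall>i\<in>K. q i = 0)"
    by (simp add: integral_char_torus[OF K])
  with fourier_coeff_recurrence_aux[OF assms, of 0 q] show ?thesis by (simp add: diff_eq_eq add.commute)
qed

lemma fourier_coeff_recurrence_Suc:
  assumes K: "finite K" and \<beta>: "\<forall>i\<in>K. 0 \<le> \<beta> i" and \<tau>: "0 \<le> \<tau>"
  shows "of_real (1 + sum \<beta> K) * fourier_coeff K \<beta> \<tau> (Suc n) q
      = (\<Sum>i\<in>K. of_real (\<beta> i) * fourier_coeff K \<beta> \<tau> (Suc n) (q(i := q i - 1)))
        + (of_real (1 + \<tau>) * fourier_coeff K \<beta> \<tau> n q - of_real \<tau> * fourier_coeff K \<beta> \<tau> n (\<lambda>i. q i - 1))"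
proof -
  note int = integrable_fourier_integrand[OF \<beta> \<tau>]
  have "kernel_den K \<beta> \<theta> * fourier_integrand K \<beta> \<tau> (Suc n) q \<theta>
      = of_real (1 + \<tau>) * fourier_integrand K \<beta> \<tau> n q \<theta> - of_real \<tau> * fourier_integrand K \<beta> \<tau> n (\<lambda>i. q i - 1) \<theta>" for \<theta>
  proof -
    have "kernel_den K \<beta> \<theta> \<noteq> 0" using norm_kernel_den_ge_1[OF \<beta>, of \<theta>] by auto
    then have "kernel_den K \<beta> \<theta> * fourier_integrand K \<beta> \<tau> (Suc n) q \<theta> = kernel_num K \<tau> \<theta> * fourier_integrand K \<beta> \<tau> n q \<theta>"
      by (simp add: fourier_integrand_def)
    also have "\<dots> = of_real (1 + \<tau>) * fourier_integrand K \<beta> \<tau> n q \<theta>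
        - of_real \<tau> * ((\<Prod>i\<in>K. cis (\<theta> i)) * fourier_integrand K \<beta> \<tau> n q \<theta>)"
      by (simp add: kernel_num_def algebra_simps)
    also have "(\<Prod>i\<in>K. cis (\<theta> i)) * fourier_integrand K \<beta> \<tau> n q \<theta> = fourier_integrand K \<beta> \<tau> n (\<lambda>i. q i - 1) \<theta>"
      unfolding fourier_integrand_def char_torus_shift_all[symmetric] by (simp add: mult_ac)
    finally show ?thesis .
  qed
  then have "(\<integral>\<theta>. kernel_den K \<beta> \<theta> * fourier_integrand K \<beta> \<tau> (Suc n) q \<theta> \<partial>torus K)
      = of_real (1 + \<tau>) * fourier_coeff K \<beta> \<tau> n q - of_real \<tau> * fourier_coeff K \<beta> \<tau> n (\<lambda>i. q i - 1)"
    unfolding fourier_coeff_def using int by simp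
  with fourier_coeff_recurrence_aux[OF assms, of "Suc n" q] show ?thesis by (simp add: diff_eq_eq add.commute)
qed

text \<open>A bounded solution of the homogeneous recurrence vanishes because the weights sum to less
  than the leading coefficient.\<close>

lemma bounded_homogeneous_recurrence_zero:
  fixes f :: "('i \<Rightarrow> int) \<Rightarrow> complex"
  assumes K: "finite K" and \<beta>: "\<forall>i\<in>K. 0 \<le> \<beta> i"
    and bd: "\<And>q. norm (f q) \<le> C"
    and rec: "\<And>q. q k < 0 \<Longrightarrow> of_real (1 + sum \<beta> K) * f q = (\<Sum>i\<in>K. of_real (\<beta> i) * f (q(i := q i - 1)))"
    and q: "q k < 0"
  shows "f q = 0"
proof -
  define s where "s = sum \<beta> K"
  have s: "0 \<le> s" unfolding s_def using \<beta> by (intro sum_nonneg) auto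
  define \<rho> where "\<rho> = s / (1 + s)"
  have \<rho>: "0 \<le> \<rho>" "\<rho> < 1" using s by (auto simp: \<rho>_def)
  have "norm (f q) \<le> C * \<rho> ^ j" if "q k < 0" for j q
    using that
  proof (induction j arbitrary: q)
    case 0
    then show ?case using bd by simp
  next
    case (Suc j)
    have "(1 + s) * norm (f q) = norm (of_real (1 + sum \<beta> K) * f q)"
      using s by (simp add: norm_mult s_def del: of_real_add)
    also have "\<dots> = norm (\<Sum>i\<in>K. of_real (\<beta> i) * f (q(i := q i - 1)))" by (simp only: rec[of q, OF Suc.prems])
    also have "\<dots> \<le> (\<Sum>i\<in>K. \<beta> i * (C * \<rho> ^ j))"
    proof (rule sum_norm_le)
      fix i assume "i \<in> K"
      have "norm (f (q(i := q i - 1))) \<le> C * \<rho> ^ j" using Suc.prems by (intro Suc.IH) auto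
      then show "norm (of_real (\<beta> i) * f (q(i := q i - 1))) \<le> \<beta> i * (C * \<rho> ^ j)"
        using \<beta> \<open>i \<in> K\<close> by (simp add: norm_mult mult_left_mono)
    qed
    also have "\<dots> = s * (C * \<rho> ^ j)" by (simp add: s_def sum_distrib_right)
    also have "\<dots> = (1 + s) * (C * \<rho> ^ Suc j)" using s by (simp add: \<rho>_def)
    finally show ?case using s by (simp del: power_Suc)
  qed
  then have "norm (f q) \<le> C * \<rho> ^ j" for j using q by blast
  moreover have "(\<lambda>j. C * \<rho> ^ j) \<longlonglongrightarrow> C * 0"
    using \<rho> by (intro tendsto_intros LIMSEQ_realpow_zero)
  ultimately have "norm (f q) \<le> C * 0" by (intro LIMSEQ_le_const) auto
  then show ?thesis by simp
qed

text \<open>For \<open>q i0 < 0\<close> the coefficients form a bounded solution of a homogeneous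
  recurrence: the inhomogeneous terms at exponent \<open>Suc n\<close> are coefficients at exponent
  \<open>n\<close> and vanish by induction. No expansion of the kernel is needed.\<close>

lemma fourier_coeff_negative:
  assumes K: "finite K" and \<beta>: "\<forall>i\<in>K. 0 \<le> \<beta> i" and \<tau>: "0 \<le> \<tau>"
    and i0: "i0 \<in> K" and q: "q i0 < 0"
  shows "fourier_coeff K \<beta> \<tau> n q = 0"
  using q
proof (induction n arbitrary: q)
  case 0
  show ?case
  proof (rule bounded_homogeneous_recurrence_zero[where k = i0 and K = K and \<beta> = \<beta>])
    fix q :: "'a \<Rightarrow> int" assume "q i0 < 0"
    then have "\<not> (\<forall>i\<in>K. q i = 0)" using i0 by force
    then show "of_real (1 + sum \<beta> K) * fourier_coeff K \<beta> \<tau> 0 q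
        = (\<Sum>i\<in>K. of_real (\<beta> i) * fourier_coeff K \<beta> \<tau> 0 (q(i := q i - 1)))"
      using fourier_coeff_recurrence_0[OF K \<beta> \<tau>, of q] by simp
  qed (use norm_fourier_coeff_le[OF \<beta> \<tau>] K \<beta> 0 in auto)
next
  case (Suc n)
  show ?case
  proof (rule bounded_homogeneous_recurrence_zero[where k = i0 and K = K and \<beta> = \<beta>])
    fix q :: "'a \<Rightarrow> int" assume "q i0 < 0"
    then have "fourier_coeff K \<beta> \<tau> n q = 0" "fourier_coeff K \<beta> \<tau> n (\<lambda>i. q i - 1) = 0"
      by (intro Suc.IH; simp)+
    then show "of_real (1 + sum \<beta> K) * fourier_coeff K \<beta> \<tau> (Suc n) q
        = (\<Sum>i\<in>K. of_real (\<beta> i) * fourier_coeff K \<beta> \<tau> (Suc n) (q(i := q i - 1)))"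
      using fourier_coeff_recurrence_Suc[OF K \<beta> \<tau>, of n q] by simp
  qed (use norm_fourier_coeff_le[OF \<beta> \<tau>] K \<beta> Suc.prems in blast)+
qed

text \<open>The rescaled Fourier coefficients satisfy the recurrence of \<open>a\<close>. For radii
  y_i = \<beta>_i / V, the hypothesis on \<open>V\<close> says 1 / (1 - s) = V and
  \<open>crit\<close> says c p = \<tau> / (1 + \<tau>). These only tie V and \<tau> to the radii;
  stationarity in the direction r enters later, in the estimate of the phase.\<close>

lemma coeff_eq_fourier_coeff:
  fixes a :: "nat ^ 'd::finite \<Rightarrow> real" and j0 :: 'd
  defines "K \<equiv> UNIV - {j0}"
  assumes ps: "has_power_series_at_0 (F c) a"
    and \<beta>: "\<And>i. i \<in> K \<Longrightarrow> 0 < \<beta> i" and \<tau>: "0 \<le> \<tau>"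
    and V: "V = 1 + sum \<beta> K" and crit: "c * (1 + \<tau>) * (\<Prod>i\<in>K. \<beta> i / V) = \<tau>"
  shows "of_real (a r) = of_real (V * (V / (1 + \<tau>)) ^ (r $ j0) * (\<Prod>i\<in>K. (V / \<beta> i) ^ (r $ i)))
      * fourier_coeff K \<beta> \<tau> (r $ j0) (\<lambda>i. int (r $ i))"
proof -
  have K: "finite K" "j0 \<notin> K" by (auto simp: K_def)
  have UK: "UNIV = insert j0 K" by (auto simp: K_def)
  have \<beta>0: "\<forall>i\<in>K. 0 \<le> \<beta> i" using \<beta> by (simp add: less_imp_le)
  have Vpos: "V > 0" unfolding V using \<beta>0 by (intro add_pos_nonneg sum_nonneg) auto
  define fc where "fc = fourier_coeff K \<beta> \<tau>"
  \<comment> \<open>Integer exponents, since a shifted index can be -1.\<close>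
  define w where "w q = (\<Prod>i\<in>K. (V / \<beta> i) powi (q i))" for q :: "'d \<Rightarrow> int"
  \<comment> \<open>The reciprocal of (1 - s) / (1 - c p), which is the value of the variable
    \<open>j0\<close> at which 1 - e1 + c ed vanishes.\<close>
  define y where "y = V / (1 + \<tau>)"
  define B where "B q = (if q j0 < 0 then 0 else of_real (V * y ^ nat (q j0) * w q) * fc (nat (q j0)) q)"
    for q :: "'d \<Rightarrow> int"
  have w_shift: "w (q(i := q i - 1)) = w q * (\<beta> i / V)" if "i \<in> K" for q i
  proof -
    have "w (q(i := q i - 1)) = (\<Prod>j\<in>K. (V / \<beta> j) powi (q j) * (if j = i then \<beta> j / V else 1))"
      unfolding w_def
    proof (intro prod.cong refl)
      fix j assume "j \<in> K"
      have "(V / \<beta> j) powi (q j - 1) = (V / \<beta> j) powi (q j) * (\<beta> j / V)"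
        using \<beta>[OF \<open>j \<in> K\<close>] Vpos by (simp add: power_int_diff)
      then show "(V / \<beta> j) powi ((q(i := q i - 1)) j) = (V / \<beta> j) powi (q j) * (if j = i then \<beta> j / V else 1)"
        by auto
    qed
    then show ?thesis using K that by (simp add: prod.distrib w_def)
  qed
  have w_shift_all: "c * y * w (\<lambda>i. q i - 1) = V * w q * \<tau> / (1 + \<tau>)\<^sup>2" for q
  proof -
    have "w (\<lambda>i. q i - 1) = (\<Prod>j\<in>K. (V / \<beta> j) powi (q j) * (\<beta> j / V))"
      unfolding w_def
    proof (intro prod.cong refl)
      fix j assume "j \<in> K"
      show "(V / \<beta> j) powi (q j - 1) = (V / \<beta> j) powi (q j) * (\<beta> j / V)"
        using \<beta>[OF \<open>j \<in> K\<close>] Vpos by (simp add: power_int_diff)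
    qed
    also have "\<dots> = w q * (\<Prod>j\<in>K. \<beta> j / V)" by (simp only: prod.distrib w_def)
    finally have "c * y * w (\<lambda>i. q i - 1) = V / (1 + \<tau>)\<^sup>2 * w q * (c * (1 + \<tau>) * (\<Prod>j\<in>K. \<beta> j / V))"
      using \<tau> by (simp add: y_def power2_eq_square)
    then show ?thesis unfolding crit by simp
  qed
  have w_j0: "w (q(j0 := t)) = w q" for q t
    unfolding w_def using K by (intro prod.cong) auto
  have fc_j0: "fc n (q(j0 := t)) = fc n q" for n q t
  proof -
    have "char_torus K (q(j0 := t)) = char_torus K q"
      unfolding char_torus_def using K by (intro ext prod.cong) auto
    then show ?thesis by (simp add: fc_def fourier_coeff_def fourier_integrand_def[abs_def])
  qed
  have "of_real (coeff_ext a q) = B q" for q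
  proof (rule recurrence_unique[where c = "complex_of_real c"])
    fix q :: "'d \<Rightarrow> int"
    show "complex_of_real (coeff_ext a q) = of_bool (q = (\<lambda>_. 0))
        + (\<Sum>i\<in>UNIV. of_real (coeff_ext a (q(i := q i - 1)))) - of_real c * of_real (coeff_ext a (\<lambda>i. q i - 1))"
      by (subst coeff_recurrence[OF ps]) simp
  next
    fix q :: "'d \<Rightarrow> int" and i assume qi: "q i < 0"
    then show "complex_of_real (coeff_ext a q) = 0" by (simp add: coeff_ext_neg)
    show "B q = 0"
    proof (cases "i = j0")
      case False
      then have "fc n q = 0" for n
        unfolding fc_def using fourier_coeff_negative[OF K(1) \<beta>0 \<tau>, of i] qi by (simp add: K_def)
      then show ?thesis by (simp add: B_def)
    qed (use qi in \<open>simp add: B_def\<close>)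
  next
    fix q :: "'d \<Rightarrow> int" assume q0: "\<forall>i. 0 \<le> q i"
    have sumU: "(\<Sum>i\<in>UNIV. B (q(i := q i - 1))) = B (q(j0 := q j0 - 1)) + (\<Sum>i\<in>K. B (q(i := q i - 1)))"
      using K by (subst UK) simp
    have BK: "B (q(i := q i - 1)) = of_real (y ^ nat (q j0) * w q) * (of_real (\<beta> i) * fc (nat (q j0)) (q(i := q i - 1)))"
      if "i \<in> K" for i
    proof -
      have "i \<noteq> j0" using that K by auto
      then show ?thesis using q0[rule_format, of j0] Vpos that by (simp add: B_def w_shift mult_ac)
    qed
    have sumK: "(\<Sum>i\<in>K. B (q(i := q i - 1)))
        = of_real (y ^ nat (q j0) * w q) * (\<Sum>i\<in>K. of_real (\<beta> i) * fc (nat (q j0)) (q(i := q i - 1)))"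
      unfolding sum_distrib_left by (intro sum.cong BK) auto
    have Bq: "B q = of_real (y ^ nat (q j0) * w q) * (of_real V * fc (nat (q j0)) q)"
      using q0[rule_format, of j0] by (simp add: B_def mult_ac)
    show "B q = of_bool (q = (\<lambda>_. 0)) + (\<Sum>i\<in>UNIV. B (q(i := q i - 1))) - of_real c * B (\<lambda>i. q i - 1)"
    proof (cases "nat (q j0)")
      case 0
      then have j0: "q j0 = 0" using q0 by (simp add: order_antisym)
      have "of_real V * fc 0 q = (\<Sum>i\<in>K. of_real (\<beta> i) * fc 0 (q(i := q i - 1))) + of_bool (\<forall>i\<in>K. q i = 0)"
        unfolding fc_def V by (rule fourier_coeff_recurrence_0[OF K(1) \<beta>0 \<tau>])
      moreover have "of_real (w q) * of_bool (\<forall>i\<in>K. q i = 0) = (of_bool (q = (\<lambda>_. 0)) :: complex)"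
      proof -
        have "(\<forall>i\<in>K. q i = 0) = (q = (\<lambda>_. 0))" using j0 by (auto simp: K_def fun_eq_iff)
        moreover have "w (\<lambda>_. 0) = 1" by (simp add: w_def)
        ultimately show ?thesis by auto
      qed
      ultimately show ?thesis unfolding sumU sumK Bq using j0
        by (simp add: B_def distrib_left)
    next
      case (Suc m)
      then have j0: "q j0 = int m + 1" by linarith
      have 1: "of_real V * fc (Suc m) q = (\<Sum>i\<in>K. of_real (\<beta> i) * fc (Suc m) (q(i := q i - 1)))
          + (of_real (1 + \<tau>) * fc m q - of_real \<tau> * fc m (\<lambda>i. q i - 1))"
        unfolding fc_def V by (rule fourier_coeff_recurrence_Suc[OF K(1) \<beta>0 \<tau>])
      \<comment> \<open>The shift in \<open>j0\<close> and the diagonal shift both lower the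
        exponent from \<open>Suc m\<close> to \<open>m\<close>; they account for the two terms
        produced by \<open>kernel_num\<close>.\<close>
      have 2: "B (q(j0 := q j0 - 1)) = of_real (y ^ Suc m * w q) * (of_real (1 + \<tau>) * fc m q)"
      proof -
        have "B (q(j0 := q j0 - 1)) = of_real (V * y ^ m * w q) * fc m q"
          by (simp add: B_def w_j0 fc_j0 j0)
        also have "V = y * (1 + \<tau>)" using \<tau> by (simp add: y_def)
        also have "of_real (y * (1 + \<tau>) * y ^ m * w q) * fc m q
            = of_real (y ^ Suc m * w q) * (of_real (1 + \<tau>) * fc m q)" by (simp add: mult_ac)
        finally show ?thesis .
      qed
      have 3: "of_real c * B (\<lambda>i. q i - 1) = of_real (y ^ Suc m * w q) * (of_real \<tau> * fc m (\<lambda>i. q i - 1))"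
      proof -
        have "of_real c * B (\<lambda>i. q i - 1) = of_real (c * (V * y ^ m * w (\<lambda>i. q i - 1))) * fc m (\<lambda>i. q i - 1)"
          by (simp add: B_def j0)
        also have "c * (V * y ^ m * w (\<lambda>i. q i - 1)) = (1 + \<tau>) * y ^ m * (c * y * w (\<lambda>i. q i - 1))"
          using \<tau> by (simp add: y_def)
        also have "\<dots> = y ^ Suc m * w q * \<tau>"
        proof -
          have "(1 + \<tau>) * (V * w q * \<tau> / (1 + \<tau>)\<^sup>2) = y * w q * \<tau>"
            using \<tau> by (simp add: y_def power2_eq_square)
          then have "y ^ m * ((1 + \<tau>) * (V * w q * \<tau> / (1 + \<tau>)\<^sup>2)) = y ^ m * (y * w q * \<tau>)" by simp
          then show ?thesis unfolding w_shift_all by (simp only: power_Suc mult_ac)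
        qed
        also have "of_real (y ^ Suc m * w q * \<tau>) * fc m (\<lambda>i. q i - 1)
            = of_real (y ^ Suc m * w q) * (of_real \<tau> * fc m (\<lambda>i. q i - 1))" by (simp add: mult_ac)
        finally show ?thesis .
      qed
      have "q \<noteq> (\<lambda>_. 0)" using j0 by auto
      then show ?thesis unfolding sumU sumK Bq 2 3 Suc 1 by (simp add: algebra_simps)
    qed
  qed
  from this[of "\<lambda>i. int (r $ i)"] show ?thesis
    by (simp add: coeff_ext_def B_def w_def fc_def y_def)
qed

subsection \<open>Estimates of the integrand\<close>

lemma norm_one_minus_cis: "(norm (1 - cis t))\<^sup>2 = 2 * (1 - cos t)"
proof -
  have "(norm (1 - cis t))\<^sup>2 = (1 - cos t)\<^sup>2 + (sin t)\<^sup>2" by (simp add: cmod_power2)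
  also have "\<dots> = 2 * (1 - cos t)"
    using sin_cos_squared_add[of t] by (simp add: power2_diff)
  finally show ?thesis .
qed

lemma abs_sin_minus_self_le: "\<bar>sin x - x\<bar> \<le> \<bar>x\<bar> ^ 3 / 6" for x :: real
proof -
  have 1: "(\<Sum>m<3. sin_coeff m * x ^ m) = x" by (simp add: sin_coeff_def numeral_eq_Suc)
  have 2: "fact 3 = (6 :: real)" by (simp add: fact_numeral)
  show ?thesis using Maclaurin_sin_bound[of x 3] unfolding 1 2 by (simp add: field_simps)
qed

lemma one_minus_cos_eq: "1 - cos x = 2 * (sin (x / 2))\<^sup>2" for x :: real
  using cos_double_sin[of "x / 2"] by simp

lemma one_minus_cos_le: "1 - cos x \<le> x\<^sup>2 / 2" for x :: real
proof -
  have "(sin (x / 2))\<^sup>2 \<le> (x / 2)\<^sup>2" using abs_sin_x_le_abs_x[of "x / 2"] by (rule abs_le_square_iff[THEN iffD1])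
  then show ?thesis unfolding one_minus_cos_eq by (simp add: power_divide)
qed

text \<open>For y = x / 2 the range gives |y| <= 2, so the cubic error of the sine is at most 2 |y|
  / 3 and |sin y| >= |y| / 3. Then 1 - cos x = 2 (sin y)^2 >= 2 (x / 6)^2.\<close>

lemma one_minus_cos_ge:
  fixes x :: real
  assumes "\<bar>x\<bar> \<le> pi"
  shows "x\<^sup>2 / 18 \<le> 1 - cos x"
proof -
  define y where "y = x / 2"
  have "\<bar>y\<bar> \<le> 2" using assms pi_less_4 by (simp add: y_def)
  then have "\<bar>y\<bar>\<^sup>2 \<le> 2\<^sup>2" by (intro power_mono) auto
  then have "\<bar>y\<bar> * \<bar>y\<bar>\<^sup>2 \<le> \<bar>y\<bar> * 4" by (intro mult_left_mono) auto
  then have "\<bar>y\<bar> ^ 3 / 6 \<le> 2 * \<bar>y\<bar> / 3" by (simp add: power3_eq_cube power2_eq_square)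
  then have "\<bar>y\<bar> / 3 \<le> \<bar>sin y\<bar>"
    using abs_sin_minus_self_le[of y] abs_triangle_ineq2[of y "sin y"] abs_minus_commute[of y "sin y"] by linarith
  then have "\<bar>y / 3\<bar> \<le> \<bar>sin y\<bar>" by simp
  then have "(y / 3)\<^sup>2 \<le> (sin y)\<^sup>2" by (rule abs_le_square_iff[THEN iffD1])
  then show ?thesis unfolding one_minus_cos_eq by (simp add: y_def power_divide)
qed

lemma abs_arctan_minus_self_le: "\<bar>arctan x - x\<bar> \<le> \<bar>x\<bar> ^ 3" for x :: real
proof -
  have pos: "\<bar>arctan x - x\<bar> \<le> \<bar>x\<bar> ^ 3" if "0 < x" for x :: real
  proof -
    have "\<exists>z>0. z < x \<and> (arctan x - x) - (arctan 0 - 0) = (x - 0) * (inverse (1 + z\<^sup>2) - 1)"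
      using that by (intro MVT2) (auto intro!: derivative_eq_intros)
    then obtain z where z: "0 < z" "z < x" "arctan x - x = x * (inverse (1 + z\<^sup>2) - 1)" by auto
    have p: "0 < 1 + z\<^sup>2" by (simp add: add_pos_nonneg)
    have "inverse (1 + z\<^sup>2) - 1 = - (z\<^sup>2 / (1 + z\<^sup>2))" using p by (simp add: field_simps)
    then have "\<bar>arctan x - x\<bar> = x * (z\<^sup>2 / (1 + z\<^sup>2))"
      using z p by (simp add: abs_mult)
    also have "\<dots> \<le> x * (x\<^sup>2 / 1)"
      using z p by (intro mult_left_mono frac_le power_mono) auto
    finally show ?thesis using that by (simp add: power3_eq_cube power2_eq_square)
  qed
  show ?thesis
    using pos[of x] pos[of "- x"] by (cases x "0::real" rule: linorder_cases) (auto simp: arctan_minus abs_minus_commute)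
qed

lemma abs_arctan_le: "\<bar>arctan x\<bar> \<le> \<bar>x\<bar>" for x :: real
proof -
  have pos: "\<bar>arctan x\<bar> \<le> \<bar>x\<bar>" if "0 < x" for x :: real
  proof -
    have "\<exists>z>0. z < x \<and> arctan x - arctan 0 = (x - 0) * inverse (1 + z\<^sup>2)"
      using that by (intro MVT2) (auto intro!: derivative_eq_intros)
    then obtain z where z: "arctan x = x * inverse (1 + z\<^sup>2)" by auto
    have "inverse (1 + z\<^sup>2) \<le> 1" by (intro inverse_le_1_iff[THEN iffD2]) simp
    then have "x * inverse (1 + z\<^sup>2) \<le> x * 1" using that by (intro mult_left_mono) auto
    then show ?thesis using that z by simp
  qed
  show ?thesis
    using pos[of x] pos[of "- x"] by (cases x "0::real" rule: linorder_cases) (auto simp: arctan_minus)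
qed

lemma complex_eq_norm_cis_arctan:
  assumes "0 < Re z"
  shows "z = of_real (norm z) * cis (arctan (Im z / Re z))"
proof -
  define x where "x = Im z / Re z"
  have "norm z = Re z * sqrt (1 + x\<^sup>2)"
  proof -
    have "(Re z)\<^sup>2 + (Im z)\<^sup>2 = (Re z)\<^sup>2 * (1 + x\<^sup>2)"
      using assms by (simp add: x_def power_divide field_simps)
    then show ?thesis using assms by (simp add: cmod_def real_sqrt_mult)
  qed
  moreover have "sqrt (1 + x\<^sup>2) > 0" by (simp add: add_pos_nonneg)
  ultimately show ?thesis
    using assms unfolding x_def[symmetric]
    by (simp add: complex_eq_iff cos_arctan sin_arctan) (simp add: x_def)
qed

text \<open>The principal argument in the right half-plane, where both kernels take their values;
  the arctangent form reduces its estimates to real ones.\<close>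

definition kernel_arg :: "complex \<Rightarrow> real" where
  "kernel_arg z = arctan (Im z / Re z)"

section \<open>Modulus of the integrand\<close>

lemma norm_fourier_integrand_eq:
  "norm (fourier_integrand K \<beta> \<tau> n q \<theta>) = norm (kernel_num K \<tau> \<theta>) ^ n / norm (kernel_den K \<beta> \<theta>) ^ Suc n"
  by (simp add: fourier_integrand_def norm_mult norm_divide norm_power)

text \<open>Write b = 1 + \<tau> and X for the sum of the 1 - cos (\<theta> i). If all \<beta> i
  equal b, the squared moduli are 1 + 2 b X + b^2 |D|^2 and 1 + \<tau> b |1 - P|^2, and |1 - P| <=
  |D| leaves a gap of at least 2 b X. Deviations of size e cost at most 2 e X + 4 b e k X, with k
  the cardinality of \<open>K\<close>; the bound on e keeps this below b X, and b >= 1.\<close>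

lemma kernel_norm_gap:
  fixes K :: "'d::finite set"
  assumes \<tau>: "0 \<le> \<tau>"
    and e: "\<forall>i\<in>K. \<bar>\<beta> i - (1 + \<tau>)\<bar> \<le> e" "(4 * real (card K) + 2) * e \<le> 1"
  shows "(norm (kernel_num K \<tau> \<theta>))\<^sup>2 + (\<Sum>i\<in>K. 1 - cos (\<theta> i)) \<le> (norm (kernel_den K \<beta> \<theta>))\<^sup>2"
proof (cases "K = {}")
  case True
  then show ?thesis by (simp add: kernel_num_def kernel_den_def)
next
  case False
  then have e0: "0 \<le> e" using e(1) abs_ge_zero order_trans by blast
  define X where "X = (\<Sum>i\<in>K. 1 - cos (\<theta> i))"
  define b where "b = 1 + \<tau>"
  define D where "D = (\<Sum>i\<in>K. 1 - cis (\<theta> i))"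
  define E where "E = (\<Sum>i\<in>K. of_real (\<beta> i - b) * (1 - cis (\<theta> i)))"
  define P where "P = (\<Prod>i\<in>K. cis (\<theta> i))"
  define L where "L = (\<Sum>i\<in>K. norm (1 - cis (\<theta> i)))"
  define k where "k = real (card K)"
  have b: "1 \<le> b" using \<tau> by (simp add: b_def)
  have X0: "0 \<le> X" unfolding X_def by (intro sum_nonneg) simp
  have L0: "0 \<le> L" unfolding L_def by (intro sum_nonneg) simp
  \<comment> \<open>Cauchy-Schwarz makes the error terms, controlled by L^2, comparable to the gap,
    which is measured by X.\<close>
  have L2: "L\<^sup>2 \<le> 2 * k * X"
  proof -
    have "L\<^sup>2 \<le> (\<Sum>i\<in>K. (norm (1 - cis (\<theta> i)))\<^sup>2) * card K"
      unfolding L_def by (rule sum_squared_le_sum_of_squares)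
    also have "(\<Sum>i\<in>K. (norm (1 - cis (\<theta> i)))\<^sup>2) = 2 * X"
      unfolding norm_one_minus_cis by (simp add: X_def sum_distrib_left)
    finally show ?thesis by (simp add: k_def mult_ac)
  qed
  have DL: "norm D \<le> L" unfolding D_def L_def by (rule norm_sum)
  have EL: "norm E \<le> e * L"
    unfolding E_def L_def sum_distrib_left using e(1)
    by (intro sum_norm_le) (auto simp: norm_mult b_def mult_right_mono simp del: of_real_diff of_real_add)
  have P1: "norm P = 1" by (simp add: P_def flip: prod_norm)
  have P2: "(norm (1 - P))\<^sup>2 = 2 * Re (1 - P)"
  proof -
    have "(Re P)\<^sup>2 + (Im P)\<^sup>2 = 1" using P1 by (simp flip: cmod_power2)
    moreover have "(norm (1 - P))\<^sup>2 = (1 - Re P)\<^sup>2 + (Im P)\<^sup>2" by (simp add: cmod_power2)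
    ultimately show ?thesis by (simp add: power2_diff)
  qed
  have PD: "(norm (1 - P))\<^sup>2 \<le> (norm D)\<^sup>2"
    unfolding P_def D_def by (intro power_mono norm_one_minus_prod_le) auto
  have expand: "(norm (1 + w))\<^sup>2 = 1 + 2 * Re w + (norm w)\<^sup>2" for w
    by (simp add: cmod_power2 power2_sum)
  have num: "(norm (kernel_num K \<tau> \<theta>))\<^sup>2 = 1 + \<tau> * b * (norm (1 - P))\<^sup>2"
  proof -
    have "(norm (of_real \<tau> * (1 - P)))\<^sup>2 = \<tau>\<^sup>2 * (norm (1 - P))\<^sup>2"
      by (simp only: norm_mult norm_of_real power_mult_distrib power2_abs)
    moreover have "2 * Re (of_real \<tau> * (1 - P)) = \<tau> * (norm (1 - P))\<^sup>2" unfolding P2 by simp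
    ultimately show ?thesis
      unfolding kernel_num_def P_def[symmetric] expand b_def power2_eq_square[of \<tau>]
      by (simp only: distrib_left distrib_right mult_1_right mult_1_left add.assoc mult.assoc)
  qed
  define Q where "Q = (\<Sum>i\<in>K. of_real (\<beta> i) * (1 - cis (\<theta> i)))"
  have Q: "Q = of_real b * D + E"
    by (simp add: Q_def D_def E_def sum_distrib_left sum.distrib[symmetric] algebra_simps)
  have ReQ: "(b - e) * X \<le> Re Q"
  proof -
    have "(b - e) * (1 - cos (\<theta> i)) \<le> \<beta> i * (1 - cos (\<theta> i))" if "i \<in> K" for i
      using e(1) that by (intro mult_right_mono) (force simp: b_def)+
    then show ?thesis unfolding X_def Q_def sum_distrib_left by (simp add: sum_mono)
  qed
  have nQ: "b\<^sup>2 * (norm D)\<^sup>2 - 4 * b * e * k * X \<le> (norm Q)\<^sup>2"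
  proof -
    have "(norm Q)\<^sup>2 = b\<^sup>2 * (norm D)\<^sup>2 + 2 * b * Re (D * cnj E) + (norm E)\<^sup>2"
      unfolding Q cmod_power2 by (simp add: power2_eq_square algebra_simps)
    moreover have "\<bar>Re (D * cnj E)\<bar> \<le> L * (e * L)"
    proof -
      have "\<bar>Re (D * cnj E)\<bar> \<le> norm D * norm E"
        using abs_Re_le_cmod[of "D * cnj E"] by (simp add: norm_mult)
      also have "\<dots> \<le> L * (e * L)" using DL EL L0 by (intro mult_mono) auto
      finally show ?thesis .
    qed
    then have "2 * b * - (L * (e * L)) \<le> 2 * b * Re (D * cnj E)"
      using b by (intro mult_left_mono) auto
    then have "- (2 * b * (L * (e * L))) \<le> 2 * b * Re (D * cnj E)" by simp
    moreover have "2 * b * (L * (e * L)) \<le> 4 * b * e * k * X"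
    proof -
      have "2 * b * (L * (e * L)) = 2 * b * e * L\<^sup>2" by (simp add: power2_eq_square)
      also have "\<dots> \<le> 2 * b * e * (2 * k * X)" using b e0 by (intro mult_left_mono[OF L2]) simp
      also have "\<dots> = 4 * b * e * k * X" by simp
      finally show ?thesis .
    qed
    ultimately show ?thesis using zero_le_power2[of "norm E"] by linarith
  qed
  have "X \<le> 2 * (b - e) * X - 4 * b * e * k * X"
  proof -
    have "b * ((4 * k + 2) * e) \<le> b * 1" using e(2) b unfolding k_def by (intro mult_left_mono) auto
    moreover have "2 * e \<le> b * (2 * e)" using mult_right_mono[OF b, of "2 * e"] e0 by simp
    moreover have "b * ((4 * k + 2) * e) = 4 * b * e * k + b * (2 * e)" by (simp add: algebra_simps)
    ultimately have "1 \<le> 2 * (b - e) - 4 * b * e * k" using b by (simp add: algebra_simps)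
    from mult_right_mono[OF this X0] show ?thesis by (simp add: algebra_simps)
  qed
  moreover have "\<tau> * b * (norm (1 - P))\<^sup>2 \<le> b\<^sup>2 * (norm D)\<^sup>2"
    using PD \<tau> b by (intro mult_mono) (auto simp: b_def power2_eq_square mult_right_mono)
  moreover have "(norm (kernel_den K \<beta> \<theta>))\<^sup>2 = 1 + 2 * Re Q + (norm Q)\<^sup>2"
    unfolding kernel_den_def Q_def[symmetric] by (rule expand)
  moreover have "2 * (b - e) * X = 2 * ((b - e) * X)" by (rule mult.assoc)
  ultimately show ?thesis unfolding num X_def[symmetric] using nQ ReQ by linarith
qed

text \<open>The denominator is at most 1 + 2 B in modulus, so the gap and the bound of 1 - cos from
  below by x^2 / 18 give a squared ratio of at most exp (- S / (18 (1 + 2 B)^2)), with S the sum of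
  squared angles. The square root turns 18 into 36.\<close>

lemma norm_fourier_integrand_le_gaussian:
  fixes K :: "'d::finite set"
  assumes \<beta>: "\<forall>i\<in>K. 0 \<le> \<beta> i" and \<tau>: "0 \<le> \<tau>"
    and e: "\<forall>i\<in>K. \<bar>\<beta> i - (1 + \<tau>)\<bar> \<le> e" "(4 * real (card K) + 2) * e \<le> 1"
    and B: "sum \<beta> K \<le> B" and \<theta>: "\<forall>i\<in>K. \<bar>\<theta> i\<bar> \<le> pi"
  shows "norm (fourier_integrand K \<beta> \<tau> n q \<theta>) \<le> exp (- (real n * (1 / (36 * (1 + 2 * B)\<^sup>2)) * (\<Sum>i\<in>K. (\<theta> i)\<^sup>2)))"
proof -
  define u where "u = norm (kernel_den K \<beta> \<theta>)"
  define v where "v = norm (kernel_num K \<tau> \<theta>)"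
  define S where "S = (\<Sum>i\<in>K. (\<theta> i)\<^sup>2)"
  define C where "C = 1 + 2 * B"
  have u1: "1 \<le> u" unfolding u_def by (rule norm_kernel_den_ge_1[OF \<beta>])
  have "u \<le> 1 + (\<Sum>i\<in>K. \<beta> i * 2)"
  proof -
    have "norm (\<Sum>i\<in>K. of_real (\<beta> i) * (1 - cis (\<theta> i))) \<le> (\<Sum>i\<in>K. \<beta> i * 2)"
    proof (rule sum_norm_le)
      fix i assume "i \<in> K"
      have "norm (1 - cis (\<theta> i)) \<le> 2" using norm_triangle_ineq4[of 1 "cis (\<theta> i)"] by simp
      then show "norm (of_real (\<beta> i) * (1 - cis (\<theta> i))) \<le> \<beta> i * 2"
        using \<beta> \<open>i \<in> K\<close> by (simp add: norm_mult mult_left_mono)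
    qed
    then show ?thesis unfolding u_def kernel_den_def by (intro order_trans[OF norm_triangle_ineq]) simp
  qed
  also have "\<dots> = 1 + 2 * sum \<beta> K" by (simp add: sum_distrib_right[symmetric])
  finally have uC: "u \<le> C" using B by (simp add: C_def)
  have u2: "0 < u\<^sup>2" "u\<^sup>2 \<le> C\<^sup>2" "0 < C\<^sup>2" using u1 uC by (auto intro: power_mono)
  have "S / 18 \<le> (\<Sum>i\<in>K. 1 - cos (\<theta> i))"
    unfolding S_def sum_divide_distrib using \<theta> by (intro sum_mono one_minus_cos_ge) auto
  then have gap: "v\<^sup>2 \<le> u\<^sup>2 - S / 18"
    using kernel_norm_gap[OF \<tau> e, of \<theta>] by (simp add: u_def v_def)
  have S0: "0 \<le> S" unfolding S_def by (intro sum_nonneg) simp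
  have "(v / u)\<^sup>2 \<le> 1 - S / 18 / u\<^sup>2"
    using gap u2 by (simp add: power_divide field_simps)
  also have "\<dots> \<le> 1 - S / 18 / C\<^sup>2"
    using S0 u2 by (intro diff_left_mono divide_left_mono mult_pos_pos) auto
  also have "\<dots> \<le> exp (- (S / 18 / C\<^sup>2))"
    using exp_ge_add_one_self[of "- (S / 18 / C\<^sup>2)"] by simp
  also have "\<dots> = (exp (- (S / (36 * C\<^sup>2))))\<^sup>2"
    by (simp add: exp_double[symmetric] field_simps)
  finally have "v / u \<le> exp (- (S / (36 * C\<^sup>2)))" by (rule power2_le_imp_le) simp
  then have "(v / u) ^ n \<le> exp (- (S / (36 * C\<^sup>2))) ^ n"
    using u1 by (intro power_mono) (auto simp: v_def)
  also have "\<dots> = exp (- (real n * (1 / (36 * C\<^sup>2)) * S))"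
    by (simp add: exp_of_nat_mult[symmetric])
  finally have 1: "(v / u) ^ n \<le> exp (- (real n * (1 / (36 * C\<^sup>2)) * S))" .
  have "norm (fourier_integrand K \<beta> \<tau> n q \<theta>) = (v / u) ^ n / u"
    unfolding norm_fourier_integrand_eq by (simp add: u_def v_def power_divide)
  also have "\<dots> \<le> (v / u) ^ n / 1"
    using u1 by (intro divide_left_mono zero_le_power) (auto simp: v_def)
  finally show ?thesis using 1 by (simp only: div_by_1 C_def S_def)
qed

section \<open>Phase of the integrand near the centre\<close>

lemma kernel_den_Re_Im:
  "Re (kernel_den K \<beta> \<theta>) = 1 + (\<Sum>i\<in>K. \<beta> i * (1 - cos (\<theta> i)))"
  "Im (kernel_den K \<beta> \<theta>) = - (\<Sum>i\<in>K. \<beta> i * sin (\<theta> i))"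
  by (simp_all add: kernel_den_def sum_negf)

lemma kernel_den_bounds:
  fixes \<beta> \<theta> :: "'i \<Rightarrow> real"
  assumes \<beta>: "\<forall>i\<in>K. 0 \<le> \<beta> i" and B: "sum \<beta> K \<le> B" and \<theta>: "\<forall>i\<in>K. \<bar>\<theta> i\<bar> \<le> t" and t: "0 \<le> t"
  shows "0 \<le> (\<Sum>i\<in>K. \<beta> i * (1 - cos (\<theta> i)))" "(\<Sum>i\<in>K. \<beta> i * (1 - cos (\<theta> i))) \<le> B * (t\<^sup>2 / 2)"
    "\<bar>\<Sum>i\<in>K. \<beta> i * sin (\<theta> i)\<bar> \<le> B * t" "\<bar>(\<Sum>i\<in>K. \<beta> i * sin (\<theta> i)) - (\<Sum>i\<in>K. \<beta> i * \<theta> i)\<bar> \<le> B * (t ^ 3 / 6)"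
proof -
  show "0 \<le> (\<Sum>i\<in>K. \<beta> i * (1 - cos (\<theta> i)))" using \<beta> by (intro sum_nonneg mult_nonneg_nonneg) auto
  have gen: "(\<Sum>i\<in>K. \<beta> i * f i) \<le> B * s" if "\<forall>i\<in>K. f i \<le> s" "0 \<le> s" for f s
  proof -
    have "(\<Sum>i\<in>K. \<beta> i * f i) \<le> (\<Sum>i\<in>K. \<beta> i * s)" using that \<beta> by (intro sum_mono mult_left_mono) auto
    also have "\<dots> = sum \<beta> K * s" by (simp add: sum_distrib_right)
    also have "\<dots> \<le> B * s" using B that by (intro mult_right_mono) auto
    finally show ?thesis .
  qed
  have gen_abs: "\<bar>\<Sum>i\<in>K. \<beta> i * f i\<bar> \<le> B * s" if "\<forall>i\<in>K. \<bar>f i\<bar> \<le> s" "0 \<le> s" for f s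
  proof -
    have "\<bar>\<Sum>i\<in>K. \<beta> i * f i\<bar> \<le> (\<Sum>i\<in>K. \<beta> i * \<bar>f i\<bar>)"
      using \<beta> by (intro order_trans[OF sum_abs] sum_mono) (simp add: abs_mult)
    also have "\<dots> \<le> B * s" using that by (intro gen) auto
    finally show ?thesis .
  qed
  have "1 - cos (\<theta> i) \<le> t\<^sup>2 / 2" if "i \<in> K" for i
  proof -
    have "(\<theta> i)\<^sup>2 \<le> t\<^sup>2" using \<theta> that power_mono[of "\<bar>\<theta> i\<bar>" t 2] by simp
    then show ?thesis using one_minus_cos_le[of "\<theta> i"] by linarith
  qed
  then show "(\<Sum>i\<in>K. \<beta> i * (1 - cos (\<theta> i))) \<le> B * (t\<^sup>2 / 2)" by (intro gen) auto
  have "\<bar>sin (\<theta> i)\<bar> \<le> t" if "i \<in> K" for i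
    using \<theta> that abs_sin_x_le_abs_x[of "\<theta> i"] by force
  then show "\<bar>\<Sum>i\<in>K. \<beta> i * sin (\<theta> i)\<bar> \<le> B * t" using t by (intro gen_abs) auto
  have "\<bar>sin (\<theta> i) - \<theta> i\<bar> \<le> t ^ 3 / 6" if "i \<in> K" for i
  proof -
    have "\<bar>\<theta> i\<bar> ^ 3 \<le> t ^ 3" using \<theta> that by (intro power_mono) auto
    then show ?thesis using abs_sin_minus_self_le[of "\<theta> i"] by linarith
  qed
  then have "\<bar>\<Sum>i\<in>K. \<beta> i * (sin (\<theta> i) - \<theta> i)\<bar> \<le> B * (t ^ 3 / 6)" using t by (intro gen_abs) auto
  then show "\<bar>(\<Sum>i\<in>K. \<beta> i * sin (\<theta> i)) - (\<Sum>i\<in>K. \<beta> i * \<theta> i)\<bar> \<le> B * (t ^ 3 / 6)"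
    by (simp add: right_diff_distrib sum_subtractf)
qed

text \<open>The argument is -arctan (s / (1 + u)) with u quadratic and s linear to leading order.
  Replacing arctan y by y, s / (1 + u) by s and sin by its argument costs the terms with B^3, B^2
  and B. The first, cruder bound serves the single denominator left over in the exponent n +
  1.\<close>

lemma kernel_den_arg_bounds:
  assumes \<beta>: "\<forall>i\<in>K. 0 \<le> \<beta> i" and B: "sum \<beta> K \<le> B" "0 \<le> B" and \<theta>: "\<forall>i\<in>K. \<bar>\<theta> i\<bar> \<le> t" and t: "0 \<le> t"
  shows "\<bar>kernel_arg (kernel_den K \<beta> \<theta>)\<bar> \<le> B * t"
    "\<bar>kernel_arg (kernel_den K \<beta> \<theta>) + (\<Sum>i\<in>K. \<beta> i * \<theta> i)\<bar> \<le> (B + B\<^sup>2 + B ^ 3) * t ^ 3"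
proof -
  define u where "u = (\<Sum>i\<in>K. \<beta> i * (1 - cos (\<theta> i)))"
  define s where "s = (\<Sum>i\<in>K. \<beta> i * sin (\<theta> i))"
  define l where "l = (\<Sum>i\<in>K. \<beta> i * \<theta> i)"
  define y where "y = s / (1 + u)"
  note bounds = kernel_den_bounds[OF \<beta> B(1) \<theta> t, folded u_def s_def l_def]
  have arg: "kernel_arg (kernel_den K \<beta> \<theta>) = - arctan y"
    by (simp add: kernel_arg_def kernel_den_Re_Im y_def s_def u_def arctan_minus)
  have u1: "1 \<le> 1 + u" using bounds(1) by simp
  have "\<bar>y\<bar> = \<bar>s\<bar> / (1 + u)" using u1 by (simp add: y_def)
  also have "\<dots> \<le> \<bar>s\<bar> / 1" using u1 by (intro divide_left_mono) auto
  finally have ys: "\<bar>y\<bar> \<le> \<bar>s\<bar>" by simp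
  then have y: "\<bar>y\<bar> \<le> B * t" using bounds(3) by simp
  have "\<bar>arctan y\<bar> \<le> \<bar>y\<bar>"
    by (rule abs_arctan_le)
  then show "\<bar>kernel_arg (kernel_den K \<beta> \<theta>)\<bar> \<le> B * t" using y by (simp add: arg)
  have 1: "\<bar>arctan y - y\<bar> \<le> B ^ 3 * t ^ 3"
  proof -
    have "\<bar>y\<bar> ^ 3 \<le> (B * t) ^ 3" using y by (intro power_mono) auto
    then show ?thesis using abs_arctan_minus_self_le[of y] by (simp add: power_mult_distrib)
  qed
  have 2: "\<bar>y - s\<bar> \<le> B\<^sup>2 * t ^ 3 / 2"
  proof -
    have "s - y = y * u" using u1 by (simp add: y_def field_simps)
    then have "\<bar>y - s\<bar> = \<bar>y\<bar> * u" using bounds(1) by (simp add: abs_minus_commute[of y s] abs_mult)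
    also have "\<dots> \<le> (B * t) * (B * (t\<^sup>2 / 2))" using y bounds(1,2) B t by (intro mult_mono) auto
    also have "\<dots> = B\<^sup>2 * t ^ 3 / 2" by (simp add: power2_eq_square power3_eq_cube)
    finally show ?thesis .
  qed
  have p: "0 \<le> B * t ^ 3" "0 \<le> B\<^sup>2 * t ^ 3" using B t by auto
  have "(B + B\<^sup>2 + B ^ 3) * t ^ 3 = B * t ^ 3 + B\<^sup>2 * t ^ 3 + B ^ 3 * t ^ 3" by (simp add: algebra_simps)
  then show "\<bar>kernel_arg (kernel_den K \<beta> \<theta>) + (\<Sum>i\<in>K. \<beta> i * \<theta> i)\<bar> \<le> (B + B\<^sup>2 + B ^ 3) * t ^ 3"
    unfolding arg l_def[symmetric] using 1 2 bounds(4) p by linarith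
qed

lemma norm_kernel_den_upper:
  assumes \<beta>: "\<forall>i\<in>K. 0 \<le> \<beta> i" and B: "sum \<beta> K \<le> B" "0 \<le> B" and \<theta>: "\<forall>i\<in>K. \<bar>\<theta> i\<bar> \<le> t" and t: "0 \<le> t" "t \<le> 1"
  shows "(norm (kernel_den K \<beta> \<theta>))\<^sup>2 \<le> exp ((B + 2 * B\<^sup>2) * t\<^sup>2)"
proof -
  define u where "u = (\<Sum>i\<in>K. \<beta> i * (1 - cos (\<theta> i)))"
  define s where "s = (\<Sum>i\<in>K. \<beta> i * sin (\<theta> i))"
  note bounds = kernel_den_bounds[OF \<beta> B(1) \<theta> t(1), folded u_def s_def]
  have "s\<^sup>2 \<le> (B * t)\<^sup>2" using bounds(3) power_mono[of "\<bar>s\<bar>" "B * t" 2] by simp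
  moreover have "u\<^sup>2 \<le> (B * t)\<^sup>2"
  proof (rule power_mono)
    have "t\<^sup>2 / 2 \<le> t" using t by (simp add: power2_eq_square) (smt (verit) mult_left_le)
    then have "B * (t\<^sup>2 / 2) \<le> B * t" using B by (intro mult_left_mono) auto
    then show "u \<le> B * t" using bounds(2) by simp
  qed (use bounds in simp)
  moreover have "(norm (kernel_den K \<beta> \<theta>))\<^sup>2 = 1 + 2 * u + u\<^sup>2 + s\<^sup>2"
    unfolding cmod_power2 kernel_den_Re_Im u_def[symmetric] s_def[symmetric] by (simp add: power2_sum)
  ultimately have "(norm (kernel_den K \<beta> \<theta>))\<^sup>2 \<le> 1 + (B + 2 * B\<^sup>2) * t\<^sup>2"
    using bounds(2) by (simp add: power_mult_distrib algebra_simps)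
  also have "\<dots> \<le> exp ((B + 2 * B\<^sup>2) * t\<^sup>2)" by (rule exp_ge_add_one_self)
  finally show ?thesis .
qed

lemma prod_cis: "(\<Prod>i\<in>K. cis (f i)) = cis (\<Sum>i\<in>K. f i)"
  by (induction K rule: infinite_finite_induct) (auto simp: cis_mult)

text \<open>\<open>kernel_num\<close> is \<open>kernel_den\<close> over a one-point index set, with
  weight \<open>\<tau>\<close> and the sum of the angles as its angle; \<open>undefined\<close>
  merely names that point.\<close>

lemma kernel_num_arg_bound:
  fixes K :: "'d::finite set"
  assumes \<tau>: "0 \<le> \<tau>" and \<theta>: "\<forall>i\<in>K. \<bar>\<theta> i\<bar> \<le> t" and t: "0 \<le> t"
  shows "\<bar>kernel_arg (kernel_num K \<tau> \<theta>) + \<tau> * (\<Sum>i\<in>K. \<theta> i)\<bar> \<le> (\<tau> + \<tau>\<^sup>2 + \<tau> ^ 3) * (real (card K) * t) ^ 3"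
proof -
  have "\<bar>\<Sum>i\<in>K. \<theta> i\<bar> \<le> (\<Sum>i\<in>K. t)" using \<theta> by (intro order_trans[OF sum_abs] sum_mono) auto
  then have "\<bar>\<Sum>i\<in>K. \<theta> i\<bar> \<le> real (card K) * t" by simp
  then have "\<bar>kernel_arg (kernel_den {undefined :: 'd} (\<lambda>_. \<tau>) (\<lambda>_. \<Sum>i\<in>K. \<theta> i))
      + (\<Sum>i\<in>{undefined :: 'd}. \<tau> * (\<Sum>i\<in>K. \<theta> i))\<bar> \<le> (\<tau> + \<tau>\<^sup>2 + \<tau> ^ 3) * (real (card K) * t) ^ 3"
    using \<tau> t by (intro kernel_den_arg_bounds) auto
  moreover have "kernel_den {undefined :: 'd} (\<lambda>_. \<tau>) (\<lambda>_. \<Sum>i\<in>K. \<theta> i) = kernel_num K \<tau> \<theta>"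
    by (simp add: kernel_den_def kernel_num_def prod_cis)
  ultimately show ?thesis by simp
qed

lemma Re_kernel_num_ge_1: "0 \<le> \<tau> \<Longrightarrow> 1 \<le> Re (kernel_num K \<tau> \<theta>)"
  by (simp add: kernel_num_def prod_cis)

text \<open>The stationarity condition \<open>r\<close> cancels the linear part of the phase. What
  remains is n times a cubic error plus the argument of one denominator; \<open>small\<close> bounds
  this by 1, and cos is at least 1/2 on [-1, 1].\<close>

lemma Re_fourier_integrand_ge_half_norm:
  fixes K :: "'d::finite set"
  assumes \<beta>: "\<forall>i\<in>K. 0 \<le> \<beta> i" and \<tau>: "0 \<le> \<tau>" "\<tau> \<le> T"
    and r: "\<forall>i\<in>K. of_int (r i) = real n * (\<beta> i - \<tau>)"
    and B: "sum \<beta> K \<le> B" "0 \<le> B" and \<theta>: "\<forall>i\<in>K. \<bar>\<theta> i\<bar> \<le> t" and t: "0 \<le> t"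
    and small: "real n * (((B + B\<^sup>2 + B ^ 3) + (T + T\<^sup>2 + T ^ 3) * real (card K) ^ 3) * t ^ 3) + B * t \<le> 1"
  shows "norm (fourier_integrand K \<beta> \<tau> n r \<theta>) / 2 \<le> Re (fourier_integrand K \<beta> \<tau> n r \<theta>)"
proof -
  define a where "a = kernel_arg (kernel_num K \<tau> \<theta>)"
  define b where "b = kernel_arg (kernel_den K \<beta> \<theta>)"
  define \<rho> where "\<rho> = (\<Sum>i\<in>K. of_int (r i) * \<theta> i)"
  define \<Theta> where "\<Theta> = real n * a - real (Suc n) * b - \<rho>"
  have num: "kernel_num K \<tau> \<theta> = of_real (norm (kernel_num K \<tau> \<theta>)) * cis a"
    unfolding a_def kernel_arg_def using Re_kernel_num_ge_1[OF \<tau>(1), of K \<theta>]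
    by (intro complex_eq_norm_cis_arctan) simp
  have den: "kernel_den K \<beta> \<theta> = of_real (norm (kernel_den K \<beta> \<theta>)) * cis b"
    unfolding b_def kernel_arg_def using Re_kernel_den_ge_1[OF \<beta>, of \<theta>]
    by (intro complex_eq_norm_cis_arctan) simp
  have ch: "char_torus K r \<theta> = cis (- \<rho>)"
    unfolding char_torus_def \<rho>_def prod_cis by (simp add: sum_negf)
  define x where "x = norm (fourier_integrand K \<beta> \<tau> n r \<theta>)"
  have "fourier_integrand K \<beta> \<tau> n r \<theta>
      = of_real (norm (kernel_num K \<tau> \<theta>) ^ n / norm (kernel_den K \<beta> \<theta>) ^ Suc n)
        * (cis a ^ n / cis b ^ Suc n * cis (- \<rho>))"
    unfolding fourier_integrand_def ch
    by (subst num, subst den) (simp add: power_mult_distrib mult_ac del: power_Suc)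
  also have "cis a ^ n / cis b ^ Suc n * cis (- \<rho>) = cis \<Theta>"
    by (simp only: Complex.DeMoivre cis_divide cis_mult \<Theta>_def add_uminus_conv_diff)
  finally have eq: "fourier_integrand K \<beta> \<tau> n r \<theta> = of_real x * cis \<Theta>"
    unfolding x_def by (simp add: norm_mult norm_divide norm_power)
  have "\<rho> = real n * ((\<Sum>i\<in>K. \<beta> i * \<theta> i) - \<tau> * (\<Sum>i\<in>K. \<theta> i))"
    unfolding \<rho>_def sum_distrib_left sum_subtractf[symmetric]
    by (intro sum.cong refl) (simp add: r[rule_format] algebra_simps)
  then have \<Theta>: "\<Theta> = real n * (a + \<tau> * (\<Sum>i\<in>K. \<theta> i)) - real n * (b + (\<Sum>i\<in>K. \<beta> i * \<theta> i)) - b"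
    unfolding \<Theta>_def by (simp add: algebra_simps)
  have "\<bar>a + \<tau> * (\<Sum>i\<in>K. \<theta> i)\<bar> \<le> (\<tau> + \<tau>\<^sup>2 + \<tau> ^ 3) * (real (card K) * t) ^ 3"
    unfolding a_def by (rule kernel_num_arg_bound[OF \<tau>(1) \<theta> t])
  also have "\<dots> \<le> (T + T\<^sup>2 + T ^ 3) * (real (card K) * t) ^ 3"
    using \<tau> t by (intro mult_right_mono add_mono power_mono) auto
  finally have 1: "\<bar>real n * (a + \<tau> * (\<Sum>i\<in>K. \<theta> i))\<bar> \<le> real n * ((T + T\<^sup>2 + T ^ 3) * (real (card K) * t) ^ 3)"
    unfolding abs_mult by (simp add: mult_left_mono)
  have "\<bar>b + (\<Sum>i\<in>K. \<beta> i * \<theta> i)\<bar> \<le> (B + B\<^sup>2 + B ^ 3) * t ^ 3"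
    unfolding b_def by (rule kernel_den_arg_bounds(2)[OF \<beta> B \<theta> t])
  then have 2: "\<bar>real n * (b + (\<Sum>i\<in>K. \<beta> i * \<theta> i))\<bar> \<le> real n * ((B + B\<^sup>2 + B ^ 3) * t ^ 3)"
    unfolding abs_mult by (simp add: mult_left_mono)
  have 3: "\<bar>b\<bar> \<le> B * t"
    unfolding b_def by (rule kernel_den_arg_bounds(1)[OF \<beta> B \<theta> t])
  have "real n * (((B + B\<^sup>2 + B ^ 3) + (T + T\<^sup>2 + T ^ 3) * real (card K) ^ 3) * t ^ 3)
      = real n * ((B + B\<^sup>2 + B ^ 3) * t ^ 3) + real n * ((T + T\<^sup>2 + T ^ 3) * (real (card K) * t) ^ 3)"
    by (simp add: algebra_simps power_mult_distrib)
  then have "\<bar>\<Theta>\<bar> \<le> 1" unfolding \<Theta> using 1 2 3 small by linarith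
  then have "\<Theta>\<^sup>2 \<le> 1" by (simp add: abs_square_le_1)
  then have "1 / 2 \<le> cos \<Theta>" using one_minus_cos_le[of \<Theta>] by simp
  then have "x * (1 / 2) \<le> x * cos \<Theta>" by (intro mult_left_mono) (auto simp: x_def)
  then show ?thesis unfolding x_def[symmetric] unfolding eq by simp
qed

text \<open>With C = B + 2 B^2, the squared modulus of the denominator is at most exp (C / n), so
  its power n + 1 is at most exp C in modulus, by (n + 1) / (2 n) <= 1. The numerator has modulus at
  least 1.\<close>

lemma norm_fourier_integrand_ge:
  fixes K :: "'d::finite set"
  assumes \<beta>: "\<forall>i\<in>K. 0 \<le> \<beta> i" and \<tau>: "0 \<le> \<tau>" and n: "1 \<le> n"
    and B: "sum \<beta> K \<le> B" "0 \<le> B" and \<theta>: "\<forall>i\<in>K. \<bar>\<theta> i\<bar> \<le> 1 / sqrt (real n)"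
  shows "exp (- (B + 2 * B\<^sup>2)) \<le> norm (fourier_integrand K \<beta> \<tau> n r \<theta>)"
proof -
  define u where "u = norm (kernel_den K \<beta> \<theta>)"
  define C where "C = B + 2 * B\<^sup>2"
  have C: "0 \<le> C" using B by (simp add: C_def)
  have u1: "1 \<le> u" unfolding u_def by (rule norm_kernel_den_ge_1[OF \<beta>])
  have "u\<^sup>2 \<le> exp (C * (1 / sqrt (real n))\<^sup>2)"
    unfolding u_def C_def using n by (intro norm_kernel_den_upper[OF \<beta> B \<theta>]) auto
  also have "C * (1 / sqrt (real n))\<^sup>2 = C / real n" by (simp add: power_divide)
  finally have u2: "u\<^sup>2 \<le> exp (C / real n)" .
  have "(u ^ Suc n)\<^sup>2 = (u\<^sup>2) ^ Suc n" by (simp only: power_mult[symmetric] mult.commute)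
  also have "\<dots> \<le> exp (C / real n) ^ Suc n" using u2 by (intro power_mono) auto
  also have "\<dots> = exp (real (Suc n) * (C / real n))" by (rule exp_of_nat_mult[symmetric])
  also have "\<dots> \<le> exp (2 * C)"
  proof -
    have "real (Suc n) * C \<le> (2 * real n) * C" using n C by (intro mult_right_mono) auto
    then show ?thesis using n by (simp add: field_simps)
  qed
  also have "\<dots> = (exp C)\<^sup>2" by (rule exp_double)
  finally have uC: "u ^ Suc n \<le> exp C" by (rule power2_le_imp_le) simp
  have v: "1 \<le> norm (kernel_num K \<tau> \<theta>)"
    using Re_kernel_num_ge_1[OF \<tau>, of K \<theta>] complex_Re_le_cmod[of "kernel_num K \<tau> \<theta>"] by linarith
  have "exp (- C) = 1 / exp C" by (simp add: exp_minus field_simps)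
  also have "\<dots> \<le> norm (kernel_num K \<tau> \<theta>) ^ n / u ^ Suc n"
    using uC u1 v by (intro frac_le one_le_power) (auto intro: less_le_trans[OF zero_less_one one_le_power] simp del: power_Suc)
  finally show ?thesis unfolding norm_fourier_integrand_eq u_def C_def .
qed

subsection \<open>Positivity of the Fourier integral\<close>

lemma integral_arc_le_lborel:
  fixes f :: "real \<Rightarrow> real"
  assumes f: "integrable lborel f" and nonneg: "\<And>x. 0 \<le> f x"
  shows "integral\<^sup>L arc f \<le> (\<integral>x. f x \<partial>lborel) / (2 * pi)"
proof -
  have m: "f \<in> borel_measurable borel" using f by simp
  have "integral\<^sup>L arc f = (\<integral>x. (indicator {-pi..pi} x / (2 * pi)) *\<^sub>R f x \<partial>lborel)"
    by (rule integral_arc[OF m])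
  also have "\<dots> \<le> (\<integral>x. f x / (2 * pi) \<partial>lborel)"
  proof (rule integral_mono)
    have "integrable lborel (\<lambda>x. indicator {-pi..pi} x *\<^sub>R f x)"
      using f by (intro integrable_mult_indicator) auto
    then have "integrable lborel (\<lambda>x. (1 / (2 * pi)) *\<^sub>R (indicator {-pi..pi} x *\<^sub>R f x))"
      by (rule integrable_scaleR_right)
    then show "integrable lborel (\<lambda>x. (indicator {-pi..pi} x / (2 * pi)) *\<^sub>R f x)" by simp
  qed (use f nonneg in \<open>auto simp: indicator_def divide_right_mono\<close>)
  finally show ?thesis by simp
qed

lemma integral_arc_gaussian_le:
  assumes "0 < \<gamma>"
  shows "(\<integral>x. exp (- (\<gamma> * x\<^sup>2 / 2)) \<partial>arc) \<le> 1 / sqrt (2 * pi * \<gamma>)"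
proof -
  define \<sigma> where "\<sigma> = 1 / sqrt \<gamma>"
  have \<sigma>: "0 < \<sigma>" "\<sigma>\<^sup>2 = 1 / \<gamma>" using assms by (auto simp: \<sigma>_def power_divide)
  have eq: "(\<lambda>x. exp (- (\<gamma> * x\<^sup>2 / 2))) = (\<lambda>x. sqrt (2 * pi * \<sigma>\<^sup>2) * normal_density 0 \<sigma> x)"
  proof
    fix x
    have "sqrt (2 * pi * \<sigma>\<^sup>2) > 0" using \<sigma>(1) by simp
    moreover have "- (x - 0)\<^sup>2 / (2 * \<sigma>\<^sup>2) = - (\<gamma> * x\<^sup>2 / 2)" using assms by (simp add: \<sigma>(2))
    ultimately show "exp (- (\<gamma> * x\<^sup>2 / 2)) = sqrt (2 * pi * \<sigma>\<^sup>2) * normal_density 0 \<sigma> x"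
      using \<sigma>(1) unfolding normal_density_def by simp
  qed
  have int: "integrable lborel (\<lambda>x. exp (- (\<gamma> * x\<^sup>2 / 2)))"
    unfolding eq using \<sigma>(1) by (intro integrable_mult_right integrable_normal_density)
  have "(\<integral>x. exp (- (\<gamma> * x\<^sup>2 / 2)) \<partial>lborel) = sqrt (2 * pi * \<sigma>\<^sup>2)"
    unfolding eq using \<sigma>(1) by simp
  moreover have "(\<integral>x. exp (- (\<gamma> * x\<^sup>2 / 2)) \<partial>arc) \<le> (\<integral>x. exp (- (\<gamma> * x\<^sup>2 / 2)) \<partial>lborel) / (2 * pi)"
    by (rule integral_arc_le_lborel[OF int]) simp
  moreover have "sqrt (2 * pi * \<sigma>\<^sup>2) / (2 * pi) = 1 / sqrt (2 * pi * \<gamma>)"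
  proof -
    have "sqrt (2 * pi * \<sigma>\<^sup>2) = sqrt (2 * pi) / sqrt \<gamma>"
      unfolding \<sigma>(2) by (simp add: real_sqrt_mult real_sqrt_divide)
    moreover have "2 * pi = sqrt (2 * pi) * sqrt (2 * pi)" by simp
    ultimately have "sqrt (2 * pi * \<sigma>\<^sup>2) / (2 * pi) = (sqrt (2 * pi) / sqrt \<gamma>) / (sqrt (2 * pi) * sqrt (2 * pi))"
      by (simp only:)
    moreover have "(x / y) / (x * x) = 1 / (x * y)" if "x \<noteq> 0" for x y :: real
      using that by simp
    then have "(sqrt (2 * pi) / sqrt \<gamma>) / (sqrt (2 * pi) * sqrt (2 * pi)) = 1 / (sqrt (2 * pi) * sqrt \<gamma>)"
      using pi_neq_zero by (metis mult_eq_0_iff real_sqrt_eq_zero_cancel_iff zero_neq_numeral)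
    ultimately show ?thesis by (simp only: real_sqrt_mult)
  qed
  ultimately show ?thesis by simp
qed

lemma integral_arc_indicator:
  assumes "0 \<le> t" "t \<le> pi"
  shows "(\<integral>x. indicator {-t..t} x \<partial>arc) = t / pi"
proof -
  have "(\<integral>x. indicat_real {-t..t} x \<partial>arc) = (\<integral>x. (indicator {-pi..pi} x / (2 * pi)) *\<^sub>R indicat_real {-t..t} x \<partial>lborel)"
    by (intro integral_arc) simp
  also have "\<dots> = (\<integral>x. indicat_real {-t..t} x / (2 * pi) \<partial>lborel)"
    using assms by (intro Bochner_Integration.integral_cong) (auto simp: indicator_def)
  also have "\<dots> = t / pi" using assms by simp
  finally show ?thesis .
qed

lemma torus_integral_prod:
  fixes f :: "real \<Rightarrow> real"
  assumes K: "finite K" and f: "f \<in> borel_measurable borel" "\<And>x. \<bar>f x\<bar> \<le> 1"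
  shows "integrable (torus K) (\<lambda>\<theta>. \<Prod>i\<in>K. f (\<theta> i))"
    "(\<integral>\<theta>. (\<Prod>i\<in>K. f (\<theta> i)) \<partial>torus K) = (integral\<^sup>L arc f) ^ card K"
proof -
  interpret product_sigma_finite "\<lambda>_. arc" by (rule product_sigma_finite_arc)
  interpret A: prob_space arc by (rule prob_space_arc)
  have int: "integrable arc f" using f by (intro A.integrable_const_bound[where B = 1]) auto
  show "integrable (torus K) (\<lambda>\<theta>. \<Prod>i\<in>K. f (\<theta> i))"
    unfolding torus_def by (intro product_integrable_prod K int)
  show "(\<integral>\<theta>. (\<Prod>i\<in>K. f (\<theta> i)) \<partial>torus K) = (integral\<^sup>L arc f) ^ card K"
    unfolding torus_def using product_integral_prod[OF K, of "\<lambda>_. f"] int by simp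
qed

lemma AE_torus:
  assumes "finite K"
  shows "AE \<theta> in torus K. \<forall>i\<in>K. \<bar>\<theta> i\<bar> \<le> pi"
proof -
  have "AE x in arc. \<bar>x\<bar> \<le> pi" by (rule AE_uniform_measureI) (auto simp: abs_le_iff)
  then have "AE \<theta> in torus K. \<bar>\<theta> i\<bar> \<le> pi" if "i \<in> K" for i
    unfolding torus_def using that by (intro AE_PiM_component prob_space_arc)
  then show ?thesis using assms by (simp add: AE_finite_all)
qed

text \<open>The cube of half-side 1 / sqrt n contributes at least b n^(-k/2), and everything outside
  the cube of half-side A / sqrt n at most exp (- \<kappa> A^2 / 2) g n^(-k/2) in absolute value;
  between them the real part is nonnegative. \<open>A\<close> is chosen first, then n. The threshold
  must not depend on \<beta>, \<tau> or r, since it has to serve a whole cone of directions.\<close>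

lemma fourier_coeff_eventually_pos:
  fixes K :: "'d::finite set"
  assumes T: "0 \<le> T" and e: "(4 * real (card K) + 2) * e \<le> 1" "e \<le> 1"
  shows "\<exists>n0. \<forall>n\<ge>n0. \<forall>\<beta> \<tau> r. 0 \<le> \<tau> \<longrightarrow> \<tau> \<le> T \<longrightarrow> (\<forall>i\<in>K. \<bar>\<beta> i - (1 + \<tau>)\<bar> \<le> e)
      \<longrightarrow> (\<forall>i\<in>K. of_int (r i) = real n * (\<beta> i - \<tau>)) \<longrightarrow> 0 < Re (fourier_coeff K \<beta> \<tau> n r)"
proof -
  define k where "k = card K"
  define B where "B = real k * (2 + T)"
  have B: "0 \<le> B" using T by (simp add: B_def)
  define \<kappa> where "\<kappa> = 1 / (36 * (1 + 2 * B)\<^sup>2)"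
  have \<kappa>: "0 < \<kappa>" using B by (simp add: \<kappa>_def)
  define C where "C = B + 2 * B\<^sup>2"
  \<comment> \<open>The central cube has measure (1 / pi)^k n^(-k/2), and the real part of the
    integrand is at least exp (- C) / 2 on it.\<close>
  define b where "b = (exp (- C) / 2) * (1 / pi) ^ k"
  define g where "g = (1 / sqrt (2 * pi * \<kappa>)) ^ k"
  have "b > 0" by (simp add: b_def)
  have g: "g > 0" using \<kappa> by (simp add: g_def)
  have "((\<lambda>A::real. exp (- (\<kappa> * A\<^sup>2 / 2)) * g) \<longlongrightarrow> 0) at_top"
    using \<kappa> by real_asymp
  then have "\<forall>\<^sub>F A in at_top. exp (- (\<kappa> * A\<^sup>2 / 2)) * g < b"
    using \<open>b > 0\<close> by (rule order_tendstoD)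
  then have "\<forall>\<^sub>F A in at_top. exp (- (\<kappa> * A\<^sup>2 / 2)) * g < b \<and> 1 \<le> A"
    using eventually_ge_at_top[of "1::real"] by (rule eventually_conj)
  then obtain A where A: "exp (- (\<kappa> * A\<^sup>2 / 2)) * g < b" "1 \<le> A"
    unfolding eventually_at_top_linorder by blast
  \<comment> \<open>Coefficient of the cubic phase error. On the cube of half-side A / sqrt n, n
    times a cubic term is still of order 1 / sqrt n.\<close>
  define D where "D = (B + B\<^sup>2 + B ^ 3) + (T + T\<^sup>2 + T ^ 3) * real k ^ 3"
  have "((\<lambda>x::real. x * (D * (A * (1 / sqrt x)) ^ 3) + B * (A * (1 / sqrt x))) \<longlongrightarrow> 0) at_top"
    using A(2) by real_asymp
  then have "\<forall>\<^sub>F x in at_top. x * (D * (A * (1 / sqrt x)) ^ 3) + B * (A * (1 / sqrt x)) < 1"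
    by (rule order_tendstoD) simp
  then obtain x0 where x0: "\<And>x. x0 \<le> x \<Longrightarrow> x * (D * (A * (1 / sqrt x)) ^ 3) + B * (A * (1 / sqrt x)) < 1"
    unfolding eventually_at_top_linorder by blast
  define n0 where "n0 = max 1 (nat \<lceil>x0\<rceil>)"
  show ?thesis
  proof (intro exI[of _ n0] allI impI)
    fix n \<beta> \<tau> r
    assume n: "n0 \<le> n" and \<tau>: "0 \<le> \<tau>" "\<tau> \<le> T" and \<beta>e: "\<forall>i\<in>K. \<bar>\<beta> i - (1 + \<tau>)\<bar> \<le> e"
      and r: "\<forall>i\<in>K. of_int (r i) = real n * (\<beta> i - \<tau>)"
    have n1: "1 \<le> n" using n by (simp add: n0_def)
    have nx: "x0 \<le> real n" using n by (simp add: n0_def)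
    have \<beta>b: "0 \<le> \<beta> i \<and> \<beta> i \<le> 2 + T" if "i \<in> K" for i
      using \<beta>e[rule_format, OF that] e(2) \<tau> by (auto simp: abs_le_iff)
    then have \<beta>: "\<forall>i\<in>K. 0 \<le> \<beta> i" by blast
    have sB: "sum \<beta> K \<le> B" using sum_bounded_above[of K \<beta> "2 + T"] \<beta>b by (simp add: B_def k_def)
    define t where "t = 1 / sqrt (real n)"
    have t: "0 < t" "t \<le> 1" "t\<^sup>2 = 1 / real n" using n1 by (auto simp: t_def power_divide)
    define f where "f \<theta> = Re (fourier_integrand K \<beta> \<tau> n r \<theta>)" for \<theta>
    define I where "I \<theta> = (\<Prod>i\<in>K. indicat_real {-t..t} (\<theta> i))" for \<theta>
    define G where "G \<theta> = (\<Prod>i\<in>K. exp (- (real n * \<kappa> * (\<theta> i)\<^sup>2 / 2)))" for \<theta>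
    have small: "real n * (((B + B\<^sup>2 + B ^ 3) + (T + T\<^sup>2 + T ^ 3) * real (card K) ^ 3) * (A * t) ^ 3) + B * (A * t) \<le> 1"
      using x0[OF nx] by (simp add: D_def t_def k_def)
    have G_eq: "G \<theta> = exp (- (real n * \<kappa> * (\<Sum>i\<in>K. (\<theta> i)\<^sup>2) / 2))" for \<theta>
      unfolding G_def by (simp add: exp_sum[symmetric] sum_negf sum_divide_distrib sum_distrib_left)
    have I1: "I \<theta> = (if \<forall>i\<in>K. \<bar>\<theta> i\<bar> \<le> t then 1 else 0)" for \<theta>
    proof -
      have ind: "indicat_real {-t..t} x = (if \<bar>x\<bar> \<le> t then 1 else 0)" for x
        by (auto simp: indicator_def abs_le_iff)
      show ?thesis
      proof (cases "\<forall>i\<in>K. \<bar>\<theta> i\<bar> \<le> t")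
        case False
        then show ?thesis unfolding I_def ind by (auto intro!: prod_zero)
      qed (simp add: I_def ind)
    qed
    have pointwise: "exp (- C) / 2 * I \<theta> - exp (- (\<kappa> * A\<^sup>2 / 2)) * G \<theta> \<le> f \<theta>" if \<theta>: "\<forall>i\<in>K. \<bar>\<theta> i\<bar> \<le> pi" for \<theta>
    proof (cases "\<forall>i\<in>K. \<bar>\<theta> i\<bar> \<le> A * t")
      case True
      have half: "norm (fourier_integrand K \<beta> \<tau> n r \<theta>) / 2 \<le> f \<theta>"
        unfolding f_def using A(2) t by (intro Re_fourier_integrand_ge_half_norm[OF \<beta> \<tau> r sB B True _ small]) simp
      have "exp (- C) / 2 * I \<theta> \<le> norm (fourier_integrand K \<beta> \<tau> n r \<theta>) / 2"
      proof (cases "\<forall>i\<in>K. \<bar>\<theta> i\<bar> \<le> t")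
        case True
        then have "exp (- C) \<le> norm (fourier_integrand K \<beta> \<tau> n r \<theta>)"
          unfolding C_def t_def by (rule norm_fourier_integrand_ge[OF \<beta> \<tau>(1) n1 sB B])
        then show ?thesis using True by (simp add: I1)
      next
        case False
        then have "I \<theta> = 0" unfolding I1 by (rule if_not_P)
        then show ?thesis by simp
      qed
      moreover have "0 \<le> exp (- (\<kappa> * A\<^sup>2 / 2)) * G \<theta>" by (simp add: G_eq)
      ultimately show ?thesis using half by linarith
    next
      case False
      then obtain j where j: "j \<in> K" "A * t < \<bar>\<theta> j\<bar>" by (auto simp: not_le)
      have "t \<le> A * t" using A(2) t by simp
      then have "I \<theta> = 0" using j by (force simp: I1)
      define S where "S = (\<Sum>i\<in>K. (\<theta> i)\<^sup>2)"
      have "(A * t)\<^sup>2 \<le> \<bar>\<theta> j\<bar>\<^sup>2" using j A(2) t by (intro power_mono) auto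
      also have "\<bar>\<theta> j\<bar>\<^sup>2 \<le> S" unfolding S_def power2_abs using j by (intro member_le_sum) auto
      finally have "real n * (A * t)\<^sup>2 \<le> real n * S" by (rule mult_left_mono) simp
      then have AS: "A\<^sup>2 \<le> real n * S" using t(3) n1 by (simp add: power_mult_distrib)
      have "\<bar>f \<theta>\<bar> \<le> norm (fourier_integrand K \<beta> \<tau> n r \<theta>)" unfolding f_def by (rule abs_Re_le_cmod)
      also have "\<dots> \<le> exp (- (real n * \<kappa> * S))"
        unfolding \<kappa>_def S_def
        by (rule norm_fourier_integrand_le_gaussian[OF \<beta> \<tau>(1) \<beta>e e(1) sB \<theta>])
      \<comment> \<open>The exponent is split in two: one half yields the small factor in A, the
        other stays under the integral and supplies the decay n^(-k/2).\<close>
      also have "\<dots> \<le> exp (- (\<kappa> * A\<^sup>2 / 2) - real n * \<kappa> * S / 2)"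
      proof -
        have "\<kappa> * A\<^sup>2 \<le> \<kappa> * (real n * S)" using \<kappa> by (intro mult_left_mono[OF AS]) simp
        moreover have "\<kappa> * (real n * S) = real n * \<kappa> * S" by simp
        ultimately have "- (real n * \<kappa> * S) \<le> - (\<kappa> * A\<^sup>2 / 2) - real n * \<kappa> * S / 2" by linarith
        then show ?thesis by simp
      qed
      also have "\<dots> = exp (- (\<kappa> * A\<^sup>2 / 2)) * G \<theta>"
        unfolding G_eq S_def mult_exp_exp by (simp only: diff_conv_add_uminus)
      finally show ?thesis using \<open>I \<theta> = 0\<close> by simp
    qed
    have "finite K" by simp
    have intI: "integrable (torus K) I" "integral\<^sup>L (torus K) I = (t / pi) ^ k"
      using torus_integral_prod[OF \<open>finite K\<close>, of "indicat_real {-t..t}"] integral_arc_indicator[of t] t pi_gt3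
      unfolding I_def[abs_def] k_def by (simp_all add: indicator_def)
    have G_arc: "(\<integral>x. exp (- (real n * \<kappa> * x\<^sup>2 / 2)) \<partial>arc) \<le> t * (1 / sqrt (2 * pi * \<kappa>))"
    proof -
      have "sqrt (2 * pi * (real n * \<kappa>)) = sqrt (real n) * sqrt (2 * pi * \<kappa>)"
        by (simp add: real_sqrt_mult)
      moreover have "(\<integral>x. exp (- (real n * \<kappa> * x\<^sup>2 / 2)) \<partial>arc) \<le> 1 / sqrt (2 * pi * (real n * \<kappa>))"
        using n1 \<kappa> by (intro integral_arc_gaussian_le) simp
      ultimately show ?thesis by (simp add: t_def)
    qed
    have gm: "(\<lambda>x. exp (- (real n * \<kappa> * x\<^sup>2 / 2))) \<in> borel_measurable borel" by measurable
    have gb: "\<bar>exp (- (real n * \<kappa> * x\<^sup>2 / 2))\<bar> \<le> 1" for x using \<kappa> by simp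
    have intG: "integrable (torus K) G" "integral\<^sup>L (torus K) G \<le> t ^ k * g"
    proof -
      show "integrable (torus K) G"
        unfolding G_def[abs_def] by (rule torus_integral_prod(1)[OF \<open>finite K\<close> gm gb])
      have "integral\<^sup>L (torus K) G = (\<integral>x. exp (- (real n * \<kappa> * x\<^sup>2 / 2)) \<partial>arc) ^ k"
        unfolding G_def[abs_def] k_def by (rule torus_integral_prod(2)[OF \<open>finite K\<close> gm gb])
      also have "\<dots> \<le> (t * (1 / sqrt (2 * pi * \<kappa>))) ^ k"
        by (rule power_mono[OF G_arc]) (simp add: integral_nonneg)
      finally show "integral\<^sup>L (torus K) G \<le> t ^ k * g" by (simp only: power_mult_distrib g_def)
    qed
    have int_f: "integrable (torus K) f"
      unfolding f_def[abs_def] by (intro integrable_Re integrable_fourier_integrand[OF \<beta> \<tau>(1)])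
    have "0 < t ^ k * (b - exp (- (\<kappa> * A\<^sup>2 / 2)) * g)"
      using t A(1) by simp
    also have "\<dots> = exp (- C) / 2 * (t / pi) ^ k - exp (- (\<kappa> * A\<^sup>2 / 2)) * (t ^ k * g)"
      by (simp add: b_def power_divide algebra_simps)
    also have "\<dots> \<le> exp (- C) / 2 * integral\<^sup>L (torus K) I - exp (- (\<kappa> * A\<^sup>2 / 2)) * integral\<^sup>L (torus K) G"
      using intG(2) intI(2) by simp
    also have "\<dots> = (\<integral>\<theta>. exp (- C) / 2 * I \<theta> - exp (- (\<kappa> * A\<^sup>2 / 2)) * G \<theta> \<partial>torus K)"
      using intI(1) intG(1) by simp
    also have "\<dots> \<le> integral\<^sup>L (torus K) f"
    proof (rule integral_mono_AE)
      show "AE \<theta> in torus K. exp (- C) / 2 * I \<theta> - exp (- (\<kappa> * A\<^sup>2 / 2)) * G \<theta> \<le> f \<theta>"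
        using AE_torus[OF \<open>finite K\<close>] by eventually_elim (rule pointwise)
    qed (use intI(1) intG(1) int_f in auto)
    also have "\<dots> = Re (fourier_coeff K \<beta> \<tau> n r)"
      unfolding f_def[abs_def] fourier_coeff_def
      by (rule integral_Re) (rule integrable_fourier_integrand[OF \<beta> \<tau>(1)])
    finally show "0 < Re (fourier_coeff K \<beta> \<tau> n r)" .
  qed
qed

subsection \<open>Positivity near the diagonal\<close>

text \<open>For c <= 0 all terms of the recurrence are nonnegative, and from any nonzero index a
  unit step down leads to a positive one. With c = 0 it also gives the nonzero constant coefficient
  used for the sign changes.\<close>

lemma coeff_pos_if_nonpos:
  fixes a :: "nat ^ 'd::finite \<Rightarrow> real"
  assumes ps: "has_power_series_at_0 (F c) a" and c: "c \<le> 0"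
  shows "0 < a r"
proof -
  have "(\<forall>i. 0 \<le> q i) \<longrightarrow> 0 < coeff_ext a q" for q
  proof (induction "nat (\<Sum>i\<in>UNIV. q i)" arbitrary: q rule: less_induct)
    case less
    show ?case
    proof
      assume q: "\<forall>i. 0 \<le> q i"
      have nn: "0 \<le> coeff_ext a p" if "(\<Sum>i\<in>UNIV. p i) < (\<Sum>i\<in>UNIV. q i)" for p
      proof (cases "\<forall>i. 0 \<le> p i")
        case True
        then have "0 \<le> (\<Sum>i\<in>UNIV. p i)" by (intro sum_nonneg) auto
        then have "nat (\<Sum>i\<in>UNIV. p i) < nat (\<Sum>i\<in>UNIV. q i)" using that by simp
        then show ?thesis using less[of p] True by simp
      next
        case False
        then have "coeff_ext a p = 0" unfolding coeff_ext_def by (rule if_not_P)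
        then show ?thesis by simp
      qed
      have s: "(\<Sum>j\<in>UNIV. (q(i := q i - 1)) j) < (\<Sum>j\<in>UNIV. q j)" for i
        by (rule sum_strict_mono_ex1) auto
      have "0 \<le> coeff_ext a (\<lambda>i. q i - 1)"
        by (intro nn sum_strict_mono) auto
      with c have "c * coeff_ext a (\<lambda>i. q i - 1) \<le> 0" by (rule mult_nonpos_nonneg)
      then have 1: "0 \<le> - c * coeff_ext a (\<lambda>i. q i - 1)" by simp
      have 2: "0 \<le> (\<Sum>i\<in>UNIV. coeff_ext a (q(i := q i - 1)))"
        by (intro sum_nonneg nn s)
      show "0 < coeff_ext a q"
      proof (cases "q = (\<lambda>_. 0)")
        case True
        then show ?thesis using coeff_recurrence[OF ps, of q] 1 2 by simp
      next
        case False
        then obtain i where "q i \<noteq> 0" by auto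
        then have "0 < q i" using q by (simp add: order_less_le)
        then have q': "\<forall>j. 0 \<le> (q(i := q i - 1)) j" using q by simp
        then have "0 \<le> (\<Sum>j\<in>UNIV. (q(i := q i - 1)) j)" by (intro sum_nonneg) auto
        then have "0 < coeff_ext a (q(i := q i - 1))"
          using less[of "q(i := q i - 1)"] s[of i] q' by simp
        also have "\<dots> \<le> (\<Sum>i\<in>UNIV. coeff_ext a (q(i := q i - 1)))"
          by (rule member_le_sum[of i]) (auto intro: nn s)
        finally show ?thesis using coeff_recurrence[OF ps, of q] 1 False by simp
      qed
    qed
  qed
  from this[of "\<lambda>i. int (r $ i)"] show ?thesis by (simp add: coeff_ext_def)
qed

text \<open>Distances are relative to coordinate \<open>j\<close>, which makes the set a cone and
  puts every ratio r_i / r_j within \<open>e\<close> of 1.\<close>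

definition diag_cone :: "'d \<Rightarrow> real \<Rightarrow> (real ^ 'd) set" where
  "diag_cone j e = {x. \<forall>i. 0 < x $ i \<and> \<bar>x $ i - x $ j\<bar> < e * x $ j}"

lemma conical_nbhd_diag_cone:
  assumes "0 < e"
  shows "conical_nbhd_of_diagonal (diag_cone (j :: 'd::finite) e)"
  unfolding conical_nbhd_of_diagonal_def
proof (intro conjI ballI allI impI)
  show "open (diag_cone j e)"
  proof -
    have "diag_cone j e = (\<Inter>i\<in>UNIV. {x. 0 < x $ i \<and> \<bar>x $ i - x $ j\<bar> < e * x $ j})"
      by (auto simp: diag_cone_def)
    moreover have "open \<dots>"
      by (intro open_INT finite_class.finite_UNIV ballI open_Collect_conj open_Collect_less continuous_intros)
    ultimately show ?thesis by simp
  qed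
  show "diag_cone j e \<subseteq> {x. \<forall>i. 0 < x $ i}" by (auto simp: diag_cone_def)
  show "(\<chi> i. 1) \<in> diag_cone j e" using assms by (simp add: diag_cone_def)
next
  fix x :: "real ^ 'd" and t :: real
  assume x: "x \<in> diag_cone j e" and t: "0 < t"
  have "\<bar>t * x $ i - t * x $ j\<bar> < e * (t * x $ j)" for i
  proof -
    have "t * \<bar>x $ i - x $ j\<bar> < t * (e * x $ j)"
      using x t by (intro mult_strict_left_mono) (auto simp: diag_cone_def)
    moreover have "\<bar>t * x $ i - t * x $ j\<bar> = t * \<bar>x $ i - x $ j\<bar>"
      using t by (simp add: abs_mult flip: right_diff_distrib)
    ultimately show ?thesis by (simp add: mult_ac)
  qed
  then show "t *\<^sub>R x \<in> diag_cone j e" using x t by (simp add: diag_cone_def)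
qed

lemma coeff_pos_near_diagonal:
  fixes a :: "nat ^ 'd::finite \<Rightarrow> real" and j0 :: 'd
  assumes d: "2 \<le> CARD('d)" and ps: "has_power_series_at_0 (F c) a"
    and c: "0 < c" "c < c_star CARD('d)"
  shows "\<exists>e>0. finite {r. real_vec r \<in> diag_cone j0 e \<and> \<not> a r > 0}"
proof -
  define d where "d = CARD('d)"
  define K where "K = UNIV - {j0}"
  have K: "finite K" "j0 \<notin> K" "card K = d - 1" by (auto simp: K_def d_def)
  have UK: "UNIV = insert j0 K" by (auto simp: K_def)
  \<comment> \<open>The largest width that \<open>kernel_norm_gap\<close> admits.\<close>
  define e where "e = 1 / (4 * real (card K) + 2)"
  have e: "0 < e" "(4 * real (card K) + 2) * e \<le> 1" "e \<le> 1" by (auto simp: e_def)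
  \<comment> \<open>An upper end \<open>T\<close> for \<tau> common to all directions. Since
    \<alpha>_i <= 2, the product of the \<alpha>_i + T is at most T^d (1 + 2 / T)^d, while T V^(d-1)
    is at least c_star T^d.\<close>
  have "((\<lambda>T. c * (1 + 2 * inverse T) ^ d) \<longlongrightarrow> c * (1 + 2 * 0) ^ d) at_top"
    by (intro tendsto_intros tendsto_inverse_0_at_top filterlim_ident)
  then have "\<forall>\<^sub>F T in at_top. c * (1 + 2 * inverse T) ^ d < c_star d"
    using c by (intro order_tendstoD) (auto simp: d_def)
  then have "\<forall>\<^sub>F T in at_top. c * (1 + 2 * inverse T) ^ d < c_star d \<and> 0 < T"
    using eventually_gt_at_top[of "0::real"] by (rule eventually_conj)
  then obtain T where T: "c * (1 + 2 * inverse T) ^ d < c_star d" "0 < T"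
    unfolding eventually_at_top_linorder by blast
  obtain n0 where n0_all: "\<forall>n\<ge>n0. \<forall>\<beta> \<tau> r. 0 \<le> \<tau> \<longrightarrow> \<tau> \<le> T \<longrightarrow> (\<forall>i\<in>K. \<bar>\<beta> i - (1 + \<tau>)\<bar> \<le> e)
      \<longrightarrow> (\<forall>i\<in>K. of_int (r i) = real n * (\<beta> i - \<tau>)) \<longrightarrow> 0 < Re (fourier_coeff K \<beta> \<tau> n r)"
    using fourier_coeff_eventually_pos[OF less_imp_le[OF T(2)] e(2,3)] ..
  note n0 = n0_all[rule_format]
  have pos: "0 < a r" if r: "real_vec r \<in> diag_cone j0 e" and n: "n0 \<le> r $ j0" for r
  proof -
    define n where "n = r $ j0"
    have npos: "0 < real n" using r by (auto simp: diag_cone_def real_vec_def n_def)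
    define \<alpha> where "\<alpha> i = real (r $ i) / real n" for i
    have \<alpha>: "0 < \<alpha> i" "\<bar>\<alpha> i - 1\<bar> < e" for i
    proof -
      have ri: "0 < real (r $ i)" "\<bar>real (r $ i) - real n\<bar> < e * real n"
        using r by (auto simp: diag_cone_def real_vec_def n_def)
      show "0 < \<alpha> i" using ri npos by (simp add: \<alpha>_def)
      have "\<alpha> i - 1 = (real (r $ i) - real n) / real n" using npos by (simp add: \<alpha>_def diff_divide_distrib)
      then have "\<bar>\<alpha> i - 1\<bar> = \<bar>real (r $ i) - real n\<bar> / real n" by simp
      also have "\<dots> < e" using ri npos by (simp add: pos_divide_less_eq)
      finally show "\<bar>\<alpha> i - 1\<bar> < e" .
    qed
    have \<alpha>j: "\<alpha> j0 = 1" using npos by (simp add: \<alpha>_def n_def)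
    \<comment> \<open>The quantity 1 / (1 - s) as a function of \<tau>, namely one plus the
      \<beta>_i over \<open>K\<close>, made symmetric by \<alpha>_j0 = 1.\<close>
    define V where "V \<tau> = sum \<alpha> UNIV + (real d - 1) * \<tau>" for \<tau>
    \<comment> \<open>A zero of \<open>E\<close> is the parameter of the critical point for the direction \<open>\<alpha>\<close>.\<close>
    define E where "E \<tau> = \<tau> * V \<tau> ^ (d - 1) - c * (\<Prod>i\<in>UNIV. \<alpha> i + \<tau>)" for \<tau>
    have "E 0 \<le> 0" using c \<alpha>(1) by (simp add: E_def prod_nonneg less_imp_le)
    moreover have "0 \<le> E T"
    proof -
      have "(\<Prod>i\<in>UNIV. \<alpha> i + T) \<le> (\<Prod>i\<in>(UNIV :: 'd set). 2 + T)"
      proof (rule prod_mono)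
        fix i show "0 \<le> \<alpha> i + T \<and> \<alpha> i + T \<le> 2 + T"
          using \<alpha>[of i] e(3) T(2) by (auto simp: abs_less_iff)
      qed
      then have "c * (\<Prod>i\<in>UNIV. \<alpha> i + T) \<le> c * (2 + T) ^ d"
        using c by (simp add: d_def mult_left_mono)
      also have "(2 + T) ^ d = T ^ d * (1 + 2 * inverse T) ^ d"
        using T(2) by (simp add: power_mult_distrib[symmetric] field_simps)
      also have "c * (T ^ d * (1 + 2 * inverse T) ^ d) = T ^ d * (c * (1 + 2 * inverse T) ^ d)" by simp
      also have "\<dots> \<le> T ^ d * c_star d" using T by (intro mult_left_mono) auto
      also have "\<dots> = T * ((real d - 1) * T) ^ (d - 1)"
        using d by (cases d) (auto simp: c_star_def power_mult_distrib d_def)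
      also have "\<dots> \<le> T * V T ^ (d - 1)"
      proof -
        have "0 \<le> sum \<alpha> UNIV" using \<alpha>(1) by (intro sum_nonneg) (simp add: less_imp_le)
        then show ?thesis using T(2) d by (intro mult_left_mono power_mono) (auto simp: V_def d_def)
      qed
      finally show ?thesis by (simp add: E_def)
    qed
    moreover have "continuous_on {0..T} E"
      unfolding E_def V_def by (intro continuous_intros)
    ultimately obtain \<tau> where \<tau>: "0 \<le> \<tau>" "\<tau> \<le> T" "E \<tau> = 0"
      using IVT'[of E 0 0 T] T(2) by auto
    define \<beta> where "\<beta> i = \<alpha> i + \<tau>" for i
    have \<beta>pos: "0 < \<beta> i" for i using \<alpha>(1)[of i] \<tau>(1) by (simp add: \<beta>_def)
    have V: "V \<tau> = 1 + sum \<beta> K"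
    proof -
      have "sum \<alpha> UNIV = 1 + sum \<alpha> K" using K by (subst UK) (simp add: \<alpha>j)
      moreover have "real (card K) = real d - 1" unfolding K(3) using d by (simp add: d_def of_nat_diff)
      ultimately show ?thesis by (simp add: V_def \<beta>_def sum.distrib)
    qed
    have Vpos: "0 < V \<tau>" unfolding V using \<beta>pos by (intro add_pos_nonneg sum_nonneg) (auto intro: less_imp_le)
    have crit: "c * (1 + \<tau>) * (\<Prod>i\<in>K. \<beta> i / V \<tau>) = \<tau>"
    proof -
      have "(\<Prod>i\<in>UNIV. \<alpha> i + \<tau>) = (1 + \<tau>) * prod \<beta> K"
        using K by (subst UK) (simp add: \<alpha>j \<beta>_def)
      then have "c * (1 + \<tau>) * prod \<beta> K = \<tau> * V \<tau> ^ (d - 1)" using \<tau>(3) by (simp add: E_def)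
      then show ?thesis using Vpos by (simp add: prod_dividef K(3))
    qed
    have "complex_of_real (a r) = of_real (V \<tau> * (V \<tau> / (1 + \<tau>)) ^ (r $ j0) * (\<Prod>i\<in>K. (V \<tau> / \<beta> i) ^ (r $ i)))
        * fourier_coeff K \<beta> \<tau> (r $ j0) (\<lambda>i. int (r $ i))"
      using coeff_eq_fourier_coeff[OF ps, of j0 \<beta> \<tau> "V \<tau>" r] \<beta>pos \<tau>(1) V crit by (simp add: K_def)
    then have "Re (complex_of_real (a r)) = Re (of_real (V \<tau> * (V \<tau> / (1 + \<tau>)) ^ (r $ j0) * (\<Prod>i\<in>K. (V \<tau> / \<beta> i) ^ (r $ i)))
        * fourier_coeff K \<beta> \<tau> (r $ j0) (\<lambda>i. int (r $ i)))" by (rule arg_cong)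
    then have "a r = (V \<tau> * (V \<tau> / (1 + \<tau>)) ^ (r $ j0) * (\<Prod>i\<in>K. (V \<tau> / \<beta> i) ^ (r $ i)))
        * Re (fourier_coeff K \<beta> \<tau> (r $ j0) (\<lambda>i. int (r $ i)))"
      by (simp only: times_complex.sel Re_complex_of_real Im_complex_of_real mult_zero_left diff_zero)
    moreover have "0 < Re (fourier_coeff K \<beta> \<tau> (r $ j0) (\<lambda>i. int (r $ i)))"
    proof (rule n0[OF n \<tau>(1,2)])
      show "\<bar>\<beta> i - (1 + \<tau>)\<bar> \<le> e" for i using \<alpha>(2) by (simp add: \<beta>_def less_imp_le)
      show "of_int (int (r $ i)) = real (r $ j0) * (\<beta> i - \<tau>)" for i
        using npos by (simp add: \<beta>_def \<alpha>_def n_def)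
    qed
    moreover have "0 < V \<tau> * (V \<tau> / (1 + \<tau>)) ^ (r $ j0) * (\<Prod>i\<in>K. (V \<tau> / \<beta> i) ^ (r $ i))"
      using Vpos \<beta>pos \<tau>(1) by (intro mult_pos_pos zero_less_power prod_pos ballI divide_pos_pos) auto
    ultimately show ?thesis by simp
  qed
  \<comment> \<open>Since e <= 1, all entries in the cone are at most twice the entry at
    \<open>j0\<close>, so bounding that one entry leaves finitely many vectors.\<close>
  have "{r. real_vec r \<in> diag_cone j0 e \<and> \<not> a r > 0} \<subseteq> {r. \<forall>i. r $ i \<le> 2 * n0}"
  proof (intro subsetI CollectI allI)
    fix r i assume "r \<in> {r. real_vec r \<in> diag_cone j0 e \<and> \<not> a r > 0}"
    then have r: "real_vec r \<in> diag_cone j0 e" "r $ j0 < n0" using pos[of r] by (auto simp: not_le[symmetric])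
    then have "\<bar>real (r $ i) - real (r $ j0)\<bar> < e * real (r $ j0)" by (auto simp: diag_cone_def real_vec_def)
    also have "\<dots> \<le> 1 * real (r $ j0)" using e by (intro mult_right_mono) auto
    finally have "real (r $ i) \<le> 2 * real (r $ j0)" by (simp add: abs_less_iff)
    then show "r $ i \<le> 2 * n0" using r(2) by linarith
  qed
  then have "finite {r. real_vec r \<in> diag_cone j0 e \<and> \<not> a r > 0}"
    by (rule finite_subset) (rule finite_bounded_nat_vec)
  with e(1) show ?thesis by blast
qed

lemma finite_diag_if_cone:
  fixes a :: "nat ^ 'd::finite \<Rightarrow> real"
  assumes N: "conical_nbhd_of_diagonal N" and fin: "finite {r. real_vec r \<in> N \<and> \<not> a r > 0}"
  shows "finite {n. \<not> diag_coeff a n > 0}"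
proof -
  have inj: "inj (\<lambda>n. (\<chi> i. n) :: nat ^ 'd)" by (auto simp: inj_on_def vec_eq_iff)
  have "{n. \<not> diag_coeff a n > 0} \<subseteq> insert 0 ((\<lambda>n. \<chi> i. n) -` {r. real_vec r \<in> N \<and> \<not> a r > 0})"
  proof
    fix n assume n: "n \<in> {n. \<not> diag_coeff a n > 0}"
    have "real_vec (\<chi> i. n) \<in> N" if "n \<noteq> 0"
    proof -
      have "real n *\<^sub>R (\<chi> i. 1) \<in> N" using N that by (simp add: conical_nbhd_of_diagonal_def)
      moreover have "real n *\<^sub>R (\<chi> i. 1) = (real_vec (\<chi> i. n) :: real ^ 'd)" by (simp add: real_vec_def vec_eq_iff)
      ultimately show ?thesis by simp
    qed
    then show "n \<in> insert 0 ((\<lambda>n. \<chi> i. n) -` {r. real_vec r \<in> N \<and> \<not> a r > 0})"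
      using n by (auto simp: diag_coeff_def)
  qed
  moreover have "finite (insert 0 ((\<lambda>n. \<chi> i. n) -` {r. real_vec r \<in> N \<and> \<not> a r > 0}))"
    by (rule finite.insertI[OF finite_vimageI[OF fin inj]])
  ultimately show ?thesis by (rule finite_subset)
qed

theorem theorem9:
  fixes c :: real and a :: "nat ^ 'd::finite \<Rightarrow> real"
  assumes "CARD('d) \<ge> 4"
    and "has_power_series_at_0 (F c) a"
  shows "(c < c_star CARD('d) \<longrightarrow> finite {n. \<not> diag_coeff a n > 0})
    \<and> (c > c_star CARD('d) \<longrightarrow>
         infinite {n. diag_coeff a n > 0} \<and> infinite {n. diag_coeff a n < 0})
    \<and> (c < c_star CARD('d) \<longrightarrow>
         (\<exists>N :: (real ^ 'd) set. conical_nbhd_of_diagonal N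
            \<and> finite {r. real_vec r \<in> N \<and> \<not> a r > 0}))"
proof -
  have cone: "\<exists>N :: (real ^ 'd) set. conical_nbhd_of_diagonal N \<and> finite {r. real_vec r \<in> N \<and> \<not> a r > 0}"
    if c: "c < c_star CARD('d)"
  proof (cases "0 < c")
    case True
    fix j0 :: 'd
    obtain e where "e > 0" "finite {r. real_vec r \<in> diag_cone j0 e \<and> \<not> a r > 0}"
      using coeff_pos_near_diagonal[OF _ assms(2) True c, of j0] assms(1) by auto
    then show ?thesis using conical_nbhd_diag_cone[of e j0] by blast
  next
    case False
    then have "a r > 0" for r using coeff_pos_if_nonpos[OF assms(2)] by simp
    \<comment> \<open>All coefficients are positive here, so any coordinate and any width give a
      suitable cone.\<close>
    moreover obtain j0 :: 'd where True by blast
    ultimately show ?thesis using conical_nbhd_diag_cone[of 1 j0] by auto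
  qed
  have signs: "infinite {n. diag_coeff a n > 0} \<and> infinite {n. diag_coeff a n < 0}" if c: "c > c_star CARD('d)"
  proof -
    obtain M :: "nat ^ 'd \<Rightarrow> real" where M: "has_power_series_at_0 (F 0) M"
      using F_has_power_series_at_0_exists by blast
    note expl = coeff_explicit[OF assms(2) M] and bd = diag_coeff_geometric_bounds[OF M]
    have M0: "diag_coeff M 0 \<noteq> 0" using coeff_pos_if_nonpos[OF M] by (simp add: diag_coeff_def less_imp_neq[THEN not_sym])
    have "infinite {n. diag_coeff a n < 0}"
      by (rule substituted_series_no_eventual_sign[OF _ c M0 expl]) (use assms(1) bd in auto)
    \<comment> \<open>The formula is linear in the coefficients of \<open>F 0\<close>, so it
      persists when both sequences are negated, and the same lemma produces the positive
      signs.\<close>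
    moreover have "infinite {n. - diag_coeff a n < 0}"
    proof (rule substituted_series_no_eventual_sign[OF _ c, where g = "\<lambda>n. - diag_coeff M n"])
      show "- diag_coeff a n = (\<Sum>k\<le>n. (- c) ^ k * real (CARD('d) * (n - k) + k choose k) * - diag_coeff M (n - k))" for n
        unfolding expl by (simp add: sum_negf)
    qed (use assms(1) bd M0 in auto)
    ultimately show ?thesis by simp
  qed
  show ?thesis
  proof (intro conjI impI)
    assume "c < c_star CARD('d)"
    then show "finite {n. \<not> diag_coeff a n > 0}" using cone finite_diag_if_cone by blast
  qed (use cone signs in blast)+
qed

end
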